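(* Let $N\ge3$, $\mu\ge0$, assume (K0) and (F0), and let $p_S(\alpha)<p<p_{JL}(\alpha)$. Let $r^*>0$ and let $u^*$ be a singular solution of $u''+\frac{N-1}{r}u'+K(r)u^p+\mu f(r)=0$, $u>0$, on $(0,r^* )$ (i.e. $\lim_{r\to0}u^*(r)=\infty$). Then for each $\rho\in(0,r^*]$, $$\mathcal{Z}_{(0,\rho)}\big[u(\cdot,\zeta)-u^*\big]\to\infty\quad\text{as }\zeta\to\infty.$$
   Context: (K0): $K:(0,\infty)\to(0,\infty)$ is continuous and $K(r)=(k_0+o(1))r^{\alpha}$ as $r\to0$ for some $\alpha>-2$, $k_0>0$. (F0): $f:(0,\infty)\to[0,\infty)$ is continuous, not identically zero, and $f(r)=O(r^{\nu})$ as $r\to0$ for some $\nu>-2$. $p_S(\alpha):=\frac{N+2+2\alpha}{N-2}$; $p_{JL}(\alpha):=1+\frac{2(2+\alpha)}{N-4-\alpha-\sqrt{(2+\alpha)(2N-2+\alpha)}}$ if $N>10+4\alpha$, and $p_{JL}(\alpha):=\infty$ if $N\le10+4\alpha$. For $\zeta>0$, $u(\cdot,\zeta)$ denotes the regular solution of $u''+\frac{N-1}{r}u'+K(r)\max\{u,0\}^p+\mu f(r)=0$ with $u(0)=\zeta$, i.e. the continuous solution on $[0,\infty)$ of $u(r)=\zeta-\int_0^r\frac{s^{2-N}-r^{2-N}}{N-2}s^{N-1}\big(K(s)\max\{u(s),0\}^p+\mu f(s)\big)ds$. For an interval $I$ and a function $h$ on $I$, $\mathcal{Z}_I[h]$ denotes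 the number of zeros of $h$ in $I$. *)

theory Defs
  imports "HOL-Analysis.Analysis" "HOL-Library.Landau_Symbols" "HOL-Library.Extended_Nat"
begin

definition p_S :: "nat \<Rightarrow> real \<Rightarrow> real" where
  "p_S N \<alpha> = (real N + 2 + 2*\<alpha>) / (real N - 2)"

definition p_JL :: "nat \<Rightarrow> real \<Rightarrow> ereal" where
  "p_JL N \<alpha> = (if real N > 10 + 4*\<alpha>
     then ereal (1 + 2*(2+\<alpha>) / (real N - 4 - \<alpha> - sqrt ((2+\<alpha>)*(2*real N - 2 + \<alpha>))))
     else \<infinity>)"

definition cond_K0 :: "(real \<Rightarrow> real) \<Rightarrow> real \<Rightarrow> bool" where
  "cond_K0 K \<alpha> \<longleftrightarrow> \<alpha> > -2 \<and> continuous_on {0<..} K \<and> (\<forall>r>0. K r > 0) \<and>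
     (\<exists>k0>0. ((\<lambda>r. K r / r powr \<alpha>) \<longlongrightarrow> k0) (at_right 0))"

definition cond_F0 :: "(real \<Rightarrow> real) \<Rightarrow> bool" where
  "cond_F0 f \<longleftrightarrow> continuous_on {0<..} f \<and> (\<forall>r>0. f r \<ge> 0) \<and> (\<exists>r>0. f r \<noteq> 0) \<and>
     (\<exists>\<nu>>-2. f \<in> O[at_right 0](\<lambda>r. r powr \<nu>))"

definition regular_solution ::
  "nat \<Rightarrow> (real \<Rightarrow> real) \<Rightarrow> (real \<Rightarrow> real) \<Rightarrow> real \<Rightarrow> real \<Rightarrow> real \<Rightarrow> (real \<Rightarrow> real) \<Rightarrow> bool" where
  "regular_solution N K f \<mu> p \<zeta> u \<longleftrightarrow> continuous_on {0..} u \<and>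
     (\<forall>r\<ge>0. ((\<lambda>s. (s powr (2 - real N) - r powr (2 - real N)) / (real N - 2) * s powr (real N - 1)
                    * (K s * (max (u s) 0) powr p + \<mu> * f s))
              has_integral (\<zeta> - u r)) {0..r})"

definition singular_solution ::
  "nat \<Rightarrow> (real \<Rightarrow> real) \<Rightarrow> (real \<Rightarrow> real) \<Rightarrow> real \<Rightarrow> real \<Rightarrow> real \<Rightarrow> (real \<Rightarrow> real) \<Rightarrow> bool" where
  "singular_solution N K f \<mu> p R u \<longleftrightarrow>
     (\<exists>u' u''. \<forall>r\<in>{0<..<R}. (u has_real_derivative u' r) (at r) \<and>
        (u' has_real_derivative u'' r) (at r) \<and> u r > 0 \<and>
        u'' r + (real N - 1) / r * u' r + K r * (u r) powr p + \<mu> * f r = 0)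
     \<and> filterlim u at_top (at_right 0)"

definition zero_count :: "real set \<Rightarrow> (real \<Rightarrow> real) \<Rightarrow> enat" where
  "zero_count I h = (if finite {r\<in>I. h r = 0} then enat (card {r\<in>I. h r = 0}) else \<infinity>)"

end

theory Submission
  imports Defs
begin

text \<open>
  In the variables \<open>t = ln r\<close>, \<open>U = r\<^sup>\<theta> u\<close> with \<open>\<theta> = (2 + \<alpha>) / (p - 1)\<close>, the equation becomes a small
  perturbation, as \<open>t\<close> tends to \<open>-\<infinity>\<close>, of the damped autonomous equation
  \<open>U'' + a U' - b U + k\<^sub>0 U\<^sup>p = 0\<close>, whose energy is a Lyapunov function for \<open>p > p\<^sub>S\<close>.
  A strict Lyapunov function that tolerates small perturbations shows that an orbit of negative energy
  is driven, within a time bounded uniformly in the orbit, to the positive equilibrium, and stays there.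
  Regular orbits start with \<open>U\<close> close to \<open>\<zeta> exp (\<theta> t)\<close>, so they reach negative energy near
  \<open>t = - ln \<zeta> / \<theta>\<close>. Running time backwards, a singular orbit either has negative energy at arbitrarily
  negative times or tends to zero; in the latter case the Riccati equation for \<open>- r u' / u\<close> shows that \<open>u\<close>
  is bounded at the origin, a contradiction. Hence both orbits are near the equilibrium on a \<open>t\<close>-interval
  of length tending to infinity with \<open>\<zeta>\<close>, and there their difference oscillates by Sturm comparison, since
  \<open>p < p\<^sub>J\<^sub>L\<close> says precisely that the linearisation at the equilibrium has complex eigenvalues.
\<close>

section \<open>Differential inequalities\<close>

text \<open>Both critical exponents become conditions on two constants. \<open>damp\<close> is N - 2
  - 2 \<theta>, positive exactly for p > p_S. At the positive equilibrium the force has derivative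
  -(p - 1) \<open>spring\<close>, so the characteristic polynomial there is x^2 +
  \<open>damp\<close> x + (p - 1) \<open>spring\<close>, with non-real roots iff
  \<open>damp\<close>^2 / 4 < (p - 1) \<open>spring\<close>. The first obstacle is uniformity in
  \<zeta>. No limit orbit is extracted; instead every constant depends only on an energy level and
  on a box that contains all orbits considered, so the waiting time near the equilibrium is the same
  for all large \<zeta>. The second obstacle is sign. A regular solution solves a truncated equation
  and might become negative. Its positivity is a consequence of negative energy, which keeps U away
  from 0. The companion variable P = \<theta> U - V is used next to the velocity V because P is
  driven by a nonnegative source, which yields the signs and the bounds that V does not offer
  directly.\<close>

lemma deriv_diff_le:
  fixes F D :: "real \<Rightarrow> real"
  assumes "s \<le> t" and "\<And>x. s \<le> x \<Longrightarrow> x \<le> t \<Longrightarrow> (F has_real_derivative D x) (at x)"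
    and "\<And>x. s \<le> x \<Longrightarrow> x \<le> t \<Longrightarrow> D x \<le> k"
  shows "F t - F s \<le> k * (t - s)"
proof (cases "s = t")
  case False
  then have "s < t" using assms(1) by simp
  from MVT2[OF this assms(2)] obtain z where z: "s < z" "z < t" "F t - F s = (t - s) * D z" by auto
  have "(t - s) * D z \<le> (t - s) * k"
    using z assms(3)[of z] by (intro mult_left_mono) auto
  then show ?thesis using z by (simp add: mult.commute)
qed simp

lemma deriv_diff_ge:
  fixes F D :: "real \<Rightarrow> real"
  assumes "s \<le> t" and "\<And>x. s \<le> x \<Longrightarrow> x \<le> t \<Longrightarrow> (F has_real_derivative D x) (at x)"
    and "\<And>x. s \<le> x \<Longrightarrow> x \<le> t \<Longrightarrow> k \<le> D x"
  shows "k * (t - s) \<le> F t - F s"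
proof -
  have "(\<lambda>x. - F x) t - (\<lambda>x. - F x) s \<le> - k * (t - s)"
    using assms by (intro deriv_diff_le[where D = "\<lambda>x. - D x"] DERIV_minus) auto
  then show ?thesis by simp
qed

text \<open>At the last time at which \<open>L\<close> is at most M its value is M, and the negative
  derivative there keeps \<open>L\<close> below M a little longer. Only the derivative at the level
  M itself is controlled.\<close>

lemma barrier:
  fixes L D :: "real \<Rightarrow> real"
  assumes st: "s \<le> t" and D: "\<And>x. s \<le> x \<Longrightarrow> x \<le> t \<Longrightarrow> (L has_real_derivative D x) (at x)"
    and Ls: "L s \<le> M" and neg: "\<And>x. s \<le> x \<Longrightarrow> x \<le> t \<Longrightarrow> L x = M \<Longrightarrow> D x < 0"
  shows "L t \<le> M"
proof (rule ccontr)
  assume Lt: "\<not> L t \<le> M"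
  define S where "S = {s..t} \<inter> L -` {..M}"
  have cont: "continuous_on {s..t} L"
    using D by (intro continuous_at_imp_continuous_on ballI) (auto intro: DERIV_isCont)
  have clS: "closed S" unfolding S_def
    using continuous_closed_preimage[OF cont closed_atLeastAtMost closed_atMost] by simp
  have ne: "S \<noteq> {}" "bdd_above S" using st Ls by (auto simp: S_def intro: bdd_aboveI[of _ t])
  define x where "x = Sup S"
  have xS: "x \<in> S" unfolding x_def using closed_contains_Sup[OF ne clS] .
  then have x: "s \<le> x" "x < t" "L x \<le> M" using Lt by (auto simp: S_def) (metis order_le_less)
  have above: "L y > M" if "x < y" "y \<le> t" for y
  proof (rule ccontr)
    assume "\<not> L y > M"
    then have "y \<in> S" using that x by (auto simp: S_def)
    then have "y \<le> x" unfolding x_def using ne by (intro cSup_upper)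
    then show False using that by simp
  qed
  have "L x = M"
  proof (rule ccontr)
    assume "L x \<noteq> M"
    then have lt: "L x < M" using x by simp
    have "\<exists>z\<ge>x. z \<le> t \<and> L z = M"
      using x lt Lt cont by (intro IVT') (auto intro: continuous_on_subset)
    then obtain z where "x \<le> z" "z \<le> t" "L z = M" by auto
    then show False using above[of z] lt by (cases "z = x") auto
  qed
  then have "D x < 0" using neg x by simp
  then obtain d where d: "d > 0" "\<And>h. 0 < h \<Longrightarrow> h < d \<Longrightarrow> L (x + h) < L x"
    using DERIV_neg_dec_right[OF D[of x]] x by auto
  define h where "h = min (d / 2) (t - x)"
  have h: "0 < h" "h < d" "x + h \<le> t" using d x by (auto simp: h_def min_def)
  show False using d(2)[OF h(1,2)] above[of "x + h"] h \<open>L x = M\<close> by auto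
qed

text \<open>The data of a regular orbit sit at t = -\<infinity>, so its bounds come from monotone
  combinations whose limit there is known.\<close>

lemma ge_limit_at_bot:
  fixes F D :: "real \<Rightarrow> real"
  assumes "\<And>x. x \<le> t \<Longrightarrow> (F has_real_derivative D x) (at x)" "\<And>x. x \<le> t \<Longrightarrow> 0 \<le> D x"
    and "(F \<longlongrightarrow> l) at_bot"
  shows "l \<le> F t"
proof (rule tendsto_upperbound[OF assms(3)])
  show "\<forall>\<^sub>F s in at_bot. F s \<le> F t"
    using eventually_le_at_bot[of t]
  proof eventually_elim
    case (elim s)
    then show ?case using deriv_diff_ge[of s t F D 0] assms by auto
  qed
qed simp

text \<open>If \<open>S\<close> reached e far to the left, the bound on its derivative would keep it
  at least e/2 on an interval of fixed length, and \<open>F\<close> would drop there by a fixed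
  amount. This is impossible for a convergent \<open>F\<close>.\<close>

lemma barbalat:
  fixes F S F' S' r :: "real \<Rightarrow> real"
  assumes "\<forall>\<^sub>F t in at_bot. (F has_real_derivative F' t) (at t)"
    and "\<forall>\<^sub>F t in at_bot. (S has_real_derivative S' t) (at t)"
    and "\<forall>\<^sub>F t in at_bot. \<bar>S' t\<bar> \<le> B" and "\<forall>\<^sub>F t in at_bot. 0 \<le> S t"
    and "\<forall>\<^sub>F t in at_bot. F' t \<le> - d * S t + r t" and "(r \<longlongrightarrow> 0) at_bot"
    and "d > 0" and "(F \<longlongrightarrow> l) at_bot"
  shows "(S \<longlongrightarrow> 0) at_bot"
proof (rule tendstoI)
  fix e :: real assume e: "e > 0"
  define C where "C = max B 1"
  have C: "C > 0" "B \<le> C" by (auto simp: C_def)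
  \<comment> \<open>At speed at most \<open>C\<close>, \<open>S\<close> needs at least this time to
    fall from e to e/2. Meanwhile the dissipation d e/2 exceeds \<open>r\<close> by d e/4, so
    \<open>F\<close> drops by d e l'/4, which is twice the tolerated distance d e l'/8 from its
    limit.\<close>
  define l' where "l' = e / (2 * C)"
  have l': "l' > 0" using e C by (simp add: l'_def)
  have "\<forall>\<^sub>F t in at_bot. \<bar>r t\<bar> < d * e / 4"
    using tendstoD[OF assms(6), of "d * e / 4"] e assms(7) by (simp add: dist_real_def)
  moreover have "\<forall>\<^sub>F t in at_bot. \<bar>F t - l\<bar> < d * e * l' / 8"
    using tendstoD[OF assms(8), of "d * e * l' / 8"] e assms(7) l' by (simp add: dist_real_def)
  ultimately have "\<forall>\<^sub>F t in at_bot. (F has_real_derivative F' t) (at t) \<and> (S has_real_derivative S' t) (at t)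
     \<and> \<bar>S' t\<bar> \<le> B \<and> 0 \<le> S t \<and> F' t \<le> - d * S t + r t \<and> \<bar>r t\<bar> < d * e / 4 \<and> \<bar>F t - l\<bar> < d * e * l' / 8"
    using assms(1-5) by eventually_elim auto
  then obtain t1 where t1: "\<And>t. t \<le> t1 \<Longrightarrow> (F has_real_derivative F' t) (at t) \<and> (S has_real_derivative S' t) (at t)
     \<and> \<bar>S' t\<bar> \<le> B \<and> 0 \<le> S t \<and> F' t \<le> - d * S t + r t \<and> \<bar>r t\<bar> < d * e / 4 \<and> \<bar>F t - l\<bar> < d * e * l' / 8"
    unfolding eventually_at_bot_linorder by auto
  have "S t < e" if t: "t \<le> t1 - l'" for t
  proof (rule ccontr)
    assume St: "\<not> S t < e"
    have S_ge: "S x \<ge> e / 2" if x: "t \<le> x" "x \<le> t + l'" for x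
    proof -
      have "- C * (x - t) \<le> S x - S t"
      proof (rule deriv_diff_ge)
        fix y assume y: "t \<le> y" "y \<le> x"
        with x t have "y \<le> t1" by auto
        then show "(S has_real_derivative S' y) (at y)" "- C \<le> S' y"
          using t1[of y] C by auto
      qed (use x in auto)
      moreover have "C * (x - t) \<le> C * l'" using x C by (intro mult_left_mono) auto
      moreover have "C * l' = e / 2" using C by (simp add: l'_def)
      ultimately show ?thesis using St by auto
    qed
    have "F (t + l') - F t \<le> (- (d * e / 4)) * (t + l' - t)"
    proof (rule deriv_diff_le)
      fix x assume x: "t \<le> x" "x \<le> t + l'"
      show "(F has_real_derivative F' x) (at x)" using t1 x t by auto
      have "d * S x \<ge> d * (e / 2)" using S_ge[OF x] assms(7) by (intro mult_left_mono) auto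
      moreover have "F' x \<le> - d * S x + r x" "\<bar>r x\<bar> < d * e / 4" using t1[of x] x t by auto
      ultimately show "F' x \<le> - (d * e / 4)" by auto
    qed (use l' in auto)
    moreover have "\<bar>F t - l\<bar> < d * e * l' / 8" "\<bar>F (t + l') - l\<bar> < d * e * l' / 8"
      using t1[of t] t1[of "t + l'"] t l' by auto
    ultimately show False by (auto simp: field_simps abs_if split: if_splits)
  qed
  then show "\<forall>\<^sub>F t in at_bot. dist (S t) 0 < e"
    unfolding eventually_at_bot_linorder using t1 l'
    by (intro exI[of _ "t1 - l'"]) (auto simp: dist_real_def)
qed

text \<open>Sturm comparison of \<open>exp (a t / 2) D\<close> with a sine of frequency \<open>w\<close>.\<close>

lemma sturm_not_positive:
  fixes D D' D'' :: "real \<Rightarrow> real"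
  assumes w: "w > 0"
    and D: "\<And>t. x \<le> t \<Longrightarrow> t \<le> x + pi / w \<Longrightarrow> (D has_real_derivative D' t) (at t)"
    and D': "\<And>t. x \<le> t \<Longrightarrow> t \<le> x + pi / w \<Longrightarrow> (D' has_real_derivative D'' t) (at t)"
    and ineq: "\<And>t. x \<le> t \<Longrightarrow> t \<le> x + pi / w \<Longrightarrow> D'' t + a * D' t + (w\<^sup>2 + a\<^sup>2 / 4) * D t \<le> 0"
    and pos: "\<And>t. x \<le> t \<Longrightarrow> t \<le> x + pi / w \<Longrightarrow> D t > 0"
  shows False
proof -
  \<comment> \<open>The Wronskian of exp (a t / 2) D and sin (w (t - x)). The inequality makes it
    nonincreasing where the sine is nonnegative, but at the two ends only the cosine term survives
    and gives a negative and then a positive value.\<close>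
  define W where "W t = exp (a * t / 2) * ((D' t + a / 2 * D t) * sin (w * (t - x)) - D t * w * cos (w * (t - x)))" for t
  have "W (x + pi / w) - W x \<le> 0 * (x + pi / w - x)"
  proof (rule deriv_diff_le)
    fix t assume t: "x \<le> t" "t \<le> x + pi / w"
    show "(W has_real_derivative exp (a * t / 2) * sin (w * (t - x)) * (D'' t + a * D' t + (w\<^sup>2 + a\<^sup>2 / 4) * D t)) (at t)"
      unfolding W_def using D[OF t] D'[OF t]
      by (auto intro!: derivative_eq_intros simp: algebra_simps power2_eq_square add_divide_distrib)
    have "w * (t - x) \<le> pi" using t w by (simp add: field_simps)
    then have "sin (w * (t - x)) \<ge> 0" using t w by (intro sin_ge_zero) auto
    then show "exp (a * t / 2) * sin (w * (t - x)) * (D'' t + a * D' t + (w\<^sup>2 + a\<^sup>2 / 4) * D t) \<le> 0"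
      using ineq[OF t] by (intro mult_nonneg_nonpos) auto
  qed (use w in auto)
  moreover have "W x = - (exp (a * x / 2) * D x * w)" by (simp add: W_def)
  moreover have "W (x + pi / w) = exp (a * (x + pi / w) / 2) * D (x + pi / w) * w"
    using w by (simp add: W_def)
  moreover have "exp (a * x / 2) * D x * w > 0" "exp (a * (x + pi / w) / 2) * D (x + pi / w) * w > 0"
    using w pos[of x] pos[of "x + pi / w"] by auto
  ultimately show False by simp
qed

text \<open>Windows of length L are separated by gaps of length L, so that points chosen in
  different windows are distinct.\<close>

lemma disjoint_window_points:
  fixes a L :: real
  assumes L: "L > 0" and ex: "\<And>j. j < M \<Longrightarrow> \<exists>x. a + 2 * real j * L \<le> x \<and> x \<le> a + 2 * real j * L + L \<and> Q x"
  obtains X where "finite X" "card X = M" "\<And>x. x \<in> X \<Longrightarrow> Q x"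
proof -
  obtain x where x: "\<And>j. j < M \<Longrightarrow> a + 2 * real j * L \<le> x j \<and> x j \<le> a + 2 * real j * L + L \<and> Q (x j)"
    using ex by metis
  have less: "x i < x j" if "i < j" "j < M" for i j
  proof -
    have "(2 * real i + 1) * L < 2 * real j * L" using that L by (intro mult_strict_right_mono) auto
    then show ?thesis using x[of i] x[of j] that by (auto simp: algebra_simps)
  qed
  then have "inj_on x {..<M}" by (intro inj_onI) (metis lessThan_iff less_irrefl linorder_neqE_nat)
  then show ?thesis using x by (intro that[of "x ` {..<M}"]) (auto simp: card_image)
qed

section \<open>The autonomous Emden-Fowler equation under small perturbations\<close>

text \<open>\<open>\<theta>\<close> and \<open>- c\<close> are the eigenvalues of the linearisation
  at the origin. In the application c = N - 2 - \<theta>, and \<open>c > \<theta>\<close> expresses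
  p > p_S.\<close>

locale emden =
  fixes \<theta> c p k0 :: real
  assumes \<theta>_pos: "\<theta> > 0" and c_gt: "c > \<theta>" and p_gt: "p > 1" and k0_pos: "k0 > 0"
begin

section \<open>Force, energy and equilibria\<close>

definition damp :: real where "damp = c - \<theta>"
definition spring :: real where "spring = \<theta> * c"
definition force :: "real \<Rightarrow> real" where "force U = spring * U - k0 * U powr p"
definition force' :: "real \<Rightarrow> real" where "force' U = spring - k0 * p * U powr (p - 1)"
definition energy :: "real \<Rightarrow> real \<Rightarrow> real" where
  "energy U V = V\<^sup>2 / 2 - spring * U\<^sup>2 / 2 + k0 * U powr (p + 1) / (p + 1)"
definition Ueq :: real where "Ueq = (spring / k0) powr (1 / (p - 1))"
definition Emin :: real where "Emin = energy Ueq 0"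

text \<open>\<open>V\<close> is the velocity and \<open>G\<close> a perturbing force seen as a
  function of time along this orbit. The condition is pointwise in t, so it can be asserted on a
  half-line or up to a time at which positivity might fail.\<close>

definition orbit :: "(real \<Rightarrow> real) \<Rightarrow> (real \<Rightarrow> real) \<Rightarrow> (real \<Rightarrow> real) \<Rightarrow> real \<Rightarrow> bool" where
  "orbit G U V t \<longleftrightarrow> 0 < U t \<and> (U has_real_derivative V t) (at t) \<and>
     (V has_real_derivative - damp * V t + force (U t) - G t) (at t)"

lemma damp_pos: "damp > 0" and spring_pos: "spring > 0" and c_pos: "c > 0"
  using \<theta>_pos c_gt by (auto simp: damp_def spring_def)

lemma Ueq_pos: "Ueq > 0" using spring_pos k0_pos by (simp add: Ueq_def)

lemma Ueq_powr: "Ueq powr (p - 1) = spring / k0"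
  using spring_pos k0_pos p_gt by (simp add: Ueq_def powr_powr)

lemma powr_p: "U \<ge> 0 \<Longrightarrow> U powr p = U * U powr (p - 1)" for U :: real
  using powr_add[of U 1 "p - 1"] by (cases "U = 0") auto

lemma powr_Suc_p: "U \<ge> 0 \<Longrightarrow> U powr (p + 1) = U * U powr p" for U :: real
  using powr_add[of U 1 p] by (cases "U = 0") (auto simp: add.commute)

lemma force_eq: "U \<ge> 0 \<Longrightarrow> force U = U * (spring - k0 * U powr (p - 1))"
  by (simp add: force_def powr_p algebra_simps)

lemma force_zero_iff: "U \<ge> 0 \<Longrightarrow> force U = 0 \<longleftrightarrow> U = 0 \<or> U = Ueq"
proof -
  assume U: "U \<ge> 0"
  have "spring - k0 * U powr (p - 1) = 0 \<longleftrightarrow> U powr (p - 1) = Ueq powr (p - 1)"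
    using k0_pos by (auto simp: Ueq_powr field_simps)
  also have "\<dots> \<longleftrightarrow> U = Ueq"
    using U Ueq_pos p_gt powr_inj[of "p - 1"]
    by (metis diff_gt_0_iff_gt less_eq_real_def powr_less_mono2 order_less_irrefl linorder_less_linear)
  finally show ?thesis using U by (simp add: force_eq)
qed

text \<open>Eliminating the power term between the energy and U times the force leaves a positive
  multiple of U^2. At the equilibrium this makes \<open>Emin\<close> negative; along an orbit whose
  velocity, energy and force all tend to 0 it forces U to 0.\<close>

lemma energy_force: "U \<ge> 0 \<Longrightarrow>
  spring * (p - 1) / (2 * (p + 1)) * U\<^sup>2 = V\<^sup>2 / 2 - energy U V - U * force U / (p + 1)"
proof -
  assume U: "U \<ge> 0"
  define q where "q = 1 / (p + 1)"
  have q: "(p - 1) / (2 * (p + 1)) = 1 / 2 - q" "x / (p + 1) = x * q" for x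
    using p_gt by (simp_all add: q_def divide_simps)
  have "spring * (p - 1) / (2 * (p + 1)) * U\<^sup>2 = spring * (1 / 2 - q) * U\<^sup>2"
    unfolding q(1)[symmetric] by simp
  then show ?thesis
    unfolding energy_def force_def powr_Suc_p[OF U] q(2) by (simp add: algebra_simps power2_eq_square)
qed

lemma Emin_neg: "Emin < 0"
proof -
  have "spring * (p - 1) / (2 * (p + 1)) * Ueq\<^sup>2 > 0"
    using spring_pos p_gt Ueq_pos by simp
  then show ?thesis
    using energy_force[of Ueq 0] Ueq_pos force_zero_iff[of Ueq] by (simp add: Emin_def)
qed

lemma DERIV_force: "U > 0 \<Longrightarrow> (force has_real_derivative force' U) (at U)"
  unfolding force_def[abs_def] force'_def by (auto intro!: derivative_eq_intros)

lemma DERIV_potential: "U > 0 \<Longrightarrow> ((\<lambda>U. energy U V) has_real_derivative - force U) (at U)"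
proof -
  assume "U > 0"
  then have "((\<lambda>U. energy U V) has_real_derivative
      0 - spring * (2 * U) / 2 + k0 * ((p + 1) * U powr p) / (p + 1)) (at U)"
    unfolding energy_def[abs_def] by (auto intro!: derivative_eq_intros)
  moreover have "k0 * ((p + 1) * U powr p) / (p + 1) = k0 * U powr p" using p_gt by simp
  ultimately show ?thesis by (simp add: force_def)
qed

lemma continuous_on_energy: "continuous_on ({0..} \<times> UNIV) (\<lambda>z. energy (fst z) (snd z))"
  unfolding energy_def using p_gt
  by (intro continuous_intros continuous_on_powr') auto

lemma continuous_on_force: "continuous_on {0..} force"
  unfolding force_def[abs_def] using p_gt
  by (intro continuous_intros continuous_on_powr') auto

lemma force_bounds:
  assumes "C > 0"
  obtains B where "B > 0" "\<And>U. 0 \<le> U \<Longrightarrow> U \<le> C \<Longrightarrow> \<bar>force U\<bar> \<le> B \<and> \<bar>force' U\<bar> \<le> B"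
proof
  define B where "B = spring * C + k0 * C powr p + (spring + k0 * p * C powr (p - 1))"
  have pos: "spring * C > 0" "k0 * C powr p > 0" "k0 * p * C powr (p - 1) > 0"
    using spring_pos k0_pos p_gt assms by auto
  then show "B > 0" using spring_pos by (simp add: B_def)
  fix U :: real assume U: "0 \<le> U" "U \<le> C"
  have "0 \<le> spring * U" "spring * U \<le> spring * C" "0 \<le> k0 * U powr p" "k0 * U powr p \<le> k0 * C powr p"
    "0 \<le> k0 * p * U powr (p - 1)" "k0 * p * U powr (p - 1) \<le> k0 * p * C powr (p - 1)"
    using U spring_pos k0_pos p_gt by (auto intro!: mult_left_mono powr_mono2)
  then show "\<bar>force U\<bar> \<le> B \<and> \<bar>force' U\<bar> \<le> B"
    using pos spring_pos unfolding force_def force'_def B_def by linarith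
qed

text \<open>A compactness argument: the points of the box whose energy is at distance at least e
  from both 0 and \<open>Emin\<close> form a compact set without equilibria, on which V^2 + force^2
  has a positive minimum.\<close>

lemma near_equilibrium:
  assumes "e > 0"
  obtains s where "s > 0" "\<And>U V. 0 \<le> U \<Longrightarrow> U \<le> C \<Longrightarrow> \<bar>V\<bar> \<le> C \<Longrightarrow> V\<^sup>2 + (force U)\<^sup>2 < s \<Longrightarrow>
    \<bar>energy U V\<bar> < e \<or> \<bar>energy U V - Emin\<bar> < e"
proof -
  define X where "X = {0..C} \<times> {-C..C}"
  let ?E = "\<lambda>z. energy (fst z) (snd z)"
  define S where "S = X \<inter> ?E -` ({..-e} \<union> {e..}) \<inter> (X \<inter> ?E -` ({..Emin-e} \<union> {Emin+e..}))"
  have X: "compact X" "X \<subseteq> {0..} \<times> UNIV" unfolding X_def by (auto intro!: compact_Times)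
  have contE: "continuous_on X ?E" using continuous_on_energy X continuous_on_subset by blast
  have "closed S" unfolding S_def
    using contE X by (intro closed_Int continuous_closed_preimage closed_Un) (auto intro: compact_imp_closed)
  moreover have "S \<subseteq> X" by (auto simp: S_def)
  ultimately have S: "compact S" using X by (metis compact_Int_closed inf.absorb2)
  have contS: "continuous_on S (\<lambda>z. (snd z)\<^sup>2 + (force (fst z))\<^sup>2)"
  proof (intro continuous_intros)
    show "continuous_on S (\<lambda>z. force (fst z))"
      by (rule continuous_on_compose2[OF continuous_on_force]) (auto intro!: continuous_intros simp: S_def X_def)
  qed
  have posS: "(snd z)\<^sup>2 + (force (fst z))\<^sup>2 > 0" if z: "z \<in> S" for z
  proof (rule ccontr)
    assume "\<not> ?thesis"
    then have "snd z = 0" "force (fst z) = 0"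
      using sum_power2_gt_zero_iff by blast+
    moreover have "fst z \<ge> 0" using z by (auto simp: S_def X_def)
    ultimately have "?E z = 0 \<or> ?E z = Emin"
      using force_zero_iff[of "fst z"] p_gt by (auto simp: Emin_def energy_def)
    then show False using z assms by (auto simp: S_def)
  qed
  have "\<exists>s>0. \<forall>z\<in>S. s \<le> (snd z)\<^sup>2 + (force (fst z))\<^sup>2"
  proof (cases "S = {}")
    case True
    then show ?thesis by (intro exI[of _ 1]) auto
  next
    case False
    from continuous_attains_inf[OF S False contS] posS show ?thesis by blast
  qed
  then obtain s where s: "s > 0" "\<And>z. z \<in> S \<Longrightarrow> s \<le> (snd z)\<^sup>2 + (force (fst z))\<^sup>2" by auto
  show ?thesis
  proof (rule that[OF s(1)])
    fix U V assume UV: "0 \<le> U" "U \<le> C" "\<bar>V\<bar> \<le> C" "V\<^sup>2 + (force U)\<^sup>2 < s"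
    then have "(U, V) \<notin> S" using s(2)[of "(U, V)"] by auto
    then show "\<bar>energy U V\<bar> < e \<or> \<bar>energy U V - Emin\<bar> < e"
      using UV by (auto simp: S_def X_def abs_le_iff abs_less_iff)
  qed
qed

text \<open>The energy alone dissipates only through \<open>V\<^sup>2\<close>; the cross term makes the decay strict away
  from the equilibria \<open>(0, 0)\<close> and \<open>(Ueq, 0)\<close>, uniformly under small perturbations \<open>G\<close>.\<close>

definition lyap :: "real \<Rightarrow> real \<Rightarrow> real \<Rightarrow> real" where
  "lyap l U V = energy U V - l * V * force U"
definition lyap' :: "real \<Rightarrow> real \<Rightarrow> real \<Rightarrow> real \<Rightarrow> real" where
  "lyap' l U V G = V * (- damp * V + force U - G) - force U * V
     - l * ((- damp * V + force U - G) * force U + V * (force' U * V))"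

lemma orbit_energy:
  assumes "orbit G U V t"
  shows "((\<lambda>t. energy (U t) (V t)) has_real_derivative - damp * (V t)\<^sup>2 - G t * V t) (at t)"
proof -
  have 1: "((\<lambda>t. energy (U t) 0) has_real_derivative - force (U t) * V t) (at t)"
    using DERIV_chain2[OF DERIV_potential, of U t] assms by (auto simp: orbit_def)
  have "((\<lambda>t. energy (U t) 0 + (V t)\<^sup>2 / 2) has_real_derivative - force (U t) * V t
      + 2 * V t * (- damp * V t + force (U t) - G t) / 2) (at t)"
    using assms by (auto simp: orbit_def intro!: derivative_eq_intros 1)
  moreover have "energy (U t) 0 + (V t)\<^sup>2 / 2 = energy (U t) (V t)" for t by (simp add: energy_def)
  moreover have "- force (U t) * V t + 2 * V t * (- damp * V t + force (U t) - G t) / 2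
      = - damp * (V t)\<^sup>2 - G t * V t"
    by (simp add: power2_eq_square diff_divide_distrib add_divide_distrib algebra_simps)
  ultimately show ?thesis by simp
qed

lemma orbit_force:
  "orbit G U V t \<Longrightarrow> ((\<lambda>t. force (U t)) has_real_derivative force' (U t) * V t) (at t)"
  using DERIV_chain2[OF DERIV_force, of U t] by (auto simp: orbit_def)

lemma orbit_V_force:
  assumes "orbit G U V t"
  shows "((\<lambda>t. V t * force (U t)) has_real_derivative
     (- damp * V t + force (U t) - G t) * force (U t) + V t * (force' (U t) * V t)) (at t)"
  using assms by (auto simp: orbit_def intro!: derivative_eq_intros orbit_force)

lemma orbit_lyap:
  assumes "orbit G U V t"
  shows "((\<lambda>t. lyap l (U t) (V t)) has_real_derivative lyap' l (U t) (V t) (G t)) (at t)"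
proof -
  have "((\<lambda>t. energy (U t) (V t) - l * (V t * force (U t))) has_real_derivative
     - damp * (V t)\<^sup>2 - G t * V t
     - l * ((- damp * V t + force (U t) - G t) * force (U t) + V t * (force' (U t) * V t))) (at t)"
    using orbit_energy[OF assms] orbit_V_force[OF assms] by (intro DERIV_diff DERIV_cmult)
  then show ?thesis
    by (simp add: lyap_def lyap'_def algebra_simps power2_eq_square)
qed

text \<open>The derivative of \<open>lyap\<close> contains - damp V^2 from the energy and - l F^2
  from the cross term. For small l the mixed terms are absorbed, leaving - l (V^2 + F^2) / 2 plus a
  multiple of \<open>G\<close>. This is strictly negative unless V^2 + F^2 < s, where
  \<open>near_equilibrium\<close> locates the energy and hence \<open>lyap\<close>.\<close>

lemma lyap_decay:
  assumes e: "e > 0" and C: "C > 0"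
  obtains l \<eta> w where "l > 0" "\<eta> > 0" "w > 0"
    "\<And>U V G. 0 \<le> U \<Longrightarrow> U \<le> C \<Longrightarrow> \<bar>V\<bar> \<le> C \<Longrightarrow> \<bar>G\<bar> \<le> w \<Longrightarrow>
      \<bar>lyap l U V - energy U V\<bar> \<le> e \<and>
      (lyap' l U V G \<le> - \<eta> \<or> \<bar>lyap l U V\<bar> < e \<or> \<bar>lyap l U V - Emin\<bar> < e)"
proof -
  from force_bounds[OF C] obtain B where B: "B > 0"
    "\<And>U. 0 \<le> U \<Longrightarrow> U \<le> C \<Longrightarrow> \<bar>force U\<bar> \<le> B \<and> \<bar>force' U\<bar> \<le> B" by metis
  obtain s where s: "s > 0" "\<And>U V. 0 \<le> U \<Longrightarrow> U \<le> C \<Longrightarrow> \<bar>V\<bar> \<le> C \<Longrightarrow> V\<^sup>2 + (force U)\<^sup>2 < s \<Longrightarrow>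
    \<bar>energy U V\<bar> < e / 2 \<or> \<bar>energy U V - Emin\<bar> < e / 2"
    using near_equilibrium[of "e / 2" C] e by auto
  \<comment> \<open>Young's inequality for damp V F costs damp^2/2 and the term with
    \<open>force'\<close> costs \<open>B\<close>; the remaining 1/2 pays for the term - l V^2 / 2
    that is to be kept.\<close>
  define q where "q = damp\<^sup>2 / 2 + B + 1 / 2"
  have q: "q > 0" using B by (auto simp: q_def intro: add_nonneg_pos)
  \<comment> \<open>The first bound keeps \<open>lyap\<close> within e/2 of the energy, as C B
    bounds V times the force; the second gives l q \<le> \<open>damp\<close>.\<close>
  define l where "l = min (e / (2 * C * B)) (damp / q)"
  have l: "l > 0" "l * (C * B) \<le> e / 2" "l * q \<le> damp"
  proof -
    show "l > 0" using e C B q damp_pos by (simp add: l_def)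
    have "l * (C * B) \<le> e / (2 * C * B) * (C * B)" using C B by (intro mult_right_mono) (auto simp: l_def)
    then show "l * (C * B) \<le> e / 2" using C B by simp
    have "l * q \<le> damp / q * q" using q by (intro mult_right_mono) (auto simp: l_def)
    then show "l * q \<le> damp" using q by simp
  qed
  \<comment> \<open>A perturbation of this size consumes at most half of the decay l s / 2.\<close>
  define w where "w = (l * s / 4) / (l * B + C)"
  have lBC: "l * B + C > 0" using l B C by (simp add: add_pos_pos)
  have w: "w > 0" using l s lBC unfolding w_def by (intro divide_pos_pos mult_pos_pos) auto
  have w_eq: "w * (l * B + C) = l * s / 4" 
    using lBC nonzero_eq_divide_eq[of "l * B + C" w "l * s / 4"] by (simp only: w_def) simp
  show ?thesis
  proof (rule that[of l "l * s / 4" w])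
    fix U V G assume H: "0 \<le> U" "U \<le> C" "\<bar>V\<bar> \<le> C" "\<bar>G\<bar> \<le> w"
    define F where "F = force U"
    have F: "\<bar>F\<bar> \<le> B" "\<bar>force' U\<bar> \<le> B" using B H by (auto simp: F_def)
    have VF: "\<bar>V * F\<bar> \<le> C * B" unfolding abs_mult using H F C by (intro mult_mono) auto
    then have "l * \<bar>V * F\<bar> \<le> l * (C * B)" using l by (intro mult_left_mono) auto
    moreover have "\<bar>l * (V * F)\<bar> = l * \<bar>V * F\<bar>" using l by (simp add: abs_mult)
    ultimately have "\<bar>l * (V * F)\<bar> \<le> e / 2" using l by linarith
    then have near: "\<bar>lyap l U V - energy U V\<bar> \<le> e / 2"
      by (simp add: lyap_def F_def mult.assoc)
    have "lyap' l U V G \<le> - (l * s / 4) \<or> \<bar>lyap l U V\<bar> < e \<or> \<bar>lyap l U V - Emin\<bar> < e"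
    proof (cases "V\<^sup>2 + F\<^sup>2 < s")
      case True
      then have "\<bar>energy U V\<bar> < e / 2 \<or> \<bar>energy U V - Emin\<bar> < e / 2"
        using s(2)[OF H(1-3)] by (simp add: F_def)
      then have "\<bar>lyap l U V\<bar> < e \<or> \<bar>lyap l U V - Emin\<bar> < e"
      proof
        assume "\<bar>energy U V\<bar> < e / 2"
        then show ?thesis using near by (intro disjI1) linarith
      next
        assume "\<bar>energy U V - Emin\<bar> < e / 2"
        then show ?thesis using near by (intro disjI2) linarith
      qed
      then show ?thesis by blast
    next
      case False
      have "G * (l * F - V) \<le> \<bar>G\<bar> * \<bar>l * F - V\<bar>" by (simp add: abs_mult[symmetric])
      also have "\<dots> \<le> w * (l * B + C)"
      proof (intro mult_mono)
        have "l * \<bar>F\<bar> \<le> l * B" using l F by (intro mult_left_mono) auto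
        then have "\<bar>l * F\<bar> \<le> l * B" using l by (simp add: abs_mult)
        then show "\<bar>l * F - V\<bar> \<le> l * B + C" using H by auto
      qed (use H w in auto)
      finally have G: "G * (l * F - V) \<le> l * s / 4" using w_eq by simp
      have "0 \<le> (damp * V - F)\<^sup>2" by simp
      then have "2 * (damp * V * F) \<le> damp\<^sup>2 * V\<^sup>2 + F\<^sup>2"
        by (simp add: power2_eq_square algebra_simps)
      moreover have "- (force' U * V\<^sup>2) \<le> B * V\<^sup>2"
        using F(2) mult_right_mono[of "- force' U" B "V\<^sup>2"] by auto
      ultimately have "damp * V * F - F\<^sup>2 - force' U * V\<^sup>2 \<le> (damp\<^sup>2 / 2 + B) * V\<^sup>2 - F\<^sup>2 / 2"
        by (simp add: algebra_simps)
      then have "l * (damp * V * F - F\<^sup>2 - force' U * V\<^sup>2) \<le> l * ((damp\<^sup>2 / 2 + B) * V\<^sup>2 - F\<^sup>2 / 2)"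
        using l by (intro mult_left_mono) auto
      also have "\<dots> = (l * q) * V\<^sup>2 - l / 2 * (V\<^sup>2 + F\<^sup>2)" by (simp add: q_def algebra_simps)
      also have "\<dots> \<le> damp * V\<^sup>2 - l / 2 * s"
        using l False by (intro diff_mono mult_right_mono mult_left_mono) auto
      finally have "lyap' l U V G \<le> - (l * s / 2) + G * (l * F - V)"
        by (simp add: lyap'_def F_def[symmetric] algebra_simps power2_eq_square)
      then show ?thesis using G by simp
    qed
    then show "\<bar>lyap l U V - energy U V\<bar> \<le> e \<and>
      (lyap' l U V G \<le> - (l * s / 4) \<or> \<bar>lyap l U V\<bar> < e \<or> \<bar>lyap l U V - Emin\<bar> < e)"
      using near e by auto
  qed (use l s w in auto)
qed

text \<open>Once \<open>lyap\<close> is at most -2e it cannot climb back, and away from the band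
  around \<open>Emin\<close> it falls at rate \<eta>, so it enters that band within a time depending
  only on e and C, not on the orbit. The hypothesis \<open>small\<close> separates the bands around
  0 and \<open>Emin\<close>, so both levels -2e and \<open>Emin\<close> + e act as barriers.\<close>

lemma trap:
  assumes e: "e > 0" and C: "C > 0" and small: "Emin + e < - 2 * e"
  obtains T w where "T > 0" "w > 0"
    "\<And>U V G s y t. (\<And>t. s \<le> t \<Longrightarrow> t < y \<Longrightarrow> orbit G U V t \<and> U t \<le> C \<and> \<bar>V t\<bar> \<le> C \<and> \<bar>G t\<bar> \<le> w) \<Longrightarrow>
      energy (U s) (V s) \<le> - 3 * e \<Longrightarrow> s \<le> t \<Longrightarrow> t < y \<Longrightarrow>
      energy (U t) (V t) \<le> - e \<and> (s + T \<le> t \<longrightarrow> energy (U t) (V t) \<le> Emin + 2 * e)"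
proof -
  from lyap_decay[OF e C] obtain l \<eta> w where l: "l > 0" "\<eta> > 0" "w > 0"
    "\<And>U V G. 0 \<le> U \<Longrightarrow> U \<le> C \<Longrightarrow> \<bar>V\<bar> \<le> C \<Longrightarrow> \<bar>G\<bar> \<le> w \<Longrightarrow>
      \<bar>lyap l U V - energy U V\<bar> \<le> e \<and>
      (lyap' l U V G \<le> - \<eta> \<or> \<bar>lyap l U V\<bar> < e \<or> \<bar>lyap l U V - Emin\<bar> < e)" by metis
  \<comment> \<open>Falling at rate \<eta> for this time from a level below -2e would lead below
    \<open>Emin\<close>.\<close>
  define T where "T = - Emin / \<eta>"
  have T: "T > 0" "\<eta> * T = - Emin"
    using l Emin_neg unfolding T_def by (auto simp: divide_neg_pos)
  show ?thesis
  proof (rule that[OF T(1) l(3)])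
    fix U V G :: "real \<Rightarrow> real" and s y t :: real
    assume orb: "\<And>t. s \<le> t \<Longrightarrow> t < y \<Longrightarrow> orbit G U V t \<and> U t \<le> C \<and> \<bar>V t\<bar> \<le> C \<and> \<bar>G t\<bar> \<le> w"
      and start: "energy (U s) (V s) \<le> - 3 * e" and t: "s \<le> t" "t < y"
    define L where "L t = lyap l (U t) (V t)" for t
    define L' where "L' t = lyap' l (U t) (V t) (G t)" for t
    have L: "(L has_real_derivative L' x) (at x)" "\<bar>L x - energy (U x) (V x)\<bar> \<le> e"
      "L' x \<le> - \<eta> \<or> \<bar>L x\<bar> < e \<or> \<bar>L x - Emin\<bar> < e" if "s \<le> x" "x < y" for x
      using orbit_lyap[of G U V x l] orb[OF that] l(4)[of "U x" "V x" "G x"]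
      by (auto simp: L_def[abs_def] L'_def orbit_def)
    have low: "L x \<le> - 2 * e" if x: "s \<le> x" "x < y" for x
    proof (rule barrier[of s x L L'])
      show "L s \<le> - 2 * e" using L(2)[of s] start t by auto
      fix z assume z: "s \<le> z" "z \<le> x" "L z = - 2 * e"
      then show "L' z < 0" using L(3)[of z] x e small l by auto
    qed (use x L in auto)
    have "L t \<le> Emin + e" if tT: "s + T \<le> t"
    proof -
      have "\<exists>x. s \<le> x \<and> x \<le> s + T \<and> L x \<le> Emin + e"
      proof (rule ccontr)
        assume "\<not> ?thesis"
        then have high: "L x > Emin + e" if "s \<le> x" "x \<le> s + T" for x using that by force
        have "L (s + T) - L s \<le> - \<eta> * (s + T - s)"
        proof (rule deriv_diff_le)
          fix x assume x: "s \<le> x" "x \<le> s + T"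
          then show "(L has_real_derivative L' x) (at x)" using L t tT by auto
          show "L' x \<le> - \<eta>" using L(3)[of x] high[of x] low[of x] x t tT e by auto
        qed (use T in auto)
        then show False using T low[of s] high[of "s + T"] t e by auto
      qed
      then obtain x where x: "s \<le> x" "x \<le> s + T" "L x \<le> Emin + e" by auto
      show ?thesis
      proof (rule barrier[of x t L L'])
        fix z assume z: "x \<le> z" "z \<le> t" "L z = Emin + e"
        then show "L' z < 0" using L(3)[of z] low[of z] x t e small l by auto
      qed (use x tT L t in auto)
    qed
    then show "energy (U t) (V t) \<le> - e \<and> (s + T \<le> t \<longrightarrow> energy (U t) (V t) \<le> Emin + 2 * e)"
      using low[OF t] L(2)[OF t] by auto
  qed
qed

text \<open>The potential decreases strictly on (0, Ueq], so an energy close to the minimum excludes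
  values of U below m. The bound is one-sided because the later Sturm comparison only needs U^(p-1)
  from below.\<close>

lemma energy_near_min:
  assumes m: "m < Ueq"
  obtains e where "e > 0" "\<And>U V. 0 < U \<Longrightarrow> energy U V \<le> Emin + e \<Longrightarrow> m \<le> U"
proof -
  have anti: "energy y 0 < energy x 0" if xy: "0 < x" "x < y" "y \<le> Ueq" for x y
  proof -
    obtain z where z: "x < z" "z < y" "energy y 0 - energy x 0 = (y - x) * (- force z)"
      using MVT2[OF xy(2), of "\<lambda>U. energy U 0" "\<lambda>U. - force U"] DERIV_potential xy by force
    have "k0 * z powr (p - 1) < k0 * Ueq powr (p - 1)"
      using z xy p_gt k0_pos by (intro mult_strict_left_mono powr_less_mono2) auto
    then have "force z > 0" using z xy k0_pos by (auto simp: force_eq Ueq_powr)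
    then have "(y - x) * (- force z) < 0" using xy by (intro mult_pos_neg) auto
    then show ?thesis using z by simp
  qed
  \<comment> \<open>m may be nonpositive, while the comparison of potentials takes place at a point
    of (0, Ueq).\<close>
  define m' where "m' = max m (Ueq / 2)"
  have m': "0 < m'" "m' < Ueq" "m \<le> m'" using m Ueq_pos by (auto simp: m'_def)
  show ?thesis
  proof (rule that[of "(energy m' 0 - Emin) / 2"])
    show pos: "(energy m' 0 - Emin) / 2 > 0" using anti[of m' Ueq] m' by (simp add: Emin_def)
    fix U V assume U: "0 < U" "energy U V \<le> Emin + (energy m' 0 - Emin) / 2"
    have "energy U V = energy U 0 + V\<^sup>2 / 2" by (simp add: energy_def)
    moreover have "V\<^sup>2 / 2 \<ge> 0" by simp
    moreover have "Emin + (energy m' 0 - Emin) / 2 = energy m' 0 - (energy m' 0 - Emin) / 2"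
      by (simp add: field_simps)
    ultimately have "energy U 0 < energy m' 0" using U(2) pos by linarith
    then have "m' \<le> U" using anti[of U m'] U m' by force
    then show "m \<le> U" using m' by simp
  qed
qed

section \<open>Behaviour as time tends to -\<infinity>\<close>

text \<open>If \<open>lyap\<close> exceeded e at some time, it would have exceeded e at all earlier
  times and so have decreased at rate \<eta> throughout. Followed backward it would be unbounded,
  contrary to the box. The lower bound is the hypothesis \<open>nonneg\<close>.\<close>

lemma backward_energy_limit:
  assumes orb: "\<And>t. t \<le> t0 \<Longrightarrow> orbit G U V t \<and> U t \<le> C \<and> \<bar>V t\<bar> \<le> C"
    and G: "(G \<longlongrightarrow> 0) at_bot"
    and nonneg: "\<And>d. d > 0 \<Longrightarrow> \<forall>\<^sub>F t in at_bot. - d < energy (U t) (V t)"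
  shows "((\<lambda>t. energy (U t) (V t)) \<longlongrightarrow> 0) at_bot"
proof (rule tendstoI)
  fix d :: real assume d: "d > 0"
  have C: "C > 0" using orb[of t0] by (auto simp: orbit_def)
  define e where "e = min (d / 3) (- Emin / 4)"
  have e: "e > 0" "2 * e < d" "Emin + e < - 2 * e"
    using d Emin_neg by (auto simp: e_def min_def)
  from lyap_decay[OF e(1) C] obtain l \<eta> w where l: "l > 0" "\<eta> > 0" "w > 0"
    "\<And>U V G. 0 \<le> U \<Longrightarrow> U \<le> C \<Longrightarrow> \<bar>V\<bar> \<le> C \<Longrightarrow> \<bar>G\<bar> \<le> w \<Longrightarrow>
      \<bar>lyap l U V - energy U V\<bar> \<le> e \<and>
      (lyap' l U V G \<le> - \<eta> \<or> \<bar>lyap l U V\<bar> < e \<or> \<bar>lyap l U V - Emin\<bar> < e)" by metis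
  have "\<forall>\<^sub>F t in at_bot. \<bar>G t\<bar> < w" using tendstoD[OF G l(3)] by (simp add: dist_real_def)
  then obtain t1 where t1: "\<And>t. t \<le> t1 \<Longrightarrow> \<bar>G t\<bar> < w" unfolding eventually_at_bot_linorder by auto
  define L where "L t = lyap l (U t) (V t)" for t
  define L' where "L' t = lyap' l (U t) (V t) (G t)" for t
  have L: "(L has_real_derivative L' x) (at x)" "\<bar>L x - energy (U x) (V x)\<bar> \<le> e"
    "L' x \<le> - \<eta> \<or> \<bar>L x\<bar> < e \<or> \<bar>L x - Emin\<bar> < e" if "x \<le> min t0 t1" for x
    using orbit_lyap[of G U V x l] orb[of x] t1[of x] that l(4)[of "U x" "V x" "G x"]
    by (auto simp: L_def[abs_def] L'_def orbit_def)
  \<comment> \<open>An upper bound of the energy on the box, obtained by dropping the negative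
    quadratic term, plus the distance e between energy and \<open>lyap\<close>.\<close>
  define Bd where "Bd = C\<^sup>2 / 2 + k0 * C powr (p + 1) / (p + 1) + e"
  have L_bd: "L x \<le> Bd" if x: "x \<le> min t0 t1" for x
  proof -
    have "(V x)\<^sup>2 \<le> C\<^sup>2" using orb[of x] x by (auto simp: abs_le_square_iff[symmetric])
    moreover have "k0 * U x powr (p + 1) / (p + 1) \<le> k0 * C powr (p + 1) / (p + 1)"
      using orb[of x] x p_gt k0_pos
      by (intro divide_right_mono mult_left_mono powr_mono2) (auto simp: orbit_def)
    moreover have "spring * (U x)\<^sup>2 \<ge> 0" using spring_pos by simp
    ultimately have "energy (U x) (V x) + e \<le> Bd" unfolding energy_def Bd_def by linarith
    then show ?thesis using L(2)[OF x] by linarith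
  qed
  have "L s \<le> e" if s: "s \<le> min t0 t1" for s
  proof (rule ccontr)
    assume Ls: "\<not> L s \<le> e"
    have high: "L x > e" if x: "x \<le> s" for x
    proof (rule ccontr)
      assume "\<not> L x > e"
      then have "L s \<le> e"
      proof (intro barrier[of x s L L' e])
        fix z assume z: "x \<le> z" "z \<le> s" "L z = e"
        then show "L' z < 0" using L(3)[of z] s e l by auto
      qed (use x s L in auto)
      then show False using Ls by simp
    qed
    define x where "x = s - (\<bar>Bd\<bar> + 1) / \<eta>"
    have x: "x \<le> s" "\<eta> * (s - x) = \<bar>Bd\<bar> + 1" using l by (auto simp: x_def)
    have "L s - L x \<le> - \<eta> * (s - x)"
    proof (rule deriv_diff_le[OF x(1)])
      fix z assume z: "x \<le> z" "z \<le> s"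
      show "(L has_real_derivative L' z) (at z)" using L z s by auto
      show "L' z \<le> - \<eta>" using L(3)[of z] high[of z] z s e by auto
    qed
    then show False using x L_bd[of x] Ls e s by auto
  qed
  then have up: "energy (U s) (V s) < d" if "s \<le> min t0 t1" for s
    using L(2)[OF that] that e by fastforce
  have "\<forall>\<^sub>F t in at_bot. t \<le> min t0 t1" by (rule eventually_le_at_bot)
  with nonneg[OF d] show "\<forall>\<^sub>F t in at_bot. dist (energy (U t) (V t)) 0 < d"
    by eventually_elim (use up in \<open>auto simp: dist_real_def abs_less_iff\<close>)
qed

text \<open>\<open>barbalat\<close> is applied twice. Convergence of the energy gives V^2 to 0. Then
  V F tends to 0 and its derivative is F^2 up to terms with a factor V or G, which gives F^2 to 0,
  where F is the force. Finally \<open>energy_force\<close> turns these limits into one for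
  U^2.\<close>

lemma backward_vanishing:
  assumes orb: "\<And>t. t \<le> t0 \<Longrightarrow> orbit G U V t \<and> U t \<le> C \<and> \<bar>V t\<bar> \<le> C"
    and G: "(G \<longlongrightarrow> 0) at_bot"
    and E: "((\<lambda>t. energy (U t) (V t)) \<longlongrightarrow> 0) at_bot"
  shows "(U \<longlongrightarrow> 0) at_bot"
proof -
  have C: "C > 0" using orb[of t0] by (auto simp: orbit_def)
  from force_bounds[OF C] obtain B where B: "B > 0"
    "\<And>U. 0 \<le> U \<Longrightarrow> U \<le> C \<Longrightarrow> \<bar>force U\<bar> \<le> B \<and> \<bar>force' U\<bar> \<le> B" by metis
  define F where "F t = force (U t)" for t
  define V' where "V' t = - damp * V t + F t - G t" for t
  have "\<forall>\<^sub>F t in at_bot. \<bar>G t\<bar> < 1" using tendstoD[OF G, of 1] by (simp add: dist_real_def)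
  moreover have "\<forall>\<^sub>F t in at_bot. t \<le> t0" by (rule eventually_le_at_bot)
  ultimately have ev: "\<forall>\<^sub>F t in at_bot. \<bar>G t\<bar> < 1 \<and> orbit G U V t \<and> U t \<le> C \<and> 0 < U t \<and> \<bar>V t\<bar> \<le> C
      \<and> \<bar>F t\<bar> \<le> B \<and> \<bar>force' (U t)\<bar> \<le> B"
  proof eventually_elim
    case (elim t)
    then show ?case using orb[of t] B(2)[of "U t"] by (auto simp: orbit_def F_def)
  qed
  have "((\<lambda>t. (V t)\<^sup>2) \<longlongrightarrow> 0) at_bot"
  proof (rule barbalat[OF _ _ _ _ _ _ damp_pos E])
    show "\<forall>\<^sub>F t in at_bot. ((\<lambda>t. energy (U t) (V t)) has_real_derivative - damp * (V t)\<^sup>2 - G t * V t) (at t)"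
      using ev by eventually_elim (use orbit_energy in auto)
    show "\<forall>\<^sub>F t in at_bot. ((\<lambda>t. (V t)\<^sup>2) has_real_derivative 2 * V t * V' t) (at t)"
      using ev by eventually_elim (auto simp: orbit_def V'_def F_def intro!: derivative_eq_intros)
    show "\<forall>\<^sub>F t in at_bot. \<bar>2 * V t * V' t\<bar> \<le> 2 * C * (damp * C + B + 1)"
      using ev
    proof eventually_elim
      case (elim t)
      have "damp * \<bar>V t\<bar> \<le> damp * C" using elim damp_pos by (intro mult_left_mono) auto
      then have "\<bar>damp * V t\<bar> \<le> damp * C" using damp_pos by (simp add: abs_mult)
      then have "\<bar>V' t\<bar> \<le> damp * C + B + 1" using elim unfolding V'_def by linarith
      then show ?case unfolding abs_mult using elim C by (intro mult_mono) auto
    qed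
    show "\<forall>\<^sub>F t in at_bot. - damp * (V t)\<^sup>2 - G t * V t \<le> - damp * (V t)\<^sup>2 + \<bar>G t\<bar> * C"
      using ev
    proof eventually_elim
      case (elim t)
      have "\<bar>G t * V t\<bar> \<le> \<bar>G t\<bar> * C" unfolding abs_mult using elim by (intro mult_left_mono) auto
      then show ?case by linarith
    qed
    show "((\<lambda>t. \<bar>G t\<bar> * C) \<longlongrightarrow> 0) at_bot"
      using tendsto_mult[OF tendsto_rabs[OF G] tendsto_const[of C]] by simp
  qed auto
  then have V: "(V \<longlongrightarrow> 0) at_bot" by simp
  have VB: "((\<lambda>t. \<bar>V t\<bar> * x) \<longlongrightarrow> 0) at_bot" "((\<lambda>t. \<bar>G t\<bar> * x) \<longlongrightarrow> 0) at_bot" for x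
    using tendsto_mult[OF tendsto_rabs[OF V] tendsto_const[of x]]
      tendsto_mult[OF tendsto_rabs[OF G] tendsto_const[of x]] by simp_all
  have VF: "((\<lambda>t. V t * F t) \<longlongrightarrow> 0) at_bot"
  proof (rule Lim_null_comparison[OF _ VB(1)[of B]])
    show "\<forall>\<^sub>F t in at_bot. norm (V t * F t) \<le> \<bar>V t\<bar> * B"
      using ev by eventually_elim (auto simp: abs_mult intro!: mult_left_mono)
  qed
  have ineq: "\<forall>\<^sub>F t in at_bot. - (V' t * F t + V t * (force' (U t) * V t)) \<le>
      - 1 * (F t)\<^sup>2 + (\<bar>V t\<bar> * (damp * B + C * B) + \<bar>G t\<bar> * B)"
    using ev
  proof eventually_elim
    case (elim t)
    have "\<bar>G t * F t\<bar> \<le> \<bar>G t\<bar> * B" unfolding abs_mult using elim by (intro mult_left_mono) auto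
    moreover have "\<bar>V t * (damp * F t)\<bar> \<le> \<bar>V t\<bar> * (damp * B)"
      unfolding abs_mult using elim damp_pos by (intro mult_left_mono) auto
    moreover have "\<bar>V t * (V t * force' (U t))\<bar> \<le> \<bar>V t\<bar> * (C * B)"
      unfolding abs_mult using elim C by (intro mult_left_mono mult_mono) auto
    moreover have "- (V' t * F t + V t * (force' (U t) * V t))
       = - 1 * (F t)\<^sup>2 + (V t * (damp * F t) + G t * F t - V t * (V t * force' (U t)))"
      by (simp add: V'_def algebra_simps power2_eq_square)
    moreover have "\<bar>V t\<bar> * (damp * B + C * B) = \<bar>V t\<bar> * (damp * B) + \<bar>V t\<bar> * (C * B)"
      by (simp add: algebra_simps)
    ultimately show ?case by linarith
  qed
  have "((\<lambda>t. (F t)\<^sup>2) \<longlongrightarrow> 0) at_bot"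
  proof (rule barbalat[where d = 1 and l = 0 and F = "\<lambda>t. - (V t * F t)" and
      F' = "\<lambda>t. - (V' t * F t + V t * (force' (U t) * V t))" and
      r = "\<lambda>t. \<bar>V t\<bar> * (damp * B + C * B) + \<bar>G t\<bar> * B"])
    show "((\<lambda>t. - (V t * F t)) \<longlongrightarrow> 0) at_bot" using tendsto_minus[OF VF] by simp
    show "\<forall>\<^sub>F t in at_bot. ((\<lambda>t. - (V t * F t)) has_real_derivative
        - (V' t * F t + V t * (force' (U t) * V t))) (at t)"
      using ev unfolding V'_def F_def by eventually_elim (intro DERIV_minus orbit_V_force, simp)
    show "\<forall>\<^sub>F t in at_bot. ((\<lambda>t. (F t)\<^sup>2) has_real_derivative 2 * F t * (force' (U t) * V t)) (at t)"
      using ev unfolding F_def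
      by eventually_elim (auto intro!: derivative_eq_intros orbit_force)
    show "\<forall>\<^sub>F t in at_bot. \<bar>2 * F t * (force' (U t) * V t)\<bar> \<le> 2 * B * (B * C)"
      using ev unfolding abs_mult by eventually_elim (use B in \<open>auto intro!: mult_mono\<close>)
    show "\<forall>\<^sub>F t in at_bot. - (V' t * F t + V t * (force' (U t) * V t)) \<le>
        - 1 * (F t)\<^sup>2 + (\<bar>V t\<bar> * (damp * B + C * B) + \<bar>G t\<bar> * B)"
      by (rule ineq)
    show "((\<lambda>t. \<bar>V t\<bar> * (damp * B + C * B) + \<bar>G t\<bar> * B) \<longlongrightarrow> 0) at_bot"
      using tendsto_add[OF VB(1) VB(2)] by simp
    show "\<forall>\<^sub>F t in at_bot. 0 \<le> (F t)\<^sup>2" by simp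
  qed simp
  then have F: "(F \<longlongrightarrow> 0) at_bot" by simp
  have UF: "((\<lambda>t. U t * F t) \<longlongrightarrow> 0) at_bot"
  proof (rule Lim_null_comparison)
    show "\<forall>\<^sub>F t in at_bot. norm (U t * F t) \<le> C * \<bar>F t\<bar>"
      using ev by eventually_elim (auto simp: abs_mult intro!: mult_right_mono)
    show "((\<lambda>t. C * \<bar>F t\<bar>) \<longlongrightarrow> 0) at_bot"
      using tendsto_mult[OF tendsto_const[of C] tendsto_rabs[OF F]] by simp
  qed
  define q where "q = spring * (p - 1) / (2 * (p + 1))"
  have q: "q > 0" using spring_pos p_gt by (simp add: q_def)
  have "((\<lambda>t. (V t)\<^sup>2 / 2 - energy (U t) (V t) - U t * F t / (p + 1)) \<longlongrightarrow> 0\<^sup>2 / 2 - 0 - 0 / (p + 1)) at_bot"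
    using p_gt by (intro tendsto_intros V E UF) auto
  moreover have "\<forall>\<^sub>F t in at_bot. (V t)\<^sup>2 / 2 - energy (U t) (V t) - U t * F t / (p + 1) = q * (U t)\<^sup>2"
    using ev unfolding F_def q_def by eventually_elim (use energy_force in auto)
  ultimately have "((\<lambda>t. q * (U t)\<^sup>2) \<longlongrightarrow> 0) at_bot" by (simp add: tendsto_cong)
  then have "((\<lambda>t. (1 / q) * (q * (U t)\<^sup>2)) \<longlongrightarrow> (1 / q) * 0) at_bot" by (intro tendsto_intros)
  then show ?thesis using q by simp
qed

text \<open>If the energy is at most some -d0 at arbitrarily negative times, each sufficiently
  negative t has such a time before t - T, and \<open>trap\<close> started there brings the energy
  near \<open>Emin\<close> at t. Otherwise the energy is asymptotically nonnegative and the two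
  preceding lemmas apply.\<close>

lemma backward_dichotomy:
  assumes orb: "\<And>t. t \<le> t0 \<Longrightarrow> orbit G U V t \<and> U t \<le> C \<and> \<bar>V t\<bar> \<le> C"
    and G: "(G \<longlongrightarrow> 0) at_bot"
  shows "(\<forall>d>0. \<forall>\<^sub>F t in at_bot. energy (U t) (V t) \<le> Emin + d) \<or> (U \<longlongrightarrow> 0) at_bot"
proof (cases "\<forall>d>0. \<forall>\<^sub>F t in at_bot. - d < energy (U t) (V t)")
  case True
  then show ?thesis
    using backward_vanishing[OF orb G] backward_energy_limit[OF orb G] by blast
next
  case False
  then obtain d0 where d0: "d0 > 0" "\<And>x. \<exists>s\<le>x. energy (U s) (V s) \<le> - d0"
    unfolding eventually_at_bot_linorder by (auto simp: not_less)
  have C: "C > 0" using orb[of t0] by (auto simp: orbit_def)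
  have "\<forall>\<^sub>F t in at_bot. energy (U t) (V t) \<le> Emin + d" if d: "d > 0" for d
  proof -
    define e where "e = min (min (d / 2) (d0 / 3)) (- Emin / 4)"
    have e: "e > 0" "2 * e \<le> d" "3 * e \<le> d0" "Emin + e < - 2 * e"
      using d d0 Emin_neg by (auto simp: e_def min_def)
    from trap[OF e(1) C e(4)] obtain T w where T: "T > 0" "w > 0" and
      trap: "\<And>U V G s y t. (\<And>t. s \<le> t \<Longrightarrow> t < y \<Longrightarrow> orbit G U V t \<and> U t \<le> C \<and> \<bar>V t\<bar> \<le> C \<and> \<bar>G t\<bar> \<le> w) \<Longrightarrow>
        energy (U s) (V s) \<le> - 3 * e \<Longrightarrow> s \<le> t \<Longrightarrow> t < y \<Longrightarrow>
        energy (U t) (V t) \<le> - e \<and> (s + T \<le> t \<longrightarrow> energy (U t) (V t) \<le> Emin + 2 * e)" by metis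
    have "\<forall>\<^sub>F t in at_bot. \<bar>G t\<bar> < w" using tendstoD[OF G T(2)] by (simp add: dist_real_def)
    then obtain t1 where t1: "\<And>t. t \<le> t1 \<Longrightarrow> \<bar>G t\<bar> < w" unfolding eventually_at_bot_linorder by auto
    have "energy (U t) (V t) \<le> Emin + d" if t: "t < min t0 t1" for t
    proof -
      obtain s where s: "s \<le> t - T" "energy (U s) (V s) \<le> - d0" using d0 by blast
      have "energy (U t) (V t) \<le> - e \<and> (s + T \<le> t \<longrightarrow> energy (U t) (V t) \<le> Emin + 2 * e)"
      proof (rule trap[of s "min t0 t1" G U V t])
        fix t assume "s \<le> t" "t < min t0 t1"
        then show "orbit G U V t \<and> U t \<le> C \<and> \<bar>V t\<bar> \<le> C \<and> \<bar>G t\<bar> \<le> w"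
          using orb[of t] t1[of t] by auto
      qed (use s e t T in auto)
      then show ?thesis using s e by auto
    qed
    then show ?thesis
      unfolding eventually_at_bot_dense by blast
  qed
  then show ?thesis by auto
qed

end

section \<open>A priori bounds\<close>

text \<open>In the application \<kappa> is K(r) / r^\<alpha>, g is \<mu> r^(\<theta>+2) f(r) and
  \<sigma> is \<theta> + 2 + \<nu>, so \<open>\<sigma> > \<theta>\<close> is \<nu> > -2. As t0 is
  nonpositive, exp (\<sigma> t) is dominated by exp (\<theta> t) and by 1.\<close>

locale emden_perturbed = emden +
  fixes \<kappa> g :: "real \<Rightarrow> real" and Cg \<sigma> t0 :: real
  assumes t0: "t0 \<le> 0" and \<sigma>_gt: "\<sigma> > \<theta>"
    and \<kappa>_bounds: "\<And>t. t \<le> t0 \<Longrightarrow> k0 / 2 \<le> \<kappa> t \<and> \<kappa> t \<le> 2 * k0"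
    and \<kappa>_lim: "(\<kappa> \<longlongrightarrow> k0) at_bot"
    and g_bounds: "\<And>t. t \<le> t0 \<Longrightarrow> 0 \<le> g t \<and> g t \<le> Cg * exp (\<sigma> * t)"
begin

text \<open>In U and P both equations have an integrating factor: the source of P is nonnegative, so
  exp (c t) P is monotone, and the sign of P decides the monotonicity of exp (-\<theta> t) U. In the
  original variables these quantities are - r^(N-1) u' and u. The truncation by \<open>max\<close>
  admits orbits of unknown sign.\<close>

definition flow :: "(real \<Rightarrow> real) \<Rightarrow> (real \<Rightarrow> real) \<Rightarrow> real \<Rightarrow> bool" where
  "flow U P t \<longleftrightarrow> (U has_real_derivative \<theta> * U t - P t) (at t) \<and>
     (P has_real_derivative - c * P t + \<kappa> t * max (U t) 0 powr p + g t) (at t)"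

definition pert :: "real \<Rightarrow> real \<Rightarrow> real" where
  "pert t x = (\<kappa> t - k0) * x powr p + g t"

lemma flow_orbit:
  assumes "flow U P t" "U t > 0"
  shows "orbit (\<lambda>t. pert t (U t)) U (\<lambda>t. \<theta> * U t - P t) t"
proof -
  have "((\<lambda>t. \<theta> * U t - P t) has_real_derivative
      \<theta> * (\<theta> * U t - P t) - (- c * P t + \<kappa> t * max (U t) 0 powr p + g t)) (at t)"
    using assms unfolding flow_def by (intro DERIV_diff DERIV_cmult) auto
  moreover have "\<theta> * (\<theta> * U t - P t) - (- c * P t + \<kappa> t * max (U t) 0 powr p + g t) =
      - damp * (\<theta> * U t - P t) + force (U t) - pert t (U t)"
    using assms by (simp add: damp_def spring_def force_def pert_def algebra_simps)
  ultimately show ?thesis using assms by (simp add: orbit_def flow_def)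
qed

lemma flow_expP:
  "flow U P t \<Longrightarrow> ((\<lambda>t. exp (c * t) * P t) has_real_derivative
     exp (c * t) * (\<kappa> t * max (U t) 0 powr p + g t)) (at t)"
  unfolding flow_def by (auto intro!: derivative_eq_intros simp: algebra_simps)

lemma flow_expU:
  "flow U P t \<Longrightarrow> ((\<lambda>t. exp (- \<theta> * t) * U t) has_real_derivative - (exp (- \<theta> * t) * P t)) (at t)"
  unfolding flow_def by (auto intro!: derivative_eq_intros simp: algebra_simps)

lemma source_nonneg: "t \<le> t0 \<Longrightarrow> 0 \<le> \<kappa> t * max (U t) 0 powr p + g t"
  using \<kappa>_bounds[of t] g_bounds[of t] k0_pos by (intro add_nonneg_nonneg mult_nonneg_nonneg) auto

lemma Cg_nonneg: "Cg \<ge> 0"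
proof -
  have "0 \<le> Cg * exp (\<sigma> * t0)" using g_bounds[of t0] by linarith
  then show ?thesis by (simp add: zero_le_mult_iff)
qed

lemma \<sigma>_pos: "\<sigma> > 0" using \<sigma>_gt \<theta>_pos by simp

lemma exp_mult_at_bot: "k > 0 \<Longrightarrow> ((\<lambda>t. x * exp (k * t)) \<longlongrightarrow> 0) at_bot" for k x :: real
proof -
  assume k: "k > 0"
  have "filterlim (\<lambda>t. k * t) at_bot at_bot"
    using k by (simp add: filterlim_tendsto_pos_mult_at_bot_iff[OF tendsto_const] filterlim_ident)
  then have "((\<lambda>t. exp (k * t)) \<longlongrightarrow> 0) at_bot" by (rule filterlim_compose[OF exp_at_bot])
  then have "((\<lambda>t. x * exp (k * t)) \<longlongrightarrow> x * 0) at_bot" by (intro tendsto_intros)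
  then show ?thesis by simp
qed

lemma pert_small:
  assumes "w > 0"
  shows "\<forall>\<^sub>F t in at_bot. \<forall>x. 0 \<le> x \<and> x \<le> C \<longrightarrow> \<bar>pert t x\<bar> \<le> w"
proof -
  have "((\<lambda>t. \<bar>\<kappa> t - k0\<bar> * C powr p + Cg * exp (\<sigma> * t)) \<longlongrightarrow> \<bar>k0 - k0\<bar> * C powr p + 0) at_bot"
    by (intro tendsto_intros \<kappa>_lim exp_mult_at_bot \<sigma>_pos)
  then have "\<forall>\<^sub>F t in at_bot. \<bar>\<kappa> t - k0\<bar> * C powr p + Cg * exp (\<sigma> * t) < w"
    using assms by (auto dest: order_tendstoD)
  then show ?thesis using eventually_le_at_bot[of t0]
  proof eventually_elim
    case (elim t)
    show ?case
    proof (intro allI impI)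
      fix x assume x: "0 \<le> x \<and> x \<le> C"
      have "\<bar>(\<kappa> t - k0) * x powr p\<bar> \<le> \<bar>\<kappa> t - k0\<bar> * C powr p"
        unfolding abs_mult using x p_gt by (intro mult_left_mono) (auto intro!: powr_mono2)
      then show "\<bar>pert t x\<bar> \<le> w" using elim g_bounds[of t] unfolding pert_def by linarith
    qed
  qed
qed

section \<open>Bounds for orbits that are positive for all earlier times\<close>

text \<open>The constant of \<open>P_ge\<close>: k0/2 bounds \<kappa> from below, and exp (-c) and
  exp (-\<theta> p) are the losses of exp (c t) and of U^p over a unit of time.\<close>

definition c1 :: real where "c1 = k0 / 2 * exp (- c - \<theta> * p)"
text \<open>The positive zero of \<theta> U - c1 U^p.\<close>

definition CU :: real where "CU = (\<theta> / c1) powr (1 / (p - 1))"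

lemma c1_pos: "c1 > 0" and CU_pos: "CU > 0"
  using k0_pos \<theta>_pos by (auto simp: c1_def CU_def)

text \<open>As P is nonnegative, exp (-\<theta> t) U does not increase, so U on [t - 1, t] is at
  least exp (-\<theta>) times its value at t. Integrating the source of exp (c t) P over that unit
  interval gives the bound.\<close>

lemma P_ge:
  assumes fl: "\<And>t. t < T \<Longrightarrow> flow U P t \<and> U t > 0 \<and> P t \<ge> 0" and T: "T \<le> t0" and t: "t < T"
  shows "c1 * U t powr p \<le> P t"
proof -
  have U_ge: "exp (- \<theta>) * U t \<le> U s" if s: "t - 1 \<le> s" "s \<le> t" for s
  proof -
    have "exp (- \<theta> * t) * U t - exp (- \<theta> * s) * U s \<le> 0 * (t - s)"
    proof (rule deriv_diff_le[OF s(2)])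
      fix x assume x: "s \<le> x" "x \<le> t"
      show "((\<lambda>t. exp (- \<theta> * t) * U t) has_real_derivative - (exp (- \<theta> * x) * P x)) (at x)"
        using flow_expU fl x t by auto
      show "- (exp (- \<theta> * x) * P x) \<le> 0" using fl[of x] x t by simp
    qed
    then have "exp (\<theta> * s) * (exp (- \<theta> * t) * U t) \<le> exp (\<theta> * s) * (exp (- \<theta> * s) * U s)"
      by (intro mult_left_mono) auto
    moreover have "exp (\<theta> * s) * exp (- \<theta> * t) = exp (\<theta> * (s - t))"
      "exp (\<theta> * s) * exp (- \<theta> * s) = 1"
      by (simp_all add: exp_add[symmetric] right_diff_distrib)
    ultimately have "exp (\<theta> * (s - t)) * U t \<le> U s"
      by (metis mult.assoc mult_1)
    moreover have "- \<theta> \<le> \<theta> * (s - t)" using s \<theta>_pos mult_left_mono[of "-1" "s - t" \<theta>] by simp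
    then have "exp (- \<theta>) * U t \<le> exp (\<theta> * (s - t)) * U t"
      using fl[OF t] by (intro mult_right_mono) auto
    ultimately show ?thesis by simp
  qed
  define k where "k = exp (c * (t - 1)) * (k0 / 2 * (exp (- \<theta>) * U t) powr p)"
  have "k * (t - (t - 1)) \<le> exp (c * t) * P t - exp (c * (t - 1)) * P (t - 1)"
  proof (rule deriv_diff_ge)
    fix x assume x: "t - 1 \<le> x" "x \<le> t"
    have x': "x < T" "x \<le> t0" using x t T by auto
    show "((\<lambda>t. exp (c * t) * P t) has_real_derivative
        exp (c * x) * (\<kappa> x * max (U x) 0 powr p + g x)) (at x)"
      using flow_expP[of U P x] fl[OF x'(1)] by blast
    have "k0 / 2 * (exp (- \<theta>) * U t) powr p \<le> \<kappa> x * max (U x) 0 powr p"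
      using \<kappa>_bounds[OF x'(2)] k0_pos U_ge[OF x] fl[OF t] p_gt by (intro mult_mono powr_mono2) auto
    also have "\<dots> \<le> \<kappa> x * max (U x) 0 powr p + g x" using g_bounds[OF x'(2)] by simp
    finally show "k \<le> exp (c * x) * (\<kappa> x * max (U x) 0 powr p + g x)"
      unfolding k_def using x c_pos k0_pos by (intro mult_mono) auto
  qed simp
  moreover have "exp (c * (t - 1)) * P (t - 1) \<ge> 0" using fl[of "t - 1"] t by simp
  ultimately have "k \<le> exp (c * t) * P t" by simp
  moreover have "k = exp (c * t) * (c1 * U t powr p)"
  proof -
    have "exp (c * (t - 1)) * exp (- \<theta> * p) = exp (c * t) * exp (- c - \<theta> * p)"
      by (simp add: exp_add[symmetric] algebra_simps)
    moreover have "(exp (- \<theta>) * U t) powr p = exp (- \<theta> * p) * U t powr p"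
      using fl[OF t] by (simp add: powr_mult exp_powr_real)
    ultimately show ?thesis by (simp add: k_def c1_def)
  qed
  ultimately show ?thesis by simp
qed

text \<open>By \<open>P_ge\<close>, U' \<le> \<theta> U - c1 U^p. An orbit above \<open>CU\<close>
  would blow up in finite time when followed backward, but it exists for all earlier times. Thus no
  data at -\<infinity> are needed and the bound is universal.\<close>

lemma U_le_CU:
  assumes fl: "\<And>t. t < T \<Longrightarrow> flow U P t \<and> U t > 0 \<and> P t \<ge> 0" and T: "T \<le> t0" and t: "t < T"
  shows "U t \<le> CU"
proof -
  define b where "b = (p - 1) * \<theta>"
  have b: "b > 0" using p_gt \<theta>_pos by (simp add: b_def)
  \<comment> \<open>Bernoulli's substitution U^(1-p) with its integrating factor.
    \<open>P_ge\<close> makes \<open>Z\<close> nondecreasing, and dropping the positive power of U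
    bounds it below by a term that vanishes at -\<infinity>.\<close>
  define Z where "Z t = exp (b * t) * (U t powr (1 - p) - c1 / \<theta>)" for t
  define Z' where "Z' t = exp (b * t) * ((p - 1) * (U t powr (- p) * P t - c1))" for t
  have dZ: "(Z has_real_derivative Z' x) (at x)" if x: "x < T" for x
  proof -
    have "U x powr (1 - p) = U x * U x powr (- p)"
      using fl[OF x] powr_add[of "U x" 1 "- p"] by simp
    then show ?thesis
      using fl[OF x] \<theta>_pos unfolding Z_def[abs_def] Z'_def flow_def b_def
      by (auto intro!: derivative_eq_intros simp: field_simps)
  qed
  have Z'_nonneg: "Z' x \<ge> 0" if x: "x < T" for x
  proof -
    have "U x powr (- p) * (c1 * U x powr p) \<le> U x powr (- p) * P x"
      using P_ge[OF fl T x] by (intro mult_left_mono) auto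
    then have "c1 \<le> U x powr (- p) * P x" using fl[OF x] by (simp add: powr_minus field_simps)
    then show ?thesis using p_gt by (simp add: Z'_def)
  qed
  have "0 \<le> Z t"
  proof (rule tendsto_upperbound)
    show "((\<lambda>s. (- c1 / \<theta>) * exp (b * s)) \<longlongrightarrow> 0) at_bot" by (rule exp_mult_at_bot[OF b])
    show "\<forall>\<^sub>F s in at_bot. (- c1 / \<theta>) * exp (b * s) \<le> Z t"
      using eventually_le_at_bot[of t]
    proof eventually_elim
      case (elim s)
      have "0 * (t - s) \<le> Z t - Z s"
        using elim t by (intro deriv_diff_ge[where D = Z'] dZ Z'_nonneg) auto
      moreover have "(- c1 / \<theta>) * exp (b * s) \<le> Z s"
        using mult_left_mono[of "- c1 / \<theta>" "U s powr (1 - p) - c1 / \<theta>" "exp (b * s)"]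
        by (simp add: Z_def mult.commute)
      ultimately show ?case by simp
    qed
  qed simp
  then have ge: "c1 / \<theta> \<le> U t powr (1 - p)" by (simp add: Z_def zero_le_mult_iff)
  have Up: "U t > 0" using fl t by auto
  then have "U t powr (p - 1) = inverse (U t powr (1 - p))"
    by (simp add: powr_minus[symmetric])
  also have "\<dots> \<le> inverse (c1 / \<theta>)" using ge c1_pos \<theta>_pos by (intro le_imp_inverse_le) auto
  finally have "U t powr (p - 1) \<le> \<theta> / c1" by simp
  then have "(U t powr (p - 1)) powr (1 / (p - 1)) \<le> CU"
    unfolding CU_def using p_gt by (intro powr_mono2) auto
  then show ?thesis using Up p_gt by (simp add: powr_powr)
qed

text \<open>The rest level of P' = - c P + const when the source is bounded by 2 k0 CU^p +
  Cg.\<close>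

definition CP :: real where "CP = (2 * k0 * CU powr p + Cg) / c"

lemma CP_pos: "CP > 0"
  using k0_pos CU_pos Cg_nonneg c_pos by (auto simp: CP_def intro!: divide_pos_pos add_pos_nonneg)

lemma P_le_CP:
  assumes fl: "\<And>t. t < T \<Longrightarrow> flow U P t \<and> U t > 0 \<and> P t \<ge> 0" and T: "T \<le> t0" and t: "t < T"
    and lim: "((\<lambda>t. exp (c * t) * P t) \<longlongrightarrow> 0) at_bot"
  shows "P t \<le> CP"
proof -
  have "0 \<le> CP * exp (c * t) - exp (c * t) * P t"
  proof (rule ge_limit_at_bot[where t = t and F = "\<lambda>t. CP * exp (c * t) - exp (c * t) * P t"])
    fix x assume x: "x \<le> t"
    have x': "x < T" "x \<le> t0" using x t T by auto
    show "((\<lambda>t. CP * exp (c * t) - exp (c * t) * P t) has_real_derivative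
        CP * (exp (c * x) * c) - exp (c * x) * (\<kappa> x * max (U x) 0 powr p + g x)) (at x)"
      using fl[OF x'(1)] by (intro DERIV_diff flow_expP DERIV_cmult) (auto intro!: derivative_eq_intros)
    have "\<kappa> x * max (U x) 0 powr p \<le> 2 * k0 * CU powr p"
      using \<kappa>_bounds[OF x'(2)] k0_pos U_le_CU[OF fl T x'(1)] fl[OF x'(1)] p_gt
      by (intro mult_mono powr_mono2) auto
    moreover have "g x \<le> Cg"
    proof -
      have "\<sigma> * x \<le> 0" using \<sigma>_pos x' t0 by (simp add: mult_nonneg_nonpos)
      then have "Cg * exp (\<sigma> * x) \<le> Cg * 1" using Cg_nonneg by (intro mult_left_mono) auto
      then show ?thesis using g_bounds[OF x'(2)] by simp
    qed
    ultimately have "\<kappa> x * max (U x) 0 powr p + g x \<le> CP * c" using c_pos by (simp add: CP_def)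
    then have "exp (c * x) * (\<kappa> x * max (U x) 0 powr p + g x) \<le> exp (c * x) * (CP * c)"
      by (intro mult_left_mono) auto
    then show "0 \<le> CP * (exp (c * x) * c) - exp (c * x) * (\<kappa> x * max (U x) 0 powr p + g x)"
      by (simp add: algebra_simps)
  next
    have "((\<lambda>t. CP * exp (c * t) - exp (c * t) * P t) \<longlongrightarrow> 0 - 0) at_bot"
      by (intro tendsto_diff lim exp_mult_at_bot c_pos)
    then show "((\<lambda>t. CP * exp (c * t) - exp (c * t) * P t) \<longlongrightarrow> 0) at_bot" by simp
  qed
  then have "exp (c * t) * P t \<le> exp (c * t) * CP" by (simp add: mult.commute)
  then show ?thesis by simp
qed

section \<open>Singular orbits\<close>

lemma orbit_bounds:
  assumes "U t > 0" "U t \<le> X" "0 \<le> P t" "P t \<le> X'" "\<theta> * X + X + X' \<le> C" "X > 0"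
  shows "U t \<le> C \<and> \<bar>\<theta> * U t - P t\<bar> \<le> C"
proof -
  have "0 \<le> \<theta> * U t" "\<theta> * U t \<le> \<theta> * X" using assms \<theta>_pos by auto
  then show ?thesis using assms by (auto simp: abs_le_iff)
qed

text \<open>\<open>Q = P / U\<close> is \<open>- r u' / u\<close> in the original variables.\<close>

lemma riccati:
  assumes "flow U P t" "U t > 0"
  shows "((\<lambda>t. P t / U t) has_real_derivative
     (P t / U t)\<^sup>2 - (c + \<theta>) * (P t / U t) + (\<kappa> t * U t powr (p - 1) + g t / U t)) (at t)"
proof -
  have "((\<lambda>t. P t / U t) has_real_derivative
     ((- c * P t + \<kappa> t * max (U t) 0 powr p + g t) * U t - P t * (\<theta> * U t - P t)) / (U t * U t)) (at t)"
    using assms unfolding flow_def by (intro DERIV_divide) auto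
  moreover have "max (U t) 0 powr p = U t * U t powr (p - 1)" using assms powr_p[of "U t"] by simp
  moreover have "((- c * P t + \<kappa> t * (U t * U t powr (p - 1)) + g t) * U t - P t * (\<theta> * U t - P t)) / (U t * U t)
      = (P t / U t)\<^sup>2 - (c + \<theta>) * (P t / U t) + (\<kappa> t * U t powr (p - 1) + g t / U t)"
    using assms(2) by (simp add: field_simps power2_eq_square)
  ultimately show ?thesis by simp
qed

text \<open>With \<open>R\<close> tending to 0 the Riccati right-hand side is close to Q (Q - c -
  \<theta>), which is negative between 0 and c + \<theta>. Backward in time Q either stays at most
  \<theta>/2 or rises above \<open>q1\<close> > \<theta>. In the second case U' = U (\<theta> - Q) <
  0, so U cannot vanish at -\<infinity>. In the first case U, and with it R, decays exponentially;
  then Q is integrable, and ln u, whose t-derivative is - Q, stays bounded.\<close>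

lemma singular_not_vanishing:
  assumes fl: "\<And>t. t < T \<Longrightarrow> flow U P t \<and> U t > 0 \<and> P t \<ge> 0" and T: "T \<le> t0"
    and van: "(U \<longlongrightarrow> 0) at_bot"
    and sing: "filterlim (\<lambda>t. exp (- \<theta> * t) * U t) at_top at_bot"
  shows False
proof -
  define Q where "Q t = P t / U t" for t
  define R where "R t = \<kappa> t * U t powr (p - 1) + g t / U t" for t
  have Q: "(Q has_real_derivative (Q t)\<^sup>2 - (c + \<theta>) * Q t + R t) (at t)" "Q t \<ge> 0" "R t \<ge> 0" if "t < T" for t
    using riccati[of U P t] fl[OF that] \<kappa>_bounds[of t] k0_pos g_bounds[of t] that T
    by (auto simp: Q_def[abs_def] R_def)
  have U': "(U has_real_derivative U t * (\<theta> - Q t)) (at t)" if "t < T" for t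
    using fl[OF that] by (simp add: flow_def Q_def algebra_simps)
  have "\<forall>\<^sub>F t in at_bot. exp (- \<theta> * t) * U t \<ge> 1" using sing by (simp add: filterlim_at_top)
  \<comment> \<open>A lower bound on U is needed to control g / U in the Riccati equation; it comes
    from u \<ge> 1 near the origin.\<close>
  then have ev1: "\<forall>\<^sub>F t in at_bot. exp (\<theta> * t) \<le> U t \<and> t < T"
    using eventually_gt_at_bot[of T]
  proof eventually_elim
    case (elim t)
    have "exp (\<theta> * t) * 1 \<le> exp (\<theta> * t) * (exp (- \<theta> * t) * U t)" using elim by (intro mult_left_mono) auto
    also have "\<dots> = U t" by (simp add: mult.assoc[symmetric] exp_add[symmetric])
    finally show ?case using elim by simp
  qed
  have R_le: "\<forall>\<^sub>F t in at_bot. R t \<le> 2 * k0 * U t powr (p - 1) + Cg * exp ((\<sigma> - \<theta>) * t)"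
    using ev1
  proof eventually_elim
    case (elim t)
    have "\<kappa> t * U t powr (p - 1) \<le> 2 * k0 * U t powr (p - 1)"
      using \<kappa>_bounds[of t] elim T by (intro mult_right_mono) auto
    moreover have "g t / U t \<le> Cg * exp (\<sigma> * t) / exp (\<theta> * t)"
      using g_bounds[of t] elim T fl[of t] Cg_nonneg by (intro frac_le) auto
    ultimately show ?case by (simp add: R_def exp_diff left_diff_distrib)
  qed
  have "((\<lambda>t. 2 * k0 * U t powr (p - 1) + Cg * exp ((\<sigma> - \<theta>) * t)) \<longlongrightarrow> 2 * k0 * 0 + 0) at_bot"
  proof (intro tendsto_add tendsto_mult tendsto_const exp_mult_at_bot)
    show "((\<lambda>t. U t powr (p - 1)) \<longlongrightarrow> 0) at_bot"
      using tendsto_powr'[OF van tendsto_const[of "p - 1"]] p_gt fl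
      by (auto intro: eventually_mono[OF eventually_gt_at_bot[of T]] less_imp_le)
  qed (use \<sigma>_gt in simp)
  then have R_lim: "((\<lambda>t. 2 * k0 * U t powr (p - 1) + Cg * exp ((\<sigma> - \<theta>) * t)) \<longlongrightarrow> 0) at_bot" by simp
  \<comment> \<open>The midpoint of \<theta> and c + \<theta>. On [\<theta>/2, q1] the product Q (c
    + \<theta> - Q) is at least 2 r, so R < r leaves Q' \<le> - r.\<close>
  define q1 where "q1 = (\<theta> + (c + \<theta>)) / 2"
  have q1: "\<theta> < q1" "q1 < c + \<theta>" using \<theta>_pos c_pos by (auto simp: q1_def)
  define r where "r = \<theta> / 2 * (c + \<theta> - q1) / 2"
  have r: "r > 0" using \<theta>_pos q1 by (simp add: r_def)
  have "\<forall>\<^sub>F t in at_bot. R t < r"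
    using R_le order_tendstoD(2)[OF R_lim r] by eventually_elim simp
  with ev1 have "\<forall>\<^sub>F t in at_bot. R t < r \<and> t < T \<and> R t \<le> 2 * k0 * U t powr (p - 1) + Cg * exp ((\<sigma> - \<theta>) * t)"
    using R_le by eventually_elim simp
  then obtain t1 where t1: "\<And>t. t \<le> t1 \<Longrightarrow> R t < r \<and> t < T
      \<and> R t \<le> 2 * k0 * U t powr (p - 1) + Cg * exp ((\<sigma> - \<theta>) * t)"
    unfolding eventually_at_bot_linorder by auto
  have Q'_neg: "(Q t)\<^sup>2 - (c + \<theta>) * Q t + R t \<le> - r" if t: "t \<le> t1" "\<theta> / 2 \<le> Q t" "Q t \<le> q1" for t
  proof -
    have "\<theta> / 2 * (c + \<theta> - q1) \<le> Q t * (c + \<theta> - Q t)"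
      using t \<theta>_pos q1 by (intro mult_mono) auto
    moreover have "Q t * (c + \<theta> - Q t) = - ((Q t)\<^sup>2 - (c + \<theta>) * Q t)"
      by (simp add: algebra_simps power2_eq_square)
    moreover have "\<theta> / 2 * (c + \<theta> - q1) = 2 * r" by (simp add: r_def)
    ultimately show ?thesis using t1[OF t(1)] by linarith
  qed
  have Q_small: "Q s \<le> \<theta> / 2" if s: "s \<le> t1" for s
  proof (rule ccontr)
    assume Qs: "\<not> Q s \<le> \<theta> / 2"
    have Q_ge: "\<theta> / 2 < Q x" if x: "x \<le> s" for x
    proof (rule ccontr)
      assume "\<not> \<theta> / 2 < Q x"
      then have "Q s \<le> \<theta> / 2"
      proof (intro barrier[of x s Q "\<lambda>t. (Q t)\<^sup>2 - (c + \<theta>) * Q t + R t"])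
        fix z assume z: "x \<le> z" "z \<le> s" "Q z = \<theta> / 2"
        then show "(Q z)\<^sup>2 - (c + \<theta>) * Q z + R z < 0"
          using Q'_neg[of z] s q1 \<theta>_pos r by auto
      qed (use x s Q(1) t1 in auto)
      then show False using Qs by simp
    qed
    \<comment> \<open>Followed backward, Q gains at rate r while it remains in [\<theta>/2, q1], so
      it must leave through the top.\<close>
    have "\<exists>x0\<le>s. q1 < Q x0"
    proof (rule ccontr)
      assume "\<not> ?thesis"
      then have le: "Q x \<le> q1" if "x \<le> s" for x using that by force
      define x where "x = s - (q1 + 1) / r"
      have x: "x \<le> s" "r * (s - x) = q1 + 1" using r q1 \<theta>_pos by (auto simp: x_def)
      have "Q s - Q x \<le> - r * (s - x)"
      proof (rule deriv_diff_le[OF x(1)])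
        fix z assume z: "x \<le> z" "z \<le> s"
        show "(Q has_real_derivative (Q z)\<^sup>2 - (c + \<theta>) * Q z + R z) (at z)"
          using Q(1) t1 z s by auto
        show "(Q z)\<^sup>2 - (c + \<theta>) * Q z + R z \<le> - r"
          using Q'_neg[of z] Q_ge[of z] le[of z] z s by auto
      qed
      then show False using x le[of x] Q(2)[of s] t1[of s] s by auto
    qed
    then obtain x0 where x0: "x0 \<le> s" "q1 < Q x0" by auto
    have Q_big: "q1 < Q x" if x: "x \<le> x0" for x
    proof (rule ccontr)
      assume "\<not> q1 < Q x"
      then have "Q x0 \<le> q1"
      proof (intro barrier[of x x0 Q "\<lambda>t. (Q t)\<^sup>2 - (c + \<theta>) * Q t + R t"])
        fix z assume z: "x \<le> z" "z \<le> x0" "Q z = q1"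
        then show "(Q z)\<^sup>2 - (c + \<theta>) * Q z + R z < 0"
          using Q'_neg[of z] s x0 q1 \<theta>_pos r by auto
      qed (use x x0 s Q(1) t1 in auto)
      then show False using x0 by simp
    qed
    have "U x0 \<le> U x" if x: "x \<le> x0" for x
    proof -
      have "U x0 - U x \<le> 0 * (x0 - x)"
      proof (rule deriv_diff_le[OF x])
        fix z assume z: "x \<le> z" "z \<le> x0"
        then have zT: "z < T" using t1[of z] x0 s by auto
        show "(U has_real_derivative U z * (\<theta> - Q z)) (at z)" using U'[OF zT] .
        show "U z * (\<theta> - Q z) \<le> 0"
          using fl[OF zT] Q_big[of z] z q1 by (intro mult_nonneg_nonpos) auto
      qed
      then show ?thesis by simp
    qed
    then have "U x0 \<le> 0"
      by (intro tendsto_lowerbound[OF van eventually_mono[OF eventually_le_at_bot[of x0]]]) auto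
    moreover have "U x0 > 0" using fl t1[of x0] x0 s by auto
    ultimately show False by simp
  qed
  define K1 where "K1 = exp (- \<theta> / 2 * t1) * U t1"
  have U_le: "U t \<le> K1 * exp (\<theta> / 2 * t)" if t: "t \<le> t1" for t
  proof -
    have "0 * (t1 - t) \<le> exp (- \<theta> / 2 * t1) * U t1 - exp (- \<theta> / 2 * t) * U t"
    proof (rule deriv_diff_ge[OF t])
      fix z assume z: "t \<le> z" "z \<le> t1"
      then have zT: "z < T" using t1 by auto
      show "((\<lambda>t. exp (- \<theta> / 2 * t) * U t) has_real_derivative
          exp (- \<theta> / 2 * z) * (U z * (\<theta> / 2 - Q z))) (at z)"
        using U'[OF zT] by (auto intro!: derivative_eq_intros simp: algebra_simps)
      show "0 \<le> exp (- \<theta> / 2 * z) * (U z * (\<theta> / 2 - Q z))"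
        using Q_small[of z] z fl[OF zT] by auto
    qed
    then have "exp (\<theta> / 2 * t) * (exp (- \<theta> / 2 * t) * U t) \<le> exp (\<theta> / 2 * t) * K1"
      unfolding K1_def by (intro mult_left_mono) auto
    moreover have "exp (\<theta> / 2 * t) * exp (- \<theta> / 2 * t) = 1"
      by (simp add: exp_add[symmetric])
    ultimately show ?thesis by (metis mult.assoc mult.commute mult_1)
  qed
  have K1: "K1 > 0" using fl t1 by (simp add: K1_def)
  define k1 where "k1 = \<theta> * (p - 1) / 2"
  define k2 where "k2 = \<sigma> - \<theta>"
  have k: "k1 > 0" "k2 > 0" using \<theta>_pos p_gt \<sigma>_gt by (auto simp: k1_def k2_def)
  define M1 where "M1 = 2 * k0 * K1 powr (p - 1)"
  have M1: "M1 > 0" using k0_pos K1 by (simp add: M1_def)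
  have R_exp: "R t \<le> M1 * exp (k1 * t) + Cg * exp (k2 * t)" if t: "t \<le> t1" for t
  proof -
    have "U t powr (p - 1) \<le> (K1 * exp (\<theta> / 2 * t)) powr (p - 1)"
      using U_le[OF t] fl[of t] t1[OF t] p_gt by (intro powr_mono2) auto
    also have "\<dots> = K1 powr (p - 1) * exp (k1 * t)"
      using K1 by (simp add: powr_mult exp_powr_real k1_def algebra_simps)
    finally have "2 * k0 * U t powr (p - 1) \<le> M1 * exp (k1 * t)"
      using k0_pos by (simp add: M1_def)
    then show ?thesis using t1[OF t] by (simp add: k2_def)
  qed
  define d where "d = c + \<theta> / 2"
  have d: "d > 0" using c_pos \<theta>_pos by (simp add: d_def)
  \<comment> \<open>The first two terms are ln u. For Q \<le> \<theta>/2 one has Q' \<le> - d Q +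
    (exponential bound of R), so - Q / d and the integrated exponentials compensate (ln u)' = - Q
    and make F nondecreasing. As Q is bounded, F \<le> F t1 bounds ln u from above.\<close>
  define F where "F t = - \<theta> * t + ln (U t) - Q t / d + (M1 / k1 * exp (k1 * t) + Cg / k2 * exp (k2 * t)) / d" for t
  have F_le: "F t \<le> F t1" if t: "t \<le> t1" for t
  proof -
    have "0 * (t1 - t) \<le> F t1 - F t"
    proof (rule deriv_diff_ge[OF t])
      fix z assume z: "t \<le> z" "z \<le> t1"
      then have zT: "z < T" using t1 by auto
      show "(F has_real_derivative - \<theta> + (\<theta> - Q z) - ((Q z)\<^sup>2 - (c + \<theta>) * Q z + R z) / d
          + (M1 * exp (k1 * z) + Cg * exp (k2 * z)) / d) (at z)"
        unfolding F_def[abs_def] using U'[OF zT] Q(1)[OF zT] fl[OF zT] k d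
        by (auto intro!: derivative_eq_intros)
      have "(Q z)\<^sup>2 \<le> Q z * (\<theta> / 2)"
        unfolding power2_eq_square using Q_small[of z] Q(2)[OF zT] z by (intro mult_left_mono) auto
      then have "(Q z)\<^sup>2 - (c + \<theta>) * Q z + R z \<le> - d * Q z + (M1 * exp (k1 * z) + Cg * exp (k2 * z))"
        using R_exp[of z] z by (simp add: d_def algebra_simps)
      then have "((Q z)\<^sup>2 - (c + \<theta>) * Q z + R z) / d \<le> (- d * Q z + (M1 * exp (k1 * z) + Cg * exp (k2 * z))) / d"
        using d by (intro divide_right_mono) auto
      also have "\<dots> = - Q z + (M1 * exp (k1 * z) + Cg * exp (k2 * z)) / d"
        using d by (simp add: add_divide_distrib diff_divide_distrib)
      finally show "0 \<le> - \<theta> + (\<theta> - Q z) - ((Q z)\<^sup>2 - (c + \<theta>) * Q z + R z) / d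
          + (M1 * exp (k1 * z) + Cg * exp (k2 * z)) / d" by simp
    qed
    then show ?thesis by simp
  qed
  have bounded: "exp (- \<theta> * t) * U t \<le> exp (F t1 + \<theta> / 2 / d)" if t: "t \<le> t1" for t
  proof -
    have Ut: "U t > 0" using fl t1[OF t] by auto
    have "Q t / d \<le> \<theta> / 2 / d" using Q_small[OF t] d by (intro divide_right_mono) auto
    moreover have "(M1 / k1 * exp (k1 * t) + Cg / k2 * exp (k2 * t)) / d \<ge> 0"
      using M1 Cg_nonneg k d by simp
    ultimately have "- \<theta> * t + ln (U t) \<le> F t1 + \<theta> / 2 / d"
      using F_le[OF t] unfolding F_def[of t] by linarith
    then have "exp (- \<theta> * t + ln (U t)) \<le> exp (F t1 + \<theta> / 2 / d)" by simp
    then show ?thesis using Ut by (simp add: exp_diff exp_minus field_simps exp_add)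
  qed
  have "\<forall>\<^sub>F t in at_bot. exp (- \<theta> * t) * U t \<ge> exp (F t1 + \<theta> / 2 / d) + 1"
    using sing by (simp add: filterlim_at_top)
  then have "\<forall>\<^sub>F t::real in at_bot. False" using eventually_le_at_bot[of t1]
    by eventually_elim (use bounded in fastforce)
  then show False by simp
qed

text \<open>A negative P would persist backward, since exp (c t) P is nondecreasing, and u would
  then be bounded near the origin. With P nonnegative the orbit stays in a box, so the dichotomy
  applies, and its vanishing alternative contradicts the singularity.\<close>

lemma singular_orbit_ge:
  assumes fl: "\<And>t. t < T \<Longrightarrow> flow U P t \<and> U t > 0" and T: "T \<le> t0"
    and sing: "filterlim (\<lambda>t. exp (- \<theta> * t) * U t) at_top at_bot" and m: "m < Ueq"
  shows "\<forall>\<^sub>F t in at_bot. m \<le> U t"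
proof -
  have expP_mono: "exp (c * s) * P s \<le> exp (c * t) * P t" if st: "s \<le> t" "t < T" for s t
  proof -
    have "0 * (t - s) \<le> exp (c * t) * P t - exp (c * s) * P s"
    proof (rule deriv_diff_ge[OF st(1)])
      fix x assume x: "s \<le> x" "x \<le> t"
      show "((\<lambda>t. exp (c * t) * P t) has_real_derivative
          exp (c * x) * (\<kappa> x * max (U x) 0 powr p + g x)) (at x)"
        using flow_expP[of U P x] fl[of x] x st by auto
      show "0 \<le> exp (c * x) * (\<kappa> x * max (U x) 0 powr p + g x)"
        using source_nonneg[of x U] x st T by simp
    qed
    then show ?thesis by simp
  qed
  have P_nonneg: "P t \<ge> 0" if t: "t < T" for t
  proof (rule ccontr)
    assume neg: "\<not> P t \<ge> 0"
    have le: "exp (- \<theta> * s) * U s \<le> exp (- \<theta> * t) * U t" if s: "s \<le> t" for s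
    proof -
      have "0 * (t - s) \<le> exp (- \<theta> * t) * U t - exp (- \<theta> * s) * U s"
      proof (rule deriv_diff_ge[OF s])
        fix x assume x: "s \<le> x" "x \<le> t"
        show "((\<lambda>t. exp (- \<theta> * t) * U t) has_real_derivative - (exp (- \<theta> * x) * P x)) (at x)"
          using flow_expU[of U P x] fl[of x] x t by auto
        have "exp (c * x) * P x \<le> exp (c * t) * P t" using expP_mono x t by auto
        also have "\<dots> < 0" using neg by (simp add: mult_pos_neg)
        finally have "P x < 0" by (simp add: mult_less_0_iff)
        then show "0 \<le> - (exp (- \<theta> * x) * P x)" by (simp add: mult_nonneg_nonpos)
      qed
      then show ?thesis by simp
    qed
    have "\<forall>\<^sub>F s in at_bot. exp (- \<theta> * s) * U s \<ge> exp (- \<theta> * t) * U t + 1"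
      using sing by (simp add: filterlim_at_top)
    then have "\<forall>\<^sub>F s::real in at_bot. False" using eventually_le_at_bot[of t]
      by eventually_elim (use le in fastforce)
    then show False by simp
  qed
  have fl': "flow U P t \<and> U t > 0 \<and> P t \<ge> 0" if "t < T" for t using fl P_nonneg that by auto
  \<comment> \<open>No limit of exp (c t) P is assumed here, so \<open>P_le_CP\<close> is not at
    hand. Instead, over [t, t + 1] u falls by at least a multiple of P t, and it is still positive
    at t + 1.\<close>
  have P_le: "P t \<le> exp (\<theta> + c) * U t" if t: "t < T - 1" for t
  proof -
    have "exp (- \<theta> * (t + 1)) * U (t + 1) - exp (- \<theta> * t) * U t
        \<le> - (exp (- (\<theta> + c) * (t + 1)) * (exp (c * t) * P t)) * (t + 1 - t)"
    proof (rule deriv_diff_le)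
      fix x assume x: "t \<le> x" "x \<le> t + 1"
      show "((\<lambda>t. exp (- \<theta> * t) * U t) has_real_derivative - (exp (- \<theta> * x) * P x)) (at x)"
        using flow_expU[of U P x] fl[of x] x t by auto
      have "exp (- (\<theta> + c) * (t + 1)) * (exp (c * t) * P t) \<le> exp (- (\<theta> + c) * x) * (exp (c * x) * P x)"
      proof (rule mult_mono)
        show "exp (- (\<theta> + c) * (t + 1)) \<le> exp (- (\<theta> + c) * x)"
          using x \<theta>_pos c_pos by simp
        show "exp (c * t) * P t \<le> exp (c * x) * P x" using expP_mono[of t x] x t by simp
      qed (use P_nonneg[of t] t in auto)
      also have "\<dots> = (exp (- (\<theta> + c) * x) * exp (c * x)) * P x" by simp
      also have "exp (- (\<theta> + c) * x) * exp (c * x) = exp (- \<theta> * x)"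
        by (simp add: exp_add[symmetric] algebra_simps)
      finally show "- (exp (- \<theta> * x) * P x) \<le> - (exp (- (\<theta> + c) * (t + 1)) * (exp (c * t) * P t))" by simp
    qed simp
    moreover have "exp (- \<theta> * (t + 1)) * U (t + 1) \<ge> 0" using fl[of "t + 1"] t by simp
    ultimately have "exp (- (\<theta> + c) * (t + 1)) * (exp (c * t) * P t) \<le> exp (- \<theta> * t) * U t" by simp
    then have "exp (\<theta> * t + (\<theta> + c)) * (exp (- (\<theta> + c) * (t + 1)) * (exp (c * t) * P t))
        \<le> exp (\<theta> * t + (\<theta> + c)) * (exp (- \<theta> * t) * U t)" by (intro mult_left_mono) auto
    moreover have "exp (\<theta> * t + (\<theta> + c)) * (exp (- (\<theta> + c) * (t + 1)) * exp (c * t)) = 1"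
      "exp (\<theta> * t + (\<theta> + c)) * exp (- \<theta> * t) = exp (\<theta> + c)"
      by (simp_all add: exp_add[symmetric] algebra_simps)
    ultimately show ?thesis by (metis mult.assoc mult_1)
  qed
  define C where "C = \<theta> * CU + CU + exp (\<theta> + c) * CU"
  have orb: "orbit (\<lambda>t. pert t (U t)) U (\<lambda>t. \<theta> * U t - P t) t \<and> U t \<le> C \<and> \<bar>\<theta> * U t - P t\<bar> \<le> C"
    if t: "t \<le> T - 2" for t
  proof (intro conjI)
    show "orbit (\<lambda>t. pert t (U t)) U (\<lambda>t. \<theta> * U t - P t) t" using flow_orbit fl t by simp
    have UCU: "U t \<le> CU" using U_le_CU[OF fl' T, of t] t by simp
    have "P t \<le> exp (\<theta> + c) * U t" using P_le t by simp
    also have "\<dots> \<le> exp (\<theta> + c) * CU" using UCU by simp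
    finally have "U t \<le> C \<and> \<bar>\<theta> * U t - P t\<bar> \<le> C"
      using UCU fl'[of t] t CU_pos by (intro orbit_bounds[of U t CU P]) (auto simp: C_def)
    then show "U t \<le> C" "\<bar>\<theta> * U t - P t\<bar> \<le> C" by auto
  qed
  have "((\<lambda>t. pert t (U t)) \<longlongrightarrow> 0) at_bot"
  proof (rule tendstoI)
    fix w :: real assume w: "w > 0"
    have "\<forall>\<^sub>F t in at_bot. \<bar>pert t (U t)\<bar> \<le> w / 2"
      using pert_small[OF half_gt_zero[OF w], of C] eventually_le_at_bot[of "T - 2"]
    proof eventually_elim
      case (elim t)
      then show ?case using orb[of t] by (auto simp: orbit_def)
    qed
    then show "\<forall>\<^sub>F t in at_bot. dist (pert t (U t)) 0 < w"
      by eventually_elim (use w in \<open>auto simp: dist_real_def\<close>)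
  qed
  from backward_dichotomy[OF orb this] show ?thesis
  proof
    assume E: "\<forall>d>0. \<forall>\<^sub>F t in at_bot. energy (U t) (\<theta> * U t - P t) \<le> Emin + d"
    from energy_near_min[OF m] obtain e where e: "e > 0"
      "\<And>U V. 0 < U \<Longrightarrow> energy U V \<le> Emin + e \<Longrightarrow> m \<le> U" by metis
    have "\<forall>\<^sub>F t in at_bot. energy (U t) (\<theta> * U t - P t) \<le> Emin + e" using E e by blast
    then show ?thesis using eventually_gt_at_bot[of T]
      by eventually_elim (use e fl in blast)
  next
    assume "(U \<longlongrightarrow> 0) at_bot"
    then show ?thesis using singular_not_vanishing[OF fl' T _ sing] by blast
  qed
qed

section \<open>Regular orbits\<close>

text \<open>The two limits say that r^(N-1) u' tends to 0 and u to \<zeta> at the origin. Positivity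
  of U is not included; it is proved below for large \<zeta>, on a suitable half-line.\<close>

definition regular_orbit :: "real \<Rightarrow> (real \<Rightarrow> real) \<Rightarrow> (real \<Rightarrow> real) \<Rightarrow> bool" where
  "regular_orbit \<zeta> U P \<longleftrightarrow> (\<forall>t\<le>t0. flow U P t) \<and> ((\<lambda>t. exp (c * t) * P t) \<longlongrightarrow> 0) at_bot \<and>
     ((\<lambda>t. exp (- \<theta> * t) * U t) \<longlongrightarrow> \<zeta>) at_bot"

lemma regular_P_nonneg:
  assumes reg: "regular_orbit \<zeta> U P" and t: "t \<le> t0"
  shows "P t \<ge> 0"
proof -
  have "0 \<le> exp (c * t) * P t"
  proof (rule ge_limit_at_bot[where t = t and F = "\<lambda>t. exp (c * t) * P t"])
    fix x assume x: "x \<le> t"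
    then show "((\<lambda>t. exp (c * t) * P t) has_real_derivative
        exp (c * x) * (\<kappa> x * max (U x) 0 powr p + g x)) (at x)"
      using reg t by (intro flow_expP) (simp add: regular_orbit_def)
    show "0 \<le> exp (c * x) * (\<kappa> x * max (U x) 0 powr p + g x)"
      using source_nonneg[of x U] x t by simp
  qed (use reg in \<open>simp add: regular_orbit_def\<close>)
  then show ?thesis by (simp add: zero_le_mult_iff)
qed

lemma regular_U_le:
  assumes reg: "regular_orbit \<zeta> U P" and t: "t \<le> t0"
  shows "U t \<le> \<zeta> * exp (\<theta> * t)"
proof -
  have "- \<zeta> \<le> - (exp (- \<theta> * t) * U t)"
  proof (rule ge_limit_at_bot[where F = "\<lambda>t. - (exp (- \<theta> * t) * U t)"])
    fix x assume x: "x \<le> t"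
    show "((\<lambda>t. - (exp (- \<theta> * t) * U t)) has_real_derivative - (- (exp (- \<theta> * x) * P x))) (at x)"
      using reg x t by (intro DERIV_minus flow_expU) (auto simp: regular_orbit_def)
    show "0 \<le> - (- (exp (- \<theta> * x) * P x))" using regular_P_nonneg[OF reg, of x] x t by simp
  qed (use reg in \<open>auto simp: regular_orbit_def intro: tendsto_minus\<close>)
  then have "exp (\<theta> * t) * (exp (- \<theta> * t) * U t) \<le> exp (\<theta> * t) * \<zeta>" by (intro mult_left_mono) auto
  moreover have "exp (\<theta> * t) * exp (- \<theta> * t) = 1" by (simp add: exp_add[symmetric])
  ultimately show ?thesis by (metis mult.assoc mult.commute mult_1)
qed

lemma DERIV_exp_mult: "((\<lambda>t. x * exp (k * t)) has_real_derivative x * k * exp (k * y)) (at y)"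
  for x k y :: real
  by (auto intro!: derivative_eq_intros)

text \<open>One Picard step: U \<le> \<zeta> exp (\<theta> t) inserted into the equation of P gives
  \<open>b1\<close> and \<open>b2\<close>, and the resulting bound of P inserted into the equation
  of U gives \<open>d1\<close> and \<open>d2\<close>. The denominators are the exponents that are
  integrated.\<close>

definition b1 :: real where "b1 = 2 * k0 / (c + \<theta> * p)"
definition b2 :: real where "b2 = Cg / (c + \<sigma>)"
definition d1 :: real where "d1 = b1 / (\<theta> * (p - 1))"
definition d2 :: real where "d2 = b2 / (\<sigma> - \<theta>)"

lemma exponent_pos: "c + \<theta> * p > 0" "c + \<sigma> > 0"
  using c_pos \<theta>_pos p_gt \<sigma>_pos by (auto intro!: add_pos_pos)

lemma b_nonneg: "b1 > 0" "b2 \<ge> 0" "d1 > 0" "d2 \<ge> 0"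
proof -
  show b: "b1 > 0" "b2 \<ge> 0" using k0_pos Cg_nonneg exponent_pos by (auto simp: b1_def b2_def)
  show "d1 > 0" "d2 \<ge> 0" using b \<theta>_pos p_gt \<sigma>_gt by (auto simp: d1_def d2_def)
qed

lemma regular_P_le:
  assumes reg: "regular_orbit \<zeta> U P" and t: "t \<le> t0" and \<zeta>: "\<zeta> > 0"
  shows "P t \<le> b1 * (\<zeta> * exp (\<theta> * t)) powr p + b2 * exp (\<sigma> * t)"
proof -
  have pw: "(\<zeta> * exp (\<theta> * x)) powr p = \<zeta> powr p * exp (\<theta> * p * x)" for x
    using \<zeta> by (simp add: powr_mult exp_powr_real algebra_simps)
  define k where "k = c + \<theta> * p"
  define k' where "k' = c + \<sigma>"
  have k: "k > 0" "k' > 0" using exponent_pos by (auto simp: k_def k'_def)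
  have "0 \<le> b1 * \<zeta> powr p * exp (k * t) + b2 * exp (k' * t) - exp (c * t) * P t"
  proof (rule ge_limit_at_bot[where t = t and F = "\<lambda>t. b1 * \<zeta> powr p * exp (k * t) + b2 * exp (k' * t) - exp (c * t) * P t"])
    fix x assume x: "x \<le> t"
    show "((\<lambda>t. b1 * \<zeta> powr p * exp (k * t) + b2 * exp (k' * t) - exp (c * t) * P t) has_real_derivative
        2 * k0 * \<zeta> powr p * exp (k * x) + Cg * exp (k' * x)
        - exp (c * x) * (\<kappa> x * max (U x) 0 powr p + g x)) (at x)"
    proof (rule DERIV_diff)
      have "b1 = 2 * k0 / k" "b2 = Cg / k'" by (simp_all add: b1_def b2_def k_def k'_def)
      then have "b1 * k = 2 * k0" "b2 * k' = Cg" using k by simp_all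
      then have "b1 * \<zeta> powr p * k = 2 * k0 * \<zeta> powr p" by (simp add: mult.commute mult.left_commute)
      then show "((\<lambda>t. b1 * \<zeta> powr p * exp (k * t) + b2 * exp (k' * t)) has_real_derivative
          2 * k0 * \<zeta> powr p * exp (k * x) + Cg * exp (k' * x)) (at x)"
        using DERIV_add[OF DERIV_exp_mult[of "b1 * \<zeta> powr p" k x] DERIV_exp_mult[of b2 k' x]]
          \<open>b2 * k' = Cg\<close> by (simp only:)
      show "((\<lambda>t. exp (c * t) * P t) has_real_derivative
          exp (c * x) * (\<kappa> x * max (U x) 0 powr p + g x)) (at x)"
        using reg x t by (intro flow_expP) (auto simp: regular_orbit_def)
    qed
    have x0: "x \<le> t0" using x t by simp
    have "max (U x) 0 powr p \<le> (\<zeta> * exp (\<theta> * x)) powr p"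
      using regular_U_le[OF reg x0] \<zeta> p_gt by (intro powr_mono2) auto
    then have "\<kappa> x * max (U x) 0 powr p \<le> 2 * k0 * (\<zeta> powr p * exp (\<theta> * p * x))"
      unfolding pw using \<kappa>_bounds[OF x0] k0_pos by (intro mult_mono) auto
    then have "exp (c * x) * (\<kappa> x * max (U x) 0 powr p + g x) \<le>
        exp (c * x) * (2 * k0 * (\<zeta> powr p * exp (\<theta> * p * x)) + Cg * exp (\<sigma> * x))"
      using g_bounds[OF x0] by (intro mult_left_mono add_mono) auto
    also have "\<dots> = 2 * k0 * \<zeta> powr p * exp (k * x) + Cg * exp (k' * x)"
      by (simp add: k_def k'_def distrib_right exp_add algebra_simps)
    finally show "0 \<le> 2 * k0 * \<zeta> powr p * exp (k * x) + Cg * exp (k' * x)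
        - exp (c * x) * (\<kappa> x * max (U x) 0 powr p + g x)" by simp
  next
    have "((\<lambda>t. b1 * \<zeta> powr p * exp (k * t) + b2 * exp (k' * t) - exp (c * t) * P t) \<longlongrightarrow> 0 + 0 - 0) at_bot"
      using reg k by (intro tendsto_diff tendsto_add exp_mult_at_bot) (auto simp: regular_orbit_def)
    then show "((\<lambda>t. b1 * \<zeta> powr p * exp (k * t) + b2 * exp (k' * t) - exp (c * t) * P t) \<longlongrightarrow> 0) at_bot" by simp
  qed
  then have "exp (c * t) * P t \<le> exp (c * t) * (b1 * (\<zeta> powr p * exp (\<theta> * p * t)) + b2 * exp (\<sigma> * t))"
    by (simp add: k_def k'_def distrib_right exp_add algebra_simps)
  then show ?thesis by (simp add: pw)
qed

lemma regular_U_ge: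
  assumes reg: "regular_orbit \<zeta> U P" and t: "t \<le> t0" and \<zeta>: "\<zeta> > 0"
  shows "\<zeta> * exp (\<theta> * t) - d1 * (\<zeta> * exp (\<theta> * t)) powr p - d2 * exp (\<sigma> * t) \<le> U t"
proof -
  have pw: "(\<zeta> * exp (\<theta> * x)) powr p = \<zeta> powr p * exp (\<theta> * p * x)" for x
    using \<zeta> by (simp add: powr_mult exp_powr_real algebra_simps)
  define k where "k = \<theta> * (p - 1)"
  define k' where "k' = \<sigma> - \<theta>"
  have k: "k > 0" "k' > 0" using \<theta>_pos p_gt \<sigma>_gt by (auto simp: k_def k'_def)
  have "\<zeta> \<le> exp (- \<theta> * t) * U t + (d1 * \<zeta> powr p * exp (k * t) + d2 * exp (k' * t))"
  proof (rule ge_limit_at_bot[where t = t and F = "\<lambda>t. exp (- \<theta> * t) * U t + (d1 * \<zeta> powr p * exp (k * t) + d2 * exp (k' * t))"])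
    fix x assume x: "x \<le> t"
    show "((\<lambda>t. exp (- \<theta> * t) * U t + (d1 * \<zeta> powr p * exp (k * t) + d2 * exp (k' * t))) has_real_derivative
        - (exp (- \<theta> * x) * P x) + (b1 * \<zeta> powr p * exp (k * x) + b2 * exp (k' * x))) (at x)"
    proof (rule DERIV_add)
      have "d1 = b1 / k" "d2 = b2 / k'" by (simp_all add: d1_def d2_def k_def k'_def)
      then have "d1 * k = b1" "d2 * k' = b2" using k by simp_all
      then have "d1 * \<zeta> powr p * k = b1 * \<zeta> powr p" by (simp add: mult.commute mult.left_commute)
      then show "((\<lambda>t. d1 * \<zeta> powr p * exp (k * t) + d2 * exp (k' * t)) has_real_derivative
          b1 * \<zeta> powr p * exp (k * x) + b2 * exp (k' * x)) (at x)"
        using DERIV_add[OF DERIV_exp_mult[of "d1 * \<zeta> powr p" k x] DERIV_exp_mult[of d2 k' x]]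
          \<open>d2 * k' = b2\<close> by (simp only:)
      show "((\<lambda>t. exp (- \<theta> * t) * U t) has_real_derivative - (exp (- \<theta> * x) * P x)) (at x)"
        using reg x t by (intro flow_expU) (auto simp: regular_orbit_def)
    qed
    have "exp (- \<theta> * x) * P x \<le> exp (- \<theta> * x) * (b1 * (\<zeta> * exp (\<theta> * x)) powr p + b2 * exp (\<sigma> * x))"
      using regular_P_le[OF reg _ \<zeta>, of x] x t by (intro mult_left_mono) auto
    also have "\<dots> = b1 * \<zeta> powr p * (exp (- \<theta> * x) * exp (\<theta> * p * x)) + b2 * (exp (- \<theta> * x) * exp (\<sigma> * x))"
      by (simp add: pw algebra_simps)
    also have "exp (- \<theta> * x) * exp (\<theta> * p * x) = exp (k * x)"
      by (simp add: exp_add[symmetric] k_def algebra_simps)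
    also have "exp (- \<theta> * x) * exp (\<sigma> * x) = exp (k' * x)"
      by (simp add: exp_add[symmetric] k'_def algebra_simps)
    finally show "0 \<le> - (exp (- \<theta> * x) * P x) + (b1 * \<zeta> powr p * exp (k * x) + b2 * exp (k' * x))" by simp
  next
    have "((\<lambda>t. exp (- \<theta> * t) * U t + (d1 * \<zeta> powr p * exp (k * t) + d2 * exp (k' * t))) \<longlongrightarrow> \<zeta> + (0 + 0)) at_bot"
      using reg k by (intro tendsto_add exp_mult_at_bot) (auto simp: regular_orbit_def)
    then show "((\<lambda>t. exp (- \<theta> * t) * U t + (d1 * \<zeta> powr p * exp (k * t) + d2 * exp (k' * t))) \<longlongrightarrow> \<zeta>) at_bot" by simp
  qed
  then have "exp (\<theta> * t) * \<zeta> \<le> exp (\<theta> * t) *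
      (exp (- \<theta> * t) * U t + (d1 * \<zeta> powr p * exp (k * t) + d2 * exp (k' * t)))"
    by (intro mult_left_mono) auto
  also have "\<dots> = (exp (\<theta> * t) * exp (- \<theta> * t)) * U t + (d1 * \<zeta> powr p * (exp (\<theta> * t) * exp (k * t))
      + d2 * (exp (\<theta> * t) * exp (k' * t)))" by (simp only: distrib_left mult.assoc mult.left_commute)
  also have "exp (\<theta> * t) * exp (- \<theta> * t) = 1" by (simp add: exp_add[symmetric])
  also have "exp (\<theta> * t) * exp (k * t) = exp (\<theta> * p * t)"
    by (simp add: exp_add[symmetric] k_def algebra_simps)
  also have "exp (\<theta> * t) * exp (k' * t) = exp (\<sigma> * t)"
    by (simp add: exp_add[symmetric] k'_def algebra_simps)
  finally show ?thesis by (simp add: pw algebra_simps)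
qed

text \<open>A regular orbit leaves the origin along the unstable direction \<open>P = 0\<close>, where the energy is negative.\<close>

lemma regular_start:
  obtains y0 \<zeta>0 \<delta> where "0 < y0" "0 < \<zeta>0" "0 < \<delta>"
    "\<And>\<zeta> U P t. \<zeta>0 \<le> \<zeta> \<Longrightarrow> regular_orbit \<zeta> U P \<Longrightarrow> t \<le> t0 \<Longrightarrow> \<zeta> * exp (\<theta> * t) \<le> y0 \<Longrightarrow> U t > 0"
    "\<And>\<zeta> U P t. \<zeta>0 \<le> \<zeta> \<Longrightarrow> regular_orbit \<zeta> U P \<Longrightarrow> t \<le> t0 \<Longrightarrow> \<zeta> * exp (\<theta> * t) = y0 \<Longrightarrow>
       energy (U t) (\<theta> * U t - P t) \<le> - \<delta>"
proof -
  \<comment> \<open>On the line V = \<theta> U the quadratic part of the energy is - \<gamma> U^2 /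
    2, and \<gamma> = \<theta> (c - \<theta>).\<close>
  define \<gamma> where "\<gamma> = spring - \<theta>\<^sup>2"
  have \<gamma>: "\<gamma> > 0" using \<theta>_pos c_gt by (simp add: \<gamma>_def spring_def power2_eq_square)
  \<comment> \<open>An upper limit for y^(p-1): the power terms in the bounds of U and P become at
    most y/4 and \<theta> y/4, and the power term of the energy at most half of \<gamma> U^2 /
    2.\<close>
  define X where "X = Min {1 / (4 * d1), \<theta> / (4 * b1), (p + 1) * \<gamma> / (4 * k0)}"
  have X_pos: "X > 0"
    using b_nonneg \<theta>_pos \<gamma> k0_pos p_gt by (simp add: X_def)
  have X: "d1 * X \<le> 1 / 4" "b1 * X \<le> \<theta> / 4" "k0 * X / (p + 1) \<le> \<gamma> / 4"
  proof -
    have le: "X \<le> 1 / (4 * d1)" "X \<le> \<theta> / (4 * b1)" "X \<le> (p + 1) * \<gamma> / (4 * k0)" by (auto simp: X_def)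
    then show "d1 * X \<le> 1 / 4" "b1 * X \<le> \<theta> / 4" using b_nonneg by (auto simp: field_simps)
    have "k0 * X \<le> \<gamma> / 4 * (p + 1)" using le(3) k0_pos by (simp add: field_simps)
    then show "k0 * X / (p + 1) \<le> \<gamma> / 4" using p_gt by (subst pos_divide_le_eq) auto
  qed
  define y0 where "y0 = X powr (1 / (p - 1))"
  have y0: "y0 > 0" "y0 powr (p - 1) = X" using X_pos p_gt by (auto simp: y0_def powr_powr)
  \<comment> \<open>For these \<zeta> the contributions of g are also at most y/4 and \<theta> y/4,
    because exp (\<sigma> t) \<le> exp (\<theta> t) = y / \<zeta>.\<close>
  define \<zeta>0 where "\<zeta>0 = 1 + 4 * d2 + 4 * b2 / \<theta>"
  have \<zeta>0: "\<zeta>0 \<ge> 1" using b_nonneg \<theta>_pos by (simp add: \<zeta>0_def)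
  \<comment> \<open>y is the value of the linearised solution. The outcome 0 \<le> P \<le> \<theta>
    U gives V^2 \<le> (\<theta> U)^2, which is what the energy estimate uses.\<close>
  have main: "y / 2 \<le> U t \<and> U t \<le> y \<and> 0 \<le> P t \<and> P t \<le> \<theta> * U t"
    if \<zeta>: "\<zeta>0 \<le> \<zeta>" and reg: "regular_orbit \<zeta> U P" and t: "t \<le> t0" and y: "y = \<zeta> * exp (\<theta> * t)" "y \<le> y0"
    for \<zeta> U P t y
  proof -
    have \<zeta>_pos: "\<zeta> > 0" using \<zeta> \<zeta>0 by simp
    have y_pos: "y > 0" using y \<zeta>_pos by simp
    have "exp (\<sigma> * t) \<le> exp (\<theta> * t)" using \<sigma>_gt t t0 by (simp add: mult_right_mono_neg)
    moreover have "exp (\<theta> * t) = y / \<zeta>" using y \<zeta>_pos by simp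
    ultimately have e: "exp (\<sigma> * t) \<le> y / \<zeta>" by simp
    have le1: "d2 * exp (\<sigma> * t) \<le> d2 * (y / \<zeta>)" "b2 * exp (\<sigma> * t) \<le> b2 * (y / \<zeta>)"
      by (rule mult_left_mono[OF e b_nonneg(4)], rule mult_left_mono[OF e b_nonneg(2)])
    have "d2 / \<zeta> \<le> 1 / 4" "b2 / \<zeta> \<le> \<theta> / 4"
    proof -
      have "4 * d2 \<le> \<zeta>" "4 * b2 / \<theta> \<le> \<zeta>"
        using \<zeta> b_nonneg \<theta>_pos unfolding \<zeta>0_def by (smt (verit) divide_nonneg_pos)+
      then show "d2 / \<zeta> \<le> 1 / 4" "b2 / \<zeta> \<le> \<theta> / 4" using \<zeta>_pos \<theta>_pos by (auto simp: field_simps)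
    qed
    then have le2: "d2 / \<zeta> * y \<le> 1 / 4 * y" "b2 / \<zeta> * y \<le> \<theta> / 4 * y"
      using y_pos by (auto intro!: mult_right_mono simp del: times_divide_eq_left)
    have "y powr (p - 1) \<le> X" unfolding y0(2)[symmetric] using y y_pos p_gt by (intro powr_mono2) auto
    then have "d1 * y powr (p - 1) \<le> d1 * X" "b1 * y powr (p - 1) \<le> b1 * X"
      using b_nonneg by simp_all
    then have "d1 * y powr (p - 1) \<le> 1 / 4" "b1 * y powr (p - 1) \<le> \<theta> / 4"
      using X by linarith+
    then have le3: "(d1 * y powr (p - 1)) * y \<le> 1 / 4 * y" "(b1 * y powr (p - 1)) * y \<le> \<theta> / 4 * y"
      using y_pos by (auto intro!: mult_right_mono simp del: times_divide_eq_left)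
    have yp: "y powr p = y * y powr (p - 1)" using powr_p[of y] y_pos by simp
    have *: "d2 * exp (\<sigma> * t) \<le> y / 4" "b2 * exp (\<sigma> * t) \<le> \<theta> * y / 4"
      using order_trans[OF le1(1), of "y / 4"] order_trans[OF le1(2), of "\<theta> * y / 4"] le2 by simp_all
    have **: "d1 * y powr p \<le> y / 4" "b1 * y powr p \<le> \<theta> * y / 4"
      using le3 unfolding yp by (simp_all add: mult_ac)
    have U: "y / 2 \<le> U t" using regular_U_ge[OF reg t \<zeta>_pos] * ** unfolding y(1)[symmetric] by linarith
    have "P t \<le> \<theta> * y / 2" using regular_P_le[OF reg t \<zeta>_pos] * ** unfolding y(1)[symmetric] by linarith
    moreover have "\<theta> * (y / 2) \<le> \<theta> * U t" using U \<theta>_pos by (intro mult_left_mono) auto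
    ultimately show ?thesis
      using U regular_U_le[OF reg t] regular_P_nonneg[OF reg t] y by auto
  qed
  show ?thesis
  proof (rule that[of y0 \<zeta>0 "\<gamma> * y0\<^sup>2 / 16"])
    show "0 < y0" "0 < \<zeta>0" "0 < \<gamma> * y0\<^sup>2 / 16" using y0 \<zeta>0 \<gamma> by auto
    fix \<zeta> U P t assume \<zeta>: "\<zeta>0 \<le> \<zeta>" and reg: "regular_orbit \<zeta> U P" and t: "t \<le> t0"
    { assume "\<zeta> * exp (\<theta> * t) \<le> y0"
      then show "U t > 0" using main[OF \<zeta> reg t refl] \<zeta> \<zeta>0 exp_gt_zero[of "\<theta> * t"]
        by (smt (verit) half_gt_zero mult_pos_pos) }
    assume y: "\<zeta> * exp (\<theta> * t) = y0"
    from main[OF \<zeta> reg t y[symmetric]]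
    have *: "y0 / 2 \<le> U t" "U t \<le> y0" "0 \<le> P t" "P t \<le> \<theta> * U t" by auto
    have Up: "U t > 0" using * y0 by simp
    have "(\<theta> * U t - P t)\<^sup>2 \<le> (\<theta> * U t)\<^sup>2" using * by (intro power_mono) auto
    moreover have "k0 * U t powr (p + 1) / (p + 1) \<le> \<gamma> / 4 * (U t)\<^sup>2"
    proof -
      have "U t powr (p - 1) \<le> X" unfolding y0(2)[symmetric] using * Up p_gt by (intro powr_mono2) auto
      then have "k0 * U t powr (p - 1) / (p + 1) \<le> k0 * X / (p + 1)"
        using k0_pos p_gt by (intro divide_right_mono mult_left_mono) auto
      then have "k0 * U t powr (p - 1) / (p + 1) * (U t)\<^sup>2 \<le> \<gamma> / 4 * (U t)\<^sup>2"
        by (intro mult_right_mono order_trans[OF _ X(3)]) auto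
      moreover have "U t powr (p + 1) = U t powr (p - 1) * (U t)\<^sup>2"
        using Up powr_Suc_p[of "U t"] powr_p[of "U t"] by (simp add: power2_eq_square)
      ultimately show ?thesis by simp
    qed
    ultimately have "energy (U t) (\<theta> * U t - P t) \<le> (\<theta> * U t)\<^sup>2 / 2 - spring * (U t)\<^sup>2 / 2 + \<gamma> / 4 * (U t)\<^sup>2"
      unfolding energy_def by linarith
    also have "\<dots> = - (\<gamma> / 4) * (U t)\<^sup>2" by (simp add: \<gamma>_def algebra_simps power2_eq_square add_divide_distrib)
    also have "\<dots> \<le> - (\<gamma> / 4) * (y0 / 2)\<^sup>2"
      using * \<gamma> y0 by (intro mult_left_mono_neg power_mono) auto
    finally show "energy (U t) (\<theta> * U t - P t) \<le> - (\<gamma> * y0\<^sup>2 / 16)" by (simp add: power2_eq_square)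
  qed
qed

text \<open>\<open>trap\<close> is started at the time s with \<zeta> exp (\<theta> s) = y0, where
  the energy is uniformly negative. Its waiting time is independent of \<zeta>, so \<zeta> enters
  only through the shift - ln \<zeta> / \<theta>.\<close>

lemma regular_orbits_ge:
  assumes m: "m < Ueq"
  obtains t1 \<Delta> \<zeta>0 where "t1 \<le> t0" "\<zeta>0 > 0"
    "\<And>\<zeta> U P t. \<zeta>0 \<le> \<zeta> \<Longrightarrow> regular_orbit \<zeta> U P \<Longrightarrow> \<Delta> - ln \<zeta> / \<theta> \<le> t \<Longrightarrow> t < t1 \<Longrightarrow> 0 < U t \<and> m \<le> U t"
proof -
  obtain y0 \<zeta>0 \<delta> where y0: "0 < y0" "0 < \<zeta>0" "0 < \<delta>" and
    start_pos: "\<And>\<zeta> U P t. \<zeta>0 \<le> \<zeta> \<Longrightarrow> regular_orbit \<zeta> U P \<Longrightarrow> t \<le> t0 \<Longrightarrow> \<zeta> * exp (\<theta> * t) \<le> y0 \<Longrightarrow> U t > 0" and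
    start: "\<And>\<zeta> U P t. \<zeta>0 \<le> \<zeta> \<Longrightarrow> regular_orbit \<zeta> U P \<Longrightarrow> t \<le> t0 \<Longrightarrow> \<zeta> * exp (\<theta> * t) = y0 \<Longrightarrow>
       energy (U t) (\<theta> * U t - P t) \<le> - \<delta>" using regular_start by metis
  from energy_near_min[OF m] obtain e0 where e0: "e0 > 0"
    "\<And>U V. 0 < U \<Longrightarrow> energy U V \<le> Emin + e0 \<Longrightarrow> m \<le> U" by metis
  define e where "e = min (min (e0 / 2) (\<delta> / 3)) (- Emin / 4)"
  have e: "e > 0" "2 * e \<le> e0" "3 * e \<le> \<delta>" "Emin + e < - 2 * e"
    using e0 y0 Emin_neg by (auto simp: e_def min_def)
  define C where "C = \<theta> * CU + CU + CP"
  have C: "C > 0" using CU_pos CP_pos \<theta>_pos by (simp add: C_def add_pos_pos)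
  from trap[OF e(1) C e(4)] obtain T w where T: "T > 0" "w > 0" and
    trap: "\<And>U V G s y t. (\<And>t. s \<le> t \<Longrightarrow> t < y \<Longrightarrow> orbit G U V t \<and> U t \<le> C \<and> \<bar>V t\<bar> \<le> C \<and> \<bar>G t\<bar> \<le> w) \<Longrightarrow>
      energy (U s) (V s) \<le> - 3 * e \<Longrightarrow> s \<le> t \<Longrightarrow> t < y \<Longrightarrow>
      energy (U t) (V t) \<le> - e \<and> (s + T \<le> t \<longrightarrow> energy (U t) (V t) \<le> Emin + 2 * e)" by metis
  from pert_small[OF T(2), of C] obtain t2 where t2: "\<And>t x. t \<le> t2 \<Longrightarrow> 0 \<le> x \<Longrightarrow> x \<le> C \<Longrightarrow> \<bar>pert t x\<bar> \<le> w"
    unfolding eventually_at_bot_linorder by blast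
  define t1 where "t1 = min t0 t2"
  show ?thesis
  proof (rule that[of t1 \<zeta>0 "ln y0 / \<theta> + T"])
    fix \<zeta> U P t assume \<zeta>: "\<zeta>0 \<le> \<zeta>" and reg: "regular_orbit \<zeta> U P"
      and t: "ln y0 / \<theta> + T - ln \<zeta> / \<theta> \<le> t" "t < t1"
    have \<zeta>_pos: "\<zeta> > 0" using \<zeta> y0 by simp
    define s where "s = (ln y0 - ln \<zeta>) / \<theta>"
    have s: "s + T \<le> t" "s < t1" using t T by (auto simp: s_def diff_divide_distrib)
    have s_eq: "\<zeta> * exp (\<theta> * s) = y0" using y0 \<zeta>_pos \<theta>_pos by (simp add: s_def exp_diff)
    have pos_s: "U x > 0" if x: "x \<le> s" for x
    proof (rule start_pos[OF \<zeta> reg])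
      have "\<theta> * x \<le> \<theta> * s" using x \<theta>_pos by simp
      then show "\<zeta> * exp (\<theta> * x) \<le> y0" unfolding s_eq[symmetric] using \<zeta>_pos by simp
    qed (use x s t1_def in auto)
    \<comment> \<open>\<open>trap\<close> presupposes positivity, so it is stated up to any time y
      before which U is positive. Applied first at a hypothetical first zero, it then yields
      positivity up to \<open>t1\<close>.\<close>
    have trapped: "energy (U x) (\<theta> * U x - P x) \<le> - e \<and>
        (s + T \<le> x \<longrightarrow> energy (U x) (\<theta> * U x - P x) \<le> Emin + 2 * e)"
      if y: "y \<le> t1" and pos: "\<And>z. z < y \<Longrightarrow> U z > 0" and x: "s \<le> x" "x < y" for x y
    proof (rule trap[where G = "\<lambda>t. pert t (U t)" and V = "\<lambda>t. \<theta> * U t - P t" and U = U and s = s])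
      fix z assume z: "s \<le> z" "z < y"
      have zt: "z \<le> t0" "z \<le> t2" using z y by (auto simp: t1_def)
      have fl: "flow U P z \<and> U z > 0 \<and> P z \<ge> 0" if "z < y" for z
        using that y reg pos regular_P_nonneg[OF reg, of z] by (auto simp: regular_orbit_def t1_def)
      have yt: "y \<le> t0" using y by (simp add: t1_def)
      have UP: "U z \<le> CU" "P z \<le> CP"
        using U_le_CU[OF fl yt z(2)] P_le_CP[OF fl yt z(2)] reg by (auto simp: regular_orbit_def)
      have "U z \<le> C \<and> \<bar>\<theta> * U z - P z\<bar> \<le> C"
        using UP fl[OF z(2)] CU_pos by (intro orbit_bounds[of U z CU P CP]) (auto simp: C_def)
      then show "orbit (\<lambda>t. pert t (U t)) U (\<lambda>t. \<theta> * U t - P t) z \<and> U z \<le> C \<and>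
          \<bar>\<theta> * U z - P z\<bar> \<le> C \<and> \<bar>pert z (U z)\<bar> \<le> w"
        using flow_orbit fl[OF z(2)] t2[OF zt(2), of "U z"] by auto
    next
      show "energy (U s) (\<theta> * U s - P s) \<le> - 3 * e"
        using start[OF \<zeta> reg _ s_eq] s e by (auto simp: t1_def)
    qed (use x in auto)
    have pos: "U x > 0" if x: "x < t1" for x
    proof (rule ccontr)
      assume neg: "\<not> U x > 0"
      then have sx: "s < x" using pos_s[of x] by force
      have cont: "continuous_on {s..x} U"
      proof (intro continuous_at_imp_continuous_on ballI)
        fix z assume "z \<in> {s..x}"
        then have "flow U P z" using reg x by (auto simp: regular_orbit_def t1_def)
        then show "isCont U z" unfolding flow_def by (blast intro: DERIV_isCont)
      qed
      define Z where "Z = {s..x} \<inter> U -` {..0}"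
      have "x \<in> Z" using neg sx by (simp add: Z_def)
      then have Z: "Z \<noteq> {}" "bdd_below Z" "closed Z"
        using continuous_closed_preimage[OF cont closed_atLeastAtMost closed_atMost]
        by (auto simp: Z_def not_less intro: bdd_belowI[of _ s])
      define y where "y = Inf Z"
      have yZ: "y \<in> Z" unfolding y_def by (rule closed_contains_Inf[OF Z])
      have y: "s \<le> y" "y \<le> x" "U y \<le> 0" using yZ by (auto simp: Z_def)
      have sy: "s < y" using y pos_s[of s] by (cases "s = y") auto
      have pos_y: "U z > 0" if z: "z < y" for z
      proof (rule ccontr)
        assume n: "\<not> U z > 0"
        then have "s < z" using pos_s[of z] by force
        then have "z \<in> Z" using n z y by (auto simp: Z_def)
        then have "y \<le> z" unfolding y_def using Z by (intro cInf_lower)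
        then show False using z by simp
      qed
      have "flow U P y" using reg y x by (auto simp: regular_orbit_def t1_def)
      then have "isCont U y" unfolding flow_def by (blast intro: DERIV_isCont)
      then have "(U \<longlongrightarrow> U y) (at_left y)" by (simp add: continuous_at filterlim_at_split)
      \<comment> \<open>Energy at most - e forces spring U^2 / 2 \<ge> e, so U stays away from 0 up
        to y and cannot reach it there.\<close>
      moreover have "\<forall>\<^sub>F z in at_left y. sqrt (2 * e / spring) \<le> U z"
        unfolding eventually_at_left_field
      proof (intro exI[of _ s] conjI sy allI impI)
        fix z assume z: "s < z" "z < y"
        then have "energy (U z) (\<theta> * U z - P z) \<le> - e"
          using trapped[of y z] pos_y y x by auto
        moreover have "k0 * U z powr (p + 1) / (p + 1) \<ge> 0" using k0_pos p_gt by simp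
        moreover have "(\<theta> * U z - P z)\<^sup>2 \<ge> 0" by simp
        ultimately have "2 * e \<le> spring * (U z)\<^sup>2" unfolding energy_def by linarith
        then have "2 * e / spring \<le> (U z)\<^sup>2" using spring_pos by (simp add: field_simps)
        then show "sqrt (2 * e / spring) \<le> U z" using pos_y[OF z(2)] by (intro real_le_lsqrt) auto
      qed
      ultimately have "sqrt (2 * e / spring) \<le> U y" by (rule tendsto_lowerbound) simp
      moreover have "sqrt (2 * e / spring) > 0" using e spring_pos by simp
      ultimately show False using y by simp
    qed
    have "energy (U t) (\<theta> * U t - P t) \<le> Emin + 2 * e"
      using trapped[of t1 t] pos s t T by auto
    then have "energy (U t) (\<theta> * U t - P t) \<le> Emin + e0" using e by linarith
    then show "0 < U t \<and> m \<le> U t" using e0(2) pos[OF t(2)] by blast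
  qed (use y0 in \<open>auto simp: t1_def\<close>)
qed

section \<open>Intersections\<close>

text \<open>In the difference of the two equations g cancels, and by the mean value theorem the
  zeroth-order coefficient is \<kappa> p z^(p-1) - \<open>spring\<close> with z above m. By
  \<open>osc\<close> it is at least w^2 + damp^2 / 4, the constant in the Sturm comparison.\<close>

lemma orbits_not_ordered:
  assumes w: "w > 0" and m: "m > 0" and tx: "x + pi / w \<le> t0"
    and fl: "\<And>t. x \<le> t \<Longrightarrow> t \<le> x + pi / w \<Longrightarrow> flow U1 P1 t \<and> flow U2 P2 t \<and> m \<le> U2 t \<and> U2 t < U1 t \<and> \<kappa>0 \<le> \<kappa> t"
    and \<kappa>0: "\<kappa>0 > 0" and osc: "w\<^sup>2 + damp\<^sup>2 / 4 + spring \<le> \<kappa>0 * (p * m powr (p - 1))"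
  shows False
proof (rule sturm_not_positive[OF w, where D = "\<lambda>t. U1 t - U2 t" and a = damp and x = x and
      D' = "\<lambda>t. (\<theta> * U1 t - P1 t) - (\<theta> * U2 t - P2 t)" and
      D'' = "\<lambda>t. (- damp * (\<theta> * U1 t - P1 t) + force (U1 t) - pert t (U1 t))
        - (- damp * (\<theta> * U2 t - P2 t) + force (U2 t) - pert t (U2 t))"])
  fix t assume t: "x \<le> t" "t \<le> x + pi / w"
  have U: "0 < m" "m \<le> U2 t" "U2 t < U1 t" "\<kappa>0 \<le> \<kappa> t" using fl[OF t] m by auto
  have orb: "orbit (\<lambda>t. pert t (U1 t)) U1 (\<lambda>t. \<theta> * U1 t - P1 t) t"
    "orbit (\<lambda>t. pert t (U2 t)) U2 (\<lambda>t. \<theta> * U2 t - P2 t) t"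
    using flow_orbit fl[OF t] m by auto
  show "((\<lambda>t. U1 t - U2 t) has_real_derivative (\<theta> * U1 t - P1 t) - (\<theta> * U2 t - P2 t)) (at t)"
    using orb unfolding orbit_def by (intro DERIV_diff) simp_all
  have "((\<lambda>t. \<theta> * U1 t - P1 t) has_real_derivative
     - damp * (\<theta> * U1 t - P1 t) + force (U1 t) - pert t (U1 t)) (at t)"
    "((\<lambda>t. \<theta> * U2 t - P2 t) has_real_derivative
     - damp * (\<theta> * U2 t - P2 t) + force (U2 t) - pert t (U2 t)) (at t)"
    using orb unfolding orbit_def by blast+
  then show "((\<lambda>t. (\<theta> * U1 t - P1 t) - (\<theta> * U2 t - P2 t)) has_real_derivative
     (- damp * (\<theta> * U1 t - P1 t) + force (U1 t) - pert t (U1 t))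
        - (- damp * (\<theta> * U2 t - P2 t) + force (U2 t) - pert t (U2 t))) (at t)"
    by (rule DERIV_diff)
  show "U1 t - U2 t > 0" using U by simp
  have "\<exists>z. U2 t < z \<and> z < U1 t \<and> U1 t powr p - U2 t powr p = (U1 t - U2 t) * (p * z powr (p - 1))"
    using U by (intro MVT2) (auto intro!: derivative_eq_intros)
  then obtain z where z: "U2 t < z" "U1 t powr p - U2 t powr p = (U1 t - U2 t) * (p * z powr (p - 1))" by auto
  have "m powr (p - 1) \<le> z powr (p - 1)" using z U p_gt by (intro powr_mono2) auto
  then have "\<kappa>0 * (p * m powr (p - 1)) \<le> \<kappa> t * (p * z powr (p - 1))"
    using U \<kappa>0 p_gt by (intro mult_mono mult_left_mono) auto
  then have "w\<^sup>2 + damp\<^sup>2 / 4 + spring \<le> \<kappa> t * (p * z powr (p - 1))" using osc by simp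
  then have "(w\<^sup>2 + damp\<^sup>2 / 4 + spring) * (U1 t - U2 t) \<le> \<kappa> t * (p * z powr (p - 1)) * (U1 t - U2 t)"
    using U by (intro mult_right_mono) auto
  also have "\<dots> = \<kappa> t * (U1 t powr p - U2 t powr p)" using z by simp
  finally show "(- damp * (\<theta> * U1 t - P1 t) + force (U1 t) - pert t (U1 t))
        - (- damp * (\<theta> * U2 t - P2 t) + force (U2 t) - pert t (U2 t))
      + damp * ((\<theta> * U1 t - P1 t) - (\<theta> * U2 t - P2 t)) + (w\<^sup>2 + damp\<^sup>2 / 4) * (U1 t - U2 t) \<le> 0"
    by (simp add: force_def pert_def algebra_simps)
qed

text \<open>A difference without zeros has constant sign, and \<open>orbits_not_ordered\<close>
  excludes either order.\<close>

lemma orbits_meet: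
  assumes w: "w > 0" and m: "m > 0" and tx: "x + pi / w \<le> t0"
    and fl: "\<And>t. x \<le> t \<Longrightarrow> t \<le> x + pi / w \<Longrightarrow> flow U1 P1 t \<and> flow U2 P2 t \<and> m \<le> U1 t \<and> m \<le> U2 t \<and> \<kappa>0 \<le> \<kappa> t"
    and \<kappa>0: "\<kappa>0 > 0" and osc: "w\<^sup>2 + damp\<^sup>2 / 4 + spring \<le> \<kappa>0 * (p * m powr (p - 1))"
  shows "\<exists>t. x \<le> t \<and> t \<le> x + pi / w \<and> U1 t = U2 t"
proof (rule ccontr)
  assume no: "\<not> ?thesis"
  have le: "x \<le> x + pi / w" using w by simp
  have cont: "continuous_on {x..x + pi / w} (\<lambda>t. U1 t - U2 t)"
  proof (intro continuous_at_imp_continuous_on ballI continuous_diff)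
    fix t assume "t \<in> {x..x + pi / w}"
    then have "flow U1 P1 t" "flow U2 P2 t" using fl by auto
    then show "isCont U1 t" "isCont U2 t" unfolding flow_def by (blast intro: DERIV_isCont)+
  qed
  have sign: "(0 < U1 s - U2 s) = (0 < U1 t - U2 t)" if st: "x \<le> s" "s \<le> t" "t \<le> x + pi / w" for s t
  proof (rule ccontr)
    assume neq: "\<not> ?thesis"
    have c: "continuous_on {s..t} (\<lambda>t. U1 t - U2 t)"
      using continuous_on_subset[OF cont, of "{s..t}"] st by auto
    have "U1 s - U2 s \<noteq> 0" "U1 t - U2 t \<noteq> 0" using no st by auto
    then consider "U1 s - U2 s \<le> 0" "0 \<le> U1 t - U2 t" | "0 \<le> U1 s - U2 s" "U1 t - U2 t \<le> 0"
      using neq by linarith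
    then have "\<exists>z\<ge>s. z \<le> t \<and> U1 z - U2 z = 0"
      by cases (use IVT'[OF _ _ st(2) c, of 0] IVT2'[OF _ _ st(2) c, of 0] in auto)
    then show False using no st by force
  qed
  show False
  proof (cases "0 < U1 x - U2 x")
    case True
    then have "U2 t < U1 t" if "x \<le> t" "t \<le> x + pi / w" for t using sign[of x t] that by auto
    then show False using orbits_not_ordered[OF w m tx _ \<kappa>0 osc, of U1 P1 U2 P2] fl by blast
  next
    case False
    then have "U1 t < U2 t" if "x \<le> t" "t \<le> x + pi / w" for t
      using sign[of x t] that no by (smt (verit))
    then show False using orbits_not_ordered[OF w m tx _ \<kappa>0 osc, of U2 P2 U1 P1] fl by blast
  qed
qed

text \<open>The regular orbit is above m from a time \<Delta> - ln \<zeta> / \<theta> on, the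
  singular one up to a fixed time. The common interval grows like ln \<zeta> / \<theta> and each
  window of length pi / w in it contains a meeting.\<close>

lemma many_intersections:
  assumes osc: "damp\<^sup>2 / 4 < (p - 1) * spring"
    and fl: "\<And>t. t < T \<Longrightarrow> flow Us Ps t \<and> Us t > 0"
    and sing: "filterlim (\<lambda>t. exp (- \<theta> * t) * Us t) at_top at_bot"
  obtains \<zeta>1 where "\<And>\<zeta> U P. \<zeta>1 \<le> \<zeta> \<Longrightarrow> regular_orbit \<zeta> U P \<Longrightarrow>
    \<exists>X. finite X \<and> card X = M \<and> (\<forall>x\<in>X. x < T \<and> U x = Us x)"
proof -
  \<comment> \<open>At the equilibrium k0 p Ueq^(p-1) = p \<open>spring\<close>, and q < 1 is the
    oscillation condition. The number s between q and 1 is the fraction of p \<open>spring\<close>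
    that suffices for oscillation with positive frequency w.\<close>
  define q where "q = (spring + damp\<^sup>2 / 4) / (p * spring)"
  define s where "s = (1 + q) / 2"
  have ps: "p * spring > 0" using p_gt spring_pos by simp
  have "spring + damp\<^sup>2 / 4 < p * spring" using osc by (simp add: algebra_simps)
  then have q: "q < 1" "0 < q"
    unfolding q_def using ps spring_pos by (auto intro!: divide_pos_pos add_pos_nonneg)
  then have s: "0 < s" "s < 1" "q < s" by (auto simp: s_def)
  then have sps: "spring + damp\<^sup>2 / 4 < s * (p * spring)" using ps by (simp add: q_def pos_divide_less_eq)
  define w where "w = sqrt (s * (p * spring) - spring - damp\<^sup>2 / 4)"
  have w: "w > 0" "w\<^sup>2 = s * (p * spring) - spring - damp\<^sup>2 / 4" using sps by (auto simp: w_def)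
  \<comment> \<open>The loss s is shared equally: one factor for \<kappa> \<ge> s' k0, the other for
    m^(p-1) = s' Ueq^(p-1).\<close>
  define s' where "s' = sqrt s"
  have s': "0 < s'" "s' < 1" "s' * s' = s" using s by (auto simp: s'_def)
  define m where "m = (s' * (spring / k0)) powr (1 / (p - 1))"
  have m: "m > 0" "m < Ueq" "m powr (p - 1) = s' * (spring / k0)"
  proof -
    show "m > 0" using s' spring_pos k0_pos by (simp add: m_def)
    have "s' * (spring / k0) < 1 * (spring / k0)" using s' spring_pos k0_pos by (intro mult_strict_right_mono) auto
    then show "m < Ueq" unfolding m_def Ueq_def using s' spring_pos k0_pos p_gt by (intro powr_less_mono2) auto
    show "m powr (p - 1) = s' * (spring / k0)" using s' spring_pos k0_pos p_gt by (simp add: m_def powr_powr)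
  qed
  have m_eq: "s' * k0 * (p * m powr (p - 1)) = s * (p * spring)"
    unfolding m(3) s'(3)[symmetric] using k0_pos by simp
  have osc': "w\<^sup>2 + damp\<^sup>2 / 4 + spring \<le> s' * k0 * (p * m powr (p - 1))"
    unfolding m_eq w(2) by simp
  have sk: "s' * k0 < k0" "s' * k0 > 0" using s' k0_pos by auto
  obtain t1 \<Delta> \<zeta>0 where t1: "t1 \<le> t0" "\<zeta>0 > 0" and
    reg_ge: "\<And>\<zeta> U P t. \<zeta>0 \<le> \<zeta> \<Longrightarrow> regular_orbit \<zeta> U P \<Longrightarrow> \<Delta> - ln \<zeta> / \<theta> \<le> t \<Longrightarrow> t < t1 \<Longrightarrow> 0 < U t \<and> m \<le> U t"
    using regular_orbits_ge[OF m(2)] by metis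
  have "\<forall>\<^sub>F t in at_bot. m \<le> Us t"
    using fl by (intro singular_orbit_ge[where T = "min T t0" and P = Ps, OF _ _ sing m(2)]) auto
  moreover have "\<forall>\<^sub>F t in at_bot. s' * k0 < \<kappa> t" using order_tendstoD(1)[OF \<kappa>_lim sk(1)] .
  ultimately have "\<forall>\<^sub>F t in at_bot. m \<le> Us t \<and> s' * k0 < \<kappa> t" by eventually_elim simp
  then obtain t2 where t2: "\<And>t. t \<le> t2 \<Longrightarrow> m \<le> Us t \<and> s' * k0 < \<kappa> t"
    unfolding eventually_at_bot_linorder by auto
  define te where "te = min (min t1 t2) T - 1"
  have te: "te < t1" "te \<le> t0" "te < T" "te \<le> t2" using t1 by (auto simp: te_def)
  define L where "L = pi / w"
  have L: "L > 0" using w by (simp add: L_def)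
  show ?thesis
  proof (rule that)
    \<comment> \<open>The threshold is the value of \<zeta> from which M windows with their gaps fit
      between the arrival time \<open>a\<close> and \<open>te\<close>.\<close>
    fix \<zeta> U P assume \<zeta>: "max \<zeta>0 (exp (\<theta> * (\<Delta> + 2 * real M * L - te))) \<le> \<zeta>" and reg: "regular_orbit \<zeta> U P"
    have \<zeta>_pos: "\<zeta> > 0" using \<zeta> t1 by simp
    define a where "a = \<Delta> - ln \<zeta> / \<theta>"
    have "\<theta> * (\<Delta> + 2 * real M * L - te) \<le> ln \<zeta>" using \<zeta> \<zeta>_pos by (simp add: ln_ge_iff)
    then have "\<Delta> + 2 * real M * L - te \<le> ln \<zeta> / \<theta>" using \<theta>_pos by (simp add: pos_le_divide_eq mult.commute)
    then have a: "a + 2 * real M * L \<le> te" by (simp add: a_def)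
    have win: "\<exists>x. a + 2 * real j * L \<le> x \<and> x \<le> a + 2 * real j * L + L \<and> (x < T \<and> U x = Us x)" if j: "j < M" for j
    proof -
      define b where "b = a + 2 * real j * L"
      have "(2 * real j + 1) * L \<le> 2 * real M * L" using j L by (intro mult_right_mono) auto
      then have b: "a \<le> b" "b + L \<le> te" using a L by (auto simp: b_def algebra_simps)
      have "\<exists>t. b \<le> t \<and> t \<le> b + pi / w \<and> U t = Us t"
      proof (rule orbits_meet[OF w(1) m(1) _ _ sk(2) osc'])
        show "b + pi / w \<le> t0" using b te by (simp add: L_def)
        fix t assume t: "b \<le> t" "t \<le> b + pi / w"
        then have t': "a \<le> t" "t \<le> te" using b by (auto simp: L_def)
        have "m \<le> U t" using reg_ge[OF _ reg, of t] \<zeta> t' te by (simp add: a_def)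
        moreover have "flow U P t" using reg t' te by (simp add: regular_orbit_def)
        moreover have "flow Us Ps t" using fl t' te by simp
        ultimately show "flow U P t \<and> flow Us Ps t \<and> m \<le> U t \<and> m \<le> Us t \<and> s' * k0 \<le> \<kappa> t"
          using t2[of t] t' te by auto
      qed
      then show ?thesis using b te unfolding b_def[symmetric] L_def[symmetric] by force
    qed
    from disjoint_window_points[of L M a "\<lambda>x. x < T \<and> U x = Us x", OF L win]
    show "\<exists>X. finite X \<and> card X = M \<and> (\<forall>x\<in>X. x < T \<and> U x = Us x)" by metis
  qed
qed

end

section \<open>Emden-Fowler variables\<close>

text \<open>The definition yields integrability of the whole kernel only, and the kernel depends on
  r. Splitting s^(-n) - r^(-n) with n = N - 2 gives u = \<zeta> - (G - r^(-n) H) / n, which can be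
  differentiated once both pieces are known to be integrable at 0.\<close>

lemma regular_solution_deriv:
  fixes K f u :: "real \<Rightarrow> real" and N :: nat
  assumes N: "N \<ge> 3" and K: "continuous_on {0<..} K" "\<And>r. r > 0 \<Longrightarrow> K r \<ge> 0"
    and f: "continuous_on {0<..} f" "\<And>r. r > 0 \<Longrightarrow> f r \<ge> 0" and \<mu>: "\<mu> \<ge> 0" and p: "p > 0"
    and sol: "regular_solution N K f \<mu> p \<zeta> u"
  obtains H where "\<And>r. r > 0 \<Longrightarrow> (u has_real_derivative - (r powr (1 - real N) * H r)) (at r)"
    "\<And>r. r > 0 \<Longrightarrow> (H has_real_derivative r powr (real N - 1) * (K r * (max (u r) 0) powr p + \<mu> * f r)) (at r)"
    "(H \<longlongrightarrow> 0) (at_right 0)"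
proof -
  define F where "F s = K s * (max (u s) 0) powr p + \<mu> * f s" for s
  define n where "n = real N - 2"
  have n: "n > 0" using N by (simp add: n_def)
  have u_cont: "continuous_on {0..} u" using sol by (simp add: regular_solution_def)
  have F_cont: "continuous_on {0<..} F" unfolding F_def[abs_def]
    using p by (intro continuous_intros continuous_on_powr' K f continuous_on_subset[OF u_cont]) auto
  have F_nonneg: "F s \<ge> 0" if "s > 0" for s using K f \<mu> that by (simp add: F_def)
  define h where "h s = s powr (n + 1) * F s" for s
  define W where "W r s = (s powr (- n) - r powr (- n)) / n * h s" for r s
  have W: "(W r has_integral (\<zeta> - u r)) {0..r}" if "r \<ge> 0" for r
  proof -
    have eq: "2 - real N = - n" "real N - 2 = n" "real N - 1 = n + 1" by (auto simp: n_def)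
    show ?thesis
      using sol that unfolding regular_solution_def eq F_def[symmetric] W_def[abs_def] h_def
      by (simp add: mult.assoc)
  qed
  have h_cont: "continuous_on {0<..} h" unfolding h_def
    by (intro continuous_intros F_cont) auto
  have h_nonneg: "h s \<ge> 0" if "s \<ge> 0" for s using F_nonneg[of s] that by (cases "s = 0") (auto simp: h_def)
  \<comment> \<open>Continuity of the integrand is known only on r > 0, so measurability and
    domination are checked on a half-open interval; the point 0 is negligible.\<close>
  have half_open: "g integrable_on {0<..r} \<longleftrightarrow> g integrable_on {0..r}" for g :: "real \<Rightarrow> real" and r :: real
  proof -
    have "negligible {x \<in> {0..r} - {0<..r}. g x \<noteq> 0}"
      by (rule negligible_subset[of "{0}"]) (simp, force)
    moreover have "negligible {x \<in> {0<..r} - {0..r}. g x \<noteq> 0}"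
      by (rule negligible_subset[of "{}"]) (simp, force)
    ultimately show ?thesis 
      using integrable_spike_set[of g "{0..r}" "{0<..r}"] integrable_spike_set[of g "{0<..r}" "{0..r}"] by blast
  qed
  have h_int: "h integrable_on {0..r}" if r: "r > 0" for r
  proof -
    \<comment> \<open>The kernel for radius r degenerates at s = r, the one for radius 2 r does not:
      on (0, r] its weight is at least \<open>d\<close>, so it dominates d h.\<close>
    define d where "d = (r powr (- n) - (2 * r) powr (- n)) / n"
    have d: "d > 0" using r n unfolding d_def by (intro divide_pos_pos) (auto intro!: powr_less_mono2_neg)
    have "W (2 * r) integrable_on {0..2 * r}" using W[of "2 * r"] r by (auto simp: integrable_on_def)
    then have "W (2 * r) integrable_on {0..r}" by (rule integrable_on_subinterval) (use r in auto)
    then have "(\<lambda>s. (1 / d) * W (2 * r) s) integrable_on {0..r}" by (intro integrable_on_mult_right)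
    then have int: "(\<lambda>s. (1 / d) * W (2 * r) s) integrable_on {0<..r}" by (simp only: half_open)
    have "h integrable_on {0<..r}"
    proof (rule measurable_bounded_by_integrable_imp_integrable[OF _ int])
      show "h \<in> borel_measurable (lebesgue_on {0<..r})"
        by (intro continuous_imp_measurable_on_sets_lebesgue continuous_on_subset[OF h_cont]) auto
      fix s assume s: "s \<in> {0<..r}"
      have "r powr (- n) \<le> s powr (- n)" using s n by (intro powr_mono2') auto
      then have "d \<le> (s powr (- n) - (2 * r) powr (- n)) / n"
        unfolding d_def using n by (intro divide_right_mono) auto
      then have "d * h s \<le> W (2 * r) s" unfolding W_def using h_nonneg[of s] s by (intro mult_right_mono) auto
      then show "norm (h s) \<le> (1 / d) * W (2 * r) s" using d h_nonneg[of s] s by (simp add: field_simps)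
    qed auto
    then show ?thesis by (simp only: half_open)
  qed
  define H where "H r = integral {0..r} h" for r
  define k where "k s = s powr (- n) * h s" for s
  have k_eq: "k s = n * W r s + r powr (- n) * h s" for r s
    using n by (simp add: k_def W_def field_simps)
  have k_int: "k integrable_on {0..r}" if r: "r > 0" for r
  proof -
    have "(\<lambda>s. n * W r s + r powr (- n) * h s) integrable_on {0..r}"
      using W[of r] r h_int[OF r]
      by (intro integrable_add integrable_on_mult_right) (auto simp: integrable_on_def)
    moreover have "(\<lambda>s. n * W r s + r powr (- n) * h s) = k" by (rule ext) (rule k_eq[symmetric])
    ultimately show ?thesis by (simp only:)
  qed
  define G where "G r = integral {0..r} k" for r
  have k_cont: "continuous_on {0<..} k" unfolding k_def
    by (intro continuous_intros h_cont) auto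
  have deriv: "((\<lambda>r. integral {0..r} g) has_real_derivative g r) (at r)"
    if int: "\<And>r. r > 0 \<Longrightarrow> g integrable_on {0..r}" and c: "continuous_on {0<..} g" and r: "r > 0" for g :: "real \<Rightarrow> real" and r
  proof -
    have "isCont g r" using c r by (simp add: continuous_on_eq_continuous_at)
    then have "continuous (at r within ({0..2 * r} - {})) g" by (simp add: continuous_at_imp_continuous_at_within)
    from integral_has_vector_derivative_continuous_at[OF int[of "2 * r"] _ _ this]
    have "((\<lambda>u. integral {0..u} g) has_vector_derivative g r) (at r within {0..2 * r})" using r by simp
    then show ?thesis
      using r by (simp add: has_real_derivative_iff_has_vector_derivative at_within_Icc_at)
  qed
  have H': "(H has_real_derivative h r) (at r)" and G': "(G has_real_derivative k r) (at r)" if "r > 0" for r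
    unfolding H_def[abs_def] G_def[abs_def] using deriv h_int h_cont k_int k_cont that by blast+
  have u_eq: "u r = \<zeta> - (G r - r powr (- n) * H r) / n" if r: "r > 0" for r
  proof -
    have "(k has_integral G r) {0..r}" "(h has_integral H r) {0..r}"
      using h_int[OF r] k_int[OF r] by (auto simp: G_def H_def intro: integrable_integral)
    then have "((\<lambda>s. (1 / n) * (k s - r powr (- n) * h s)) has_integral (1 / n) * (G r - r powr (- n) * H r)) {0..r}"
      by (intro has_integral_mult_right has_integral_diff)
    moreover have "(\<lambda>s. (1 / n) * (k s - r powr (- n) * h s)) = W r"
      using n by (simp add: fun_eq_iff W_def k_def left_diff_distrib)
    ultimately have "(1 / n) * (G r - r powr (- n) * H r) = \<zeta> - u r"
      using W[of r] r by (auto intro: has_integral_unique)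
    then show ?thesis by simp
  qed
  show ?thesis
  proof (rule that)
    fix r :: real assume r: "r > 0"
    show "(H has_real_derivative r powr (real N - 1) * (K r * (max (u r) 0) powr p + \<mu> * f r)) (at r)"
      using H'[OF r] by (simp add: h_def F_def n_def)
    have 1: "((\<lambda>r. r powr (- n)) has_real_derivative - n * r powr (- n - 1)) (at r)"
      using r by (auto intro!: derivative_eq_intros)
    have "((\<lambda>r. \<zeta> - (G r - r powr (- n) * H r) / n) has_real_derivative
        0 - (k r - (- n * r powr (- n - 1) * H r + h r * r powr (- n))) / n) (at r)"
      by (intro DERIV_diff DERIV_const DERIV_cdivide DERIV_mult 1 H'[OF r] G'[OF r])
    \<comment> \<open>The terms with k and h cancel because k r = r^(-n) h r; only the derivative of
      r^(-n) remains.\<close>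
    also have "0 - (k r - (- n * r powr (- n - 1) * H r + h r * r powr (- n))) / n = - (r powr (1 - real N) * H r)"
    proof -
      have e: "- n - 1 = 1 - real N" by (simp add: n_def)
      show ?thesis unfolding e using n by (simp add: k_def mult.commute)
    qed
    finally show "(u has_real_derivative - (r powr (1 - real N) * H r)) (at r)"
      using r u_eq by (auto intro: has_field_derivative_transform_within_open[of _ _ _ "{0<..}"])
  next
    have "continuous_on {0..1} H"
      unfolding H_def[abs_def] by (intro indefinite_integral_continuous_1 h_int) simp
    then have "(H \<longlongrightarrow> H 0) (at_right 0)" by (intro continuous_on_Icc_at_rightD) auto
    then show "(H \<longlongrightarrow> 0) (at_right 0)" by (simp add: H_def)
  qed
qed

text \<open>H = - r^(N-1) u' turns the equation into the system already obtained for regular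
  solutions; \<open>max\<close> may be inserted since u is positive.\<close>

lemma singular_solution_deriv:
  fixes K f u :: "real \<Rightarrow> real" and N :: nat
  assumes sol: "singular_solution N K f \<mu> p R u"
  obtains H where "\<And>r. 0 < r \<Longrightarrow> r < R \<Longrightarrow> (u has_real_derivative - (r powr (1 - real N) * H r)) (at r)"
    "\<And>r. 0 < r \<Longrightarrow> r < R \<Longrightarrow> (H has_real_derivative r powr (real N - 1) * (K r * (max (u r) 0) powr p + \<mu> * f r)) (at r)"
proof -
  from sol obtain u' u'' where u: "\<And>r. 0 < r \<Longrightarrow> r < R \<Longrightarrow> (u has_real_derivative u' r) (at r) \<and>
        (u' has_real_derivative u'' r) (at r) \<and> u r > 0 \<and>
        u'' r + (real N - 1) / r * u' r + K r * (u r) powr p + \<mu> * f r = 0"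
    unfolding singular_solution_def by (metis greaterThanLessThan_iff)
  define H where "H r = - (r powr (real N - 1) * u' r)" for r
  show ?thesis
  proof (rule that)
    fix r :: real assume r: "0 < r" "r < R"
    have "r powr (1 - real N) * r powr (real N - 1) = 1" using r by (simp add: powr_add[symmetric])
    then have "- (r powr (1 - real N) * H r) = u' r" by (simp add: H_def mult.assoc[symmetric])
    then show "(u has_real_derivative - (r powr (1 - real N) * H r)) (at r)" using u[OF r] by simp
    have "((\<lambda>r. r powr (real N - 1)) has_real_derivative (real N - 1) * r powr (real N - 1 - 1)) (at r)"
      using r by (auto intro!: derivative_eq_intros)
    then have "(H has_real_derivative
       - ((real N - 1) * r powr (real N - 1 - 1) * u' r + u'' r * r powr (real N - 1))) (at r)"
      unfolding H_def[abs_def] using u[OF r] by (intro DERIV_minus DERIV_mult) auto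
    also have "r powr (real N - 1 - 1) = r powr (real N - 1) / r" using r by (simp add: powr_diff power2_eq_square)
    also have "- ((real N - 1) * (r powr (real N - 1) / r) * u' r + u'' r * r powr (real N - 1))
       = r powr (real N - 1) * - (u'' r + (real N - 1) / r * u' r)" by (simp add: algebra_simps)
    also have "- (u'' r + (real N - 1) / r * u' r) = K r * (u r) powr p + \<mu> * f r"
      using u[OF r] by linarith
    also have "u r = max (u r) 0" using u[OF r] by simp
    finally show "(H has_real_derivative r powr (real N - 1) * (K r * (max (u r) 0) powr p + \<mu> * f r)) (at r)" .
  qed
qed

text \<open>Emden-Fowler variables \<open>t = ln r\<close>, \<open>U = r\<^sup>\<theta> u\<close>, \<open>P = - r\<^bsup>\<theta>+1\<^esup> u'\<close>.\<close>

lemma emden_fowler: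
  fixes K f u H :: "real \<Rightarrow> real" and n \<theta> p \<alpha> t :: real
  defines "r \<equiv> exp t"
  assumes u: "(u has_real_derivative - (r powr (- n - 1) * H r)) (at r)"
    and H: "(H has_real_derivative r powr (n + 1) * (K r * (max (u r) 0) powr p + \<mu> * f r)) (at r)"
    and \<theta>: "\<theta> * p = \<theta> + 2 + \<alpha>"
  shows "((\<lambda>t. exp (\<theta> * t) * u (exp t)) has_real_derivative
      \<theta> * (exp (\<theta> * t) * u r) - exp (- (n - \<theta>) * t) * H r) (at t)" (is ?thesis1)
    and "((\<lambda>t. exp (- (n - \<theta>) * t) * H (exp t)) has_real_derivative
      - (n - \<theta>) * (exp (- (n - \<theta>) * t) * H r) + (K r / r powr \<alpha>) * max (exp (\<theta> * t) * u r) 0 powr p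
      + \<mu> * exp ((\<theta> + 2) * t) * f r) (at t)" (is ?thesis2)
proof -
  have pw: "r powr a = exp (a * t)" for a by (simp add: r_def exp_powr_real mult.commute)
  have r_exp: "r = exp t" by (simp add: r_def)
  have u': "((\<lambda>t. u (exp t)) has_real_derivative - (r powr (- n - 1) * H r) * exp t) (at t)"
    using DERIV_chain2[OF u[unfolded r_exp] DERIV_exp] by (simp add: r_exp)
  have H': "((\<lambda>t. H (exp t)) has_real_derivative r powr (n + 1) * (K r * (max (u r) 0) powr p + \<mu> * f r) * exp t) (at t)"
    using DERIV_chain2[OF H[unfolded r_exp] DERIV_exp] by (simp add: r_exp)
  have ex: "((\<lambda>t. exp (a * t)) has_real_derivative a * exp (a * t)) (at t)" for a
    by (auto intro!: derivative_eq_intros)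
  have e1: "exp (\<theta> * t) * (r powr (- n - 1) * exp t) = exp (- (n - \<theta>) * t)"
    unfolding pw by (simp add: exp_add[symmetric] algebra_simps)
  have "((\<lambda>t. exp (\<theta> * t) * u (exp t)) has_real_derivative
      \<theta> * exp (\<theta> * t) * u (exp t) + - (r powr (- n - 1) * H r) * exp t * exp (\<theta> * t)) (at t)"
    by (intro DERIV_mult ex u')
  also have "\<theta> * exp (\<theta> * t) * u (exp t) + - (r powr (- n - 1) * H r) * exp t * exp (\<theta> * t)
     = \<theta> * (exp (\<theta> * t) * u r) - (exp (\<theta> * t) * (r powr (- n - 1) * exp t)) * H r"
    by (simp add: r_exp algebra_simps)
  finally show ?thesis1 unfolding e1 .
  have max_eq: "max (exp (\<theta> * t) * u r) 0 = exp (\<theta> * t) * max (u r) 0"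
    by (simp add: max_def zero_le_mult_iff mult_le_0_iff)
  have e2: "exp (- (n - \<theta>) * t) * (r powr (n + 1) * exp t) = exp ((\<theta> + 2) * t)"
    unfolding pw by (simp add: exp_add[symmetric] algebra_simps)
  \<comment> \<open>This is where \<theta> is determined: \<theta> p - \<alpha> = \<theta> + 2 makes
    the nonlinear term autonomous up to \<kappa>.\<close>
  have "exp (\<theta> * p * t) / r powr \<alpha> = exp ((\<theta> + 2) * t)"
    unfolding pw \<theta> by (simp add: exp_diff[symmetric] algebra_simps)
  then have e3: "(K r / r powr \<alpha>) * max (exp (\<theta> * t) * u r) 0 powr p = exp ((\<theta> + 2) * t) * (K r * max (u r) 0 powr p)"
    unfolding max_eq by (simp add: powr_mult exp_powr_real divide_inverse mult_ac)
  have "((\<lambda>t. exp (- (n - \<theta>) * t) * H (exp t)) has_real_derivative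
      - (n - \<theta>) * exp (- (n - \<theta>) * t) * H (exp t)
      + r powr (n + 1) * (K r * (max (u r) 0) powr p + \<mu> * f r) * exp t * exp (- (n - \<theta>) * t)) (at t)"
    by (intro DERIV_mult ex H')
  also have "- (n - \<theta>) * exp (- (n - \<theta>) * t) * H (exp t)
      + r powr (n + 1) * (K r * (max (u r) 0) powr p + \<mu> * f r) * exp t * exp (- (n - \<theta>) * t)
      = - (n - \<theta>) * (exp (- (n - \<theta>) * t) * H r)
      + (exp (- (n - \<theta>) * t) * (r powr (n + 1) * exp t)) * (K r * (max (u r) 0) powr p + \<mu> * f r)"
    by (simp add: r_exp mult_ac)
  also have "(exp (- (n - \<theta>) * t) * (r powr (n + 1) * exp t)) * (K r * (max (u r) 0) powr p + \<mu> * f r)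
      = (K r / r powr \<alpha>) * max (exp (\<theta> * t) * u r) 0 powr p + \<mu> * exp ((\<theta> + 2) * t) * f r"
    unfolding e2 e3 by (simp add: algebra_simps)
  finally show ?thesis2 by (simp add: add.assoc)
qed

section \<open>The exponents and the count of zeros\<close>

text \<open>Put \<beta> = 2 + \<alpha> = \<theta> (p - 1) and x = n - 2 \<theta>. The oscillation
  condition reads x^2 - 2 \<beta> x - 2 \<beta> n < 0, and the positive root of this quadratic is
  \<beta> + s with s^2 = \<beta> (2 n + \<beta>). So it says n - \<beta> - s < 2 \<theta>, which for
  N > 10 + 4 \<alpha> is p < p_JL rearranged.\<close>

lemma below_JL_oscillates:
  fixes N :: nat and \<alpha> p :: real
  assumes N: "N \<ge> 3" and \<alpha>: "\<alpha> > -2" and pS: "p_S N \<alpha> < p" and pJL: "ereal p < p_JL N \<alpha>"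
  defines "n \<equiv> real N - 2" and "\<theta> \<equiv> (2 + \<alpha>) / (p - 1)"
  shows "p > 1" "\<theta> > 0" "\<theta> * p = \<theta> + 2 + \<alpha>" "n - \<theta> > \<theta>"
    "(n - \<theta> - \<theta>)\<^sup>2 / 4 < (p - 1) * (\<theta> * (n - \<theta>))"
proof -
  define \<beta> where "\<beta> = 2 + \<alpha>"
  have \<beta>: "\<beta> > 0" using \<alpha> by (simp add: \<beta>_def)
  have n: "n \<ge> 1" using N by (simp add: n_def)
  have "p_S N \<alpha> = (n + 2 * \<beta>) / n" by (simp add: p_S_def n_def \<beta>_def)
  then have "n + 2 * \<beta> < p * n" using pS n by (simp add: pos_divide_less_eq)
  then have pn: "2 * \<beta> < (p - 1) * n" by (simp add: algebra_simps)
  then have "0 < (p - 1) * n" using \<beta> by linarith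
  then show p: "p > 1" using n by (simp add: zero_less_mult_iff)
  have \<theta>_eq: "\<theta> * (p - 1) = \<beta>" using p by (simp add: \<theta>_def \<beta>_def)
  show \<theta>: "\<theta> > 0" using p \<beta> by (simp add: \<theta>_def \<beta>_def)
  show "\<theta> * p = \<theta> + 2 + \<alpha>" using \<theta>_eq by (simp add: \<beta>_def algebra_simps)
  have "(p - 1) * (2 * \<theta>) < (p - 1) * n" using pn \<theta>_eq by (simp add: algebra_simps)
  then have n2: "2 * \<theta> < n" using p by simp
  then show "n - \<theta> > \<theta>" by simp
  define s where "s = sqrt (\<beta> * (2 * n + \<beta>))"
  have s: "s \<ge> 0" "s\<^sup>2 = \<beta> * (2 * n + \<beta>)" using \<beta> n by (auto simp: s_def)
  have s_eq: "sqrt ((2 + \<alpha>) * (2 * real N - 2 + \<alpha>)) = s"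
    by (simp add: s_def \<beta>_def n_def)
  have lt: "n - \<beta> - s < 2 * \<theta>"
  proof (cases "real N > 10 + 4 * \<alpha>")
    case True
    have "n - \<beta> = real N - 4 - \<alpha>" by (simp add: n_def \<beta>_def)
    then have pd: "p < 1 + 2 * \<beta> / (n - \<beta> - s)"
      using pJL True unfolding p_JL_def s_eq by (simp add: \<beta>_def[symmetric])
    show ?thesis
    proof (cases "n - \<beta> - s > 0")
      case d: True
      then have "(p - 1) * (n - \<beta> - s) < 2 * \<beta>" using pd by (simp add: field_simps)
      also have "2 * \<beta> = (p - 1) * (2 * \<theta>)" using \<theta>_eq by (simp add: algebra_simps)
      finally show ?thesis using p by simp
    qed (use \<theta> in simp)
  next
    case False
    \<comment> \<open>In low dimension n - \<beta> \<le> s, so the condition holds for every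
      positive \<theta>; this explains the value \<infinity> of \<open>p_JL\<close>.\<close>
    then have "n \<le> 4 * \<beta>" by (simp add: n_def \<beta>_def)
    then have "n * n \<le> n * (4 * \<beta>)" using n by (intro mult_left_mono) auto
    then have "(n - \<beta>)\<^sup>2 \<le> s\<^sup>2" unfolding s by (simp add: power2_eq_square algebra_simps)
    then have "n - \<beta> \<le> s" using s by (rule_tac power2_le_imp_le) auto
    then show ?thesis using \<theta> by simp
  qed
  define x where "x = n - 2 * \<theta>"
  have x: "x > 0" "x - \<beta> < s" using n2 lt by (auto simp: x_def)
  have "x\<^sup>2 < 2 * \<beta> * (x + n)"
  proof (cases "x \<le> \<beta>")
    case True
    then have "x * x \<le> \<beta> * x" using x by (intro mult_right_mono) auto
    moreover have "\<beta> * x > 0" "\<beta> * n > 0" using \<beta> x n by auto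
    moreover have "2 * \<beta> * (x + n) = 2 * (\<beta> * x) + 2 * (\<beta> * n)" by (simp add: algebra_simps)
    ultimately show ?thesis unfolding power2_eq_square by linarith
  next
    case False
    then have "(x - \<beta>)\<^sup>2 < s\<^sup>2" using x by (intro power_strict_mono) auto
    then show ?thesis unfolding s by (simp add: power2_eq_square algebra_simps)
  qed
  also have "2 * \<beta> * (x + n) = 4 * (\<beta> * (n - \<theta>))" by (simp add: x_def algebra_simps)
  also have "\<beta> * (n - \<theta>) = (p - 1) * (\<theta> * (n - \<theta>))" unfolding \<theta>_eq[symmetric] by simp
  also have "x = n - \<theta> - \<theta>" by (simp add: x_def)
  finally show "(n - \<theta> - \<theta>)\<^sup>2 / 4 < (p - 1) * (\<theta> * (n - \<theta>))" by linarith
qed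

lemma zero_count_ge:
  assumes X: "finite X" "card X = M" and sub: "\<And>x. x \<in> X \<Longrightarrow> r x \<in> I \<and> h (r x) = 0" and inj: "inj_on r X"
  shows "enat M \<le> zero_count I h"
proof (cases "finite {r \<in> I. h r = 0}")
  case True
  have "M = card (r ` X)" using X inj by (simp add: card_image)
  also have "\<dots> \<le> card {r \<in> I. h r = 0}" using True sub by (intro card_mono) auto
  finally show ?thesis using True by (simp add: zero_count_def)
qed (simp add: zero_count_def)

theorem theorem4p1:
  fixes N :: nat and \<mu> \<alpha> p rstar :: real
    and K f ustar :: "real \<Rightarrow> real" and u :: "real \<Rightarrow> real \<Rightarrow> real"
  assumes "N \<ge> 3" and "\<mu> \<ge> 0"
    and "cond_K0 K \<alpha>" and "cond_F0 f"
    and "p_S N \<alpha> < p" and "ereal p < p_JL N \<alpha>"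
    and "rstar > 0"
    and "singular_solution N K f \<mu> p rstar ustar"
    and "\<And>\<zeta>. \<zeta> > 0 \<Longrightarrow> regular_solution N K f \<mu> p \<zeta> (u \<zeta>)"
  shows "\<forall>\<rho>\<in>{0<..rstar}. \<forall>M::nat. eventually
           (\<lambda>\<zeta>. zero_count {0<..<\<rho>} (\<lambda>r. u \<zeta> r - ustar r) \<ge> enat M) at_top"
proof (intro ballI allI)
  fix \<rho> :: real and M :: nat
  assume \<rho>: "\<rho> \<in> {0<..rstar}"
  from assms(3) obtain k0 where \<alpha>: "\<alpha> > -2" and K: "continuous_on {0<..} K" "\<And>r. r > 0 \<Longrightarrow> K r > 0"
    and k0: "k0 > 0" "((\<lambda>r. K r / r powr \<alpha>) \<longlongrightarrow> k0) (at_right 0)"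
    unfolding cond_K0_def by auto
  from assms(4) obtain \<nu> where f: "continuous_on {0<..} f" "\<And>r. r > 0 \<Longrightarrow> f r \<ge> 0"
    and \<nu>: "\<nu> > -2" "f \<in> O[at_right 0](\<lambda>r. r powr \<nu>)"
    unfolding cond_F0_def by auto
  define n where "n = real N - 2"
  define \<theta> where "\<theta> = (2 + \<alpha>) / (p - 1)"
  note JL = below_JL_oscillates[OF assms(1) \<alpha> assms(5,6), folded n_def \<theta>_def]
  define \<kappa> where "\<kappa> t = K (exp t) / exp t powr \<alpha>" for t
  define g where "g t = \<mu> * exp ((\<theta> + 2) * t) * f (exp t)" for t
  have exp_right: "filterlim (exp :: real \<Rightarrow> real) (at_right 0) at_bot"
    by (auto simp: filterlim_at exp_at_bot)
  have \<kappa>_lim: "(\<kappa> \<longlongrightarrow> k0) at_bot"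
    unfolding \<kappa>_def[abs_def] by (rule filterlim_compose[OF k0(2) exp_right])
  obtain Cf where Cf: "Cf > 0" "\<forall>\<^sub>F r in at_right 0. norm (f r) \<le> Cf * norm (r powr \<nu>)"
    using \<nu>(2) by (elim landau_o.bigE) auto
  have "\<forall>\<^sub>F t in at_bot. norm (f (exp t)) \<le> Cf * norm (exp t powr \<nu>)"
    using Cf(2) exp_right by (rule eventually_compose_filterlim)
  moreover have "\<forall>\<^sub>F t in at_bot. k0 / 2 < \<kappa> t" "\<forall>\<^sub>F t in at_bot. \<kappa> t < 2 * k0"
    using order_tendstoD(1)[OF \<kappa>_lim, of "k0 / 2"] order_tendstoD(2)[OF \<kappa>_lim, of "2 * k0"] k0(1) by simp_all
  moreover have "\<forall>\<^sub>F t::real in at_bot. t \<le> 0" by (rule eventually_le_at_bot)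
  ultimately have "\<forall>\<^sub>F t in at_bot. norm (f (exp t)) \<le> Cf * norm (exp t powr \<nu>) \<and> k0 / 2 < \<kappa> t \<and> \<kappa> t < 2 * k0 \<and> t \<le> 0"
    by eventually_elim simp
  then obtain t0 where t0: "\<And>t. t \<le> t0 \<Longrightarrow>
      norm (f (exp t)) \<le> Cf * norm (exp t powr \<nu>) \<and> k0 / 2 < \<kappa> t \<and> \<kappa> t < 2 * k0 \<and> t \<le> 0"
    unfolding eventually_at_bot_linorder by blast
  interpret emden_perturbed \<theta> "n - \<theta>" p k0 \<kappa> g "\<mu> * Cf" "\<theta> + 2 + \<nu>" t0
  proof
    fix t assume t: "t \<le> t0"
    show "k0 / 2 \<le> \<kappa> t \<and> \<kappa> t \<le> 2 * k0" using t0[OF t] by simp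
    have "f (exp t) \<le> Cf * exp (\<nu> * t)"
      using t0[OF t] f(2)[of "exp t"] by (simp add: exp_powr_real mult.commute)
    then have "g t \<le> \<mu> * exp ((\<theta> + 2) * t) * (Cf * exp (\<nu> * t))"
      unfolding g_def using assms(2) by (intro mult_left_mono) auto
    also have "\<dots> = \<mu> * Cf * (exp ((\<theta> + 2) * t) * exp (\<nu> * t))" by simp
    also have "exp ((\<theta> + 2) * t) * exp (\<nu> * t) = exp ((\<theta> + 2 + \<nu>) * t)"
      by (simp add: exp_add[symmetric] algebra_simps)
    finally show "0 \<le> g t \<and> g t \<le> \<mu> * Cf * exp ((\<theta> + 2 + \<nu>) * t)"
      using assms(2) f(2)[of "exp t"] by (simp add: g_def)
  qed (use JL k0 \<kappa>_lim \<nu>(1) t0[of t0] in auto)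
  have N_eq: "1 - real N = - n - 1" "real N - 1 = n + 1" by (auto simp: n_def)
  obtain Hs where Hs: "\<And>r. 0 < r \<Longrightarrow> r < rstar \<Longrightarrow> (ustar has_real_derivative - (r powr (- n - 1) * Hs r)) (at r)"
    "\<And>r. 0 < r \<Longrightarrow> r < rstar \<Longrightarrow> (Hs has_real_derivative r powr (n + 1) * (K r * (max (ustar r) 0) powr p + \<mu> * f r)) (at r)"
    using singular_solution_deriv[OF assms(8)] unfolding N_eq by metis
  have flow_Hs: "flow (\<lambda>t. exp (\<theta> * t) * v (exp t)) (\<lambda>t. exp (- (n - \<theta>) * t) * H (exp t)) t"
    if "(v has_real_derivative - (exp t powr (- n - 1) * H (exp t))) (at (exp t))"
      "(H has_real_derivative exp t powr (n + 1) * (K (exp t) * (max (v (exp t)) 0) powr p + \<mu> * f (exp t))) (at (exp t))"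
    for v H :: "real \<Rightarrow> real" and t
    unfolding flow_def \<kappa>_def g_def 
    using emden_fowler[where u = v and H = H and K = K and f = f and t = t and n = n, OF that JL(3)]
    by (auto simp: add.assoc)
  define Us where "Us t = exp (\<theta> * t) * ustar (exp t)" for t
  define Ps where "Ps t = exp (- (n - \<theta>) * t) * Hs (exp t)" for t
  \<comment> \<open>Restricting to t < ln \<rho> puts the meeting points into (0, \<rho>), and hence
    inside the interval where the singular solution is given.\<close>
  have ln_\<rho>: "0 < exp t" "exp t < \<rho>" "exp t < rstar" if "t < ln \<rho>" for t
  proof -
    have "exp t < \<rho>" using exp_less_mono[OF that] \<rho> by (metis exp_ln greaterThanAtMost_iff)
    then show "0 < exp t" "exp t < \<rho>" "exp t < rstar" using \<rho> by auto
  qed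
  have fl_s: "flow Us Ps t \<and> Us t > 0" if t: "t < ln \<rho>" for t
  proof
    show "flow Us Ps t"
      unfolding Us_def[abs_def] Ps_def[abs_def] using Hs ln_\<rho>[OF t] by (intro flow_Hs) auto
    have "ustar (exp t) > 0" using assms(8) ln_\<rho>[OF t] by (auto simp: singular_solution_def)
    then show "Us t > 0" by (simp add: Us_def)
  qed
  have sing: "filterlim (\<lambda>t. exp (- \<theta> * t) * Us t) at_top at_bot"
  proof -
    have "filterlim (\<lambda>t. ustar (exp t)) at_top at_bot"
      using assms(8) exp_right unfolding singular_solution_def by (blast intro: filterlim_compose)
    moreover have "exp (- \<theta> * t) * Us t = ustar (exp t)" for t
      by (simp add: Us_def mult.assoc[symmetric] exp_add[symmetric])
    ultimately show ?thesis by simp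
  qed
  have osc: "damp\<^sup>2 / 4 < (p - 1) * spring" using JL(5) by (simp add: damp_def spring_def)
  obtain \<zeta>1 where \<zeta>1: "\<And>\<zeta> U P. \<zeta>1 \<le> \<zeta> \<Longrightarrow> regular_orbit \<zeta> U P \<Longrightarrow>
    \<exists>X. finite X \<and> card X = M \<and> (\<forall>x\<in>X. x < ln \<rho> \<and> U x = Us x)"
    using many_intersections[OF osc fl_s sing, where M = M] by blast
  show "\<forall>\<^sub>F \<zeta> in at_top. zero_count {0<..<\<rho>} (\<lambda>r. u \<zeta> r - ustar r) \<ge> enat M"
    using eventually_ge_at_top[of \<zeta>1] eventually_gt_at_top[of 0]
  proof eventually_elim
    case (elim \<zeta>)
    have sol: "regular_solution N K f \<mu> p \<zeta> (u \<zeta>)" using assms(9) elim by simp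
    have p0: "p > 0" using JL(1) by simp
    obtain H where H: "\<And>r. r > 0 \<Longrightarrow> (u \<zeta> has_real_derivative - (r powr (- n - 1) * H r)) (at r)"
      "\<And>r. r > 0 \<Longrightarrow> (H has_real_derivative r powr (n + 1) * (K r * (max (u \<zeta> r) 0) powr p + \<mu> * f r)) (at r)"
      "(H \<longlongrightarrow> 0) (at_right 0)"
      using regular_solution_deriv[OF assms(1) K(1) less_imp_le[OF K(2)] f assms(2) p0 sol] unfolding N_eq by metis
    define U where "U t = exp (\<theta> * t) * u \<zeta> (exp t)" for t
    define P where "P t = exp (- (n - \<theta>) * t) * H (exp t)" for t
    have "regular_orbit \<zeta> U P" unfolding regular_orbit_def
    proof (intro conjI allI impI)
      show "flow U P t" for t
        unfolding U_def[abs_def] P_def[abs_def] using H(1,2) by (intro flow_Hs) auto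
      have "exp ((n - \<theta>) * t) * P t = H (exp t)" for t
        by (simp add: P_def mult.assoc[symmetric] exp_add[symmetric] distrib_right[symmetric])
      then show "((\<lambda>t. exp ((n - \<theta>) * t) * P t) \<longlongrightarrow> 0) at_bot"
        using filterlim_compose[OF H(3) exp_right] by simp
      have "exp (- \<theta> * t) * U t = u \<zeta> (exp t)" for t
        by (simp add: U_def mult.assoc[symmetric] exp_add[symmetric])
      moreover have "(u \<zeta> \<longlongrightarrow> \<zeta>) (at_right 0)"
      proof -
        \<comment> \<open>At r = 0 the integral equation runs over a degenerate interval, which
          yields u(0) = \<zeta>.\<close>
        obtain W :: "real \<Rightarrow> real" where "(W has_integral (\<zeta> - u \<zeta> 0)) {0..0}"
          using sol unfolding regular_solution_def by blast
        then have "\<zeta> - u \<zeta> 0 = 0" by (intro has_integral_unique[OF _ has_integral_refl(2)]) simp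
        then have "u \<zeta> 0 = \<zeta>" by simp
        moreover have "continuous_on {0..1} (u \<zeta>)"
          using sol unfolding regular_solution_def by (auto intro: continuous_on_subset)
        then have "(u \<zeta> \<longlongrightarrow> u \<zeta> 0) (at_right 0)" by (intro continuous_on_Icc_at_rightD) auto
        ultimately show ?thesis by simp
      qed
      ultimately show "((\<lambda>t. exp (- \<theta> * t) * U t) \<longlongrightarrow> \<zeta>) at_bot"
        using filterlim_compose[OF _ exp_right, of "u \<zeta>" "nhds \<zeta>"] by simp
    qed
    from \<zeta>1[OF elim(1) this] obtain X where X: "finite X" "card X = M" "\<And>x. x \<in> X \<Longrightarrow> x < ln \<rho> \<and> U x = Us x"
      by blast
    show ?case
    proof (rule zero_count_ge[OF X(1,2), where r = exp])
      fix x assume "x \<in> X"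
      then show "exp x \<in> {0<..<\<rho>} \<and> u \<zeta> (exp x) - ustar (exp x) = 0"
        using X(3) ln_\<rho> by (auto simp: U_def Us_def)
    qed (simp add: inj_on_def)
  qed
qed

end
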